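(* Let $\mathcal H$ be a separable complex Hilbert space, let $H_0$ be a closed operator in $\mathcal H$ with $\rho(H_0)\neq\emptyset$, and let $V$ be a linear operator in $\mathcal H$ with $\operatorname{dom}(V)\supseteq\operatorname{dom}(H_0)$. Let $H=H_0+V$, $\operatorname{dom}(H)=\operatorname{dom}(H_0)$, and suppose that $\rho(H)\neq\emptyset$. Suppose further that $$K(z)=-V(H_0-zI_{\mathcal H})^{-1}\in\mathcal B(\mathcal H)\quad\text{for some (and hence for all) } z\in\rho(H_0).$$ Let $z_0\in\sigma_d(H_0)\cap\sigma(H)$ be such that $D(z_0;\varepsilon_0)\backslash\{z_0\}\subset\rho(H_0)\cap\rho(H)$ for some $\varepsilon_0>0$. Let $K_0(z_0)\in\mathcal B(\mathcal H)$ be the coefficient of $(z-z_0)^0$ in the Laurent expansion $K(z)=\sum_{k=-N_0}^\infty(z-z_0)^kK_k(z_0)$, $0<|z-z_0|<\varepsilon_0$, and suppose that $I_{\mathcal H}-K_0(z_0)$ is a Fredholm operator. Then $z_0$ is a discrete eigenvalue of $H$, that is, $z_0\in\sigma_d(H)$, and for $0<\varepsilon<\varepsilon_0$, $$m_a(z_0;H)=m_a(z_0;H_0)+\operatorname{ind}_{\partial D(z_0;\varepsilon)}(I_{\mathcal H}-K(\cdot)).$$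
   Context: $D(z_0;r)$ is the open disk of center $z_0$ and radius $r$; $\partial D(z_0;r)$ is its boundary circle, oriented counterclockwise. $\mathcal B(\mathcal H)$ denotes the bounded operators on $\mathcal H$. For a closed operator $A$ and an isolated point $\lambda_0$ of $\sigma(A)$, the Riesz projection is $P(\lambda_0;A)=\frac{-1}{2\pi i}\oint_{\partial D(\lambda_0;\varepsilon)}(A-\zeta I)^{-1}\,d\zeta$ with $\varepsilon>0$ small enough to exclude the rest of $\sigma(A)$. The discrete spectrum $\sigma_d(A)$ is the set of eigenvalues $\lambda$ of $A$ that are isolated points of $\sigma(A)$ with $\dim\operatorname{ran}P(\lambda;A)<\infty$; its elements are called discrete eigenvalues. For $\lambda\in\sigma_d(A)$ the algebraic multiplicity is $m_a(\lambda;A)=\dim\operatorname{ran}P(\lambda;A)$. Because $z_0\in\sigma_d(H_0)$, $K(\cdot)$ has a norm convergent Laurent expansion around $z_0$ of the stated form, with $K_k(z_0)$ of finite rank for $k<0$ and $K_k(z_0)\in\mathcal B(\mathcal H)$ for $k\ge0$. Index: let $M(\cdot)$ be a $\mathcal B(\mathcal H)$-valued function analytic on $D(z_0;\varepsilon_0)\backslash\{z_0\}$ with norm convergent Laurent expansion at $z_0$ having finitely many negative-power terms, all with finite-rank coefficients, with Fredholm zeroth coefficient, and such that $M(z)$ is boundedly invertible for $0<|z-z_0|<\varepsilon_0$. Then $\operatorname{ind}_{\partial D(z_0;\varepsilon)}(M(\cdot))=\operatorname{tr}_{\mathcal H}\Big(\frac1{2\pi i}\oint_{\partial D(z_0;\varepsilon)}M'(\zeta)M(\zeta)^{-1}\,d\zeta\Big)=\operatorname{tr}_{\mathcal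 H}\Big(\frac1{2\pi i}\oint_{\partial D(z_0;\varepsilon)}M(\zeta)^{-1}M'(\zeta)\,d\zeta\Big)$, $0<\varepsilon<\varepsilon_0$ (the contour integrals are finite-rank operators). *)

theory Defs
  imports "HOL-Complex_Analysis.Complex_Analysis"
begin

section \<open>Complex Hilbert spaces\<close>

text \<open>
  The complex structure is put on top of a complete real inner product space whose inner product
  is the real part of the complex one. Norm and topology are therefore the ones induced by
  \<open>cinner\<close>, and the library results on real Hilbert and Banach spaces apply. The complex inner
  product is linear in its second argument.
\<close>

class complex_hilbert_space = real_inner + complete_space +
  fixes scaleC :: "complex \<Rightarrow> 'a \<Rightarrow> 'a" (infixr "*\<^sub>C" 75)
    and cinner :: "'a \<Rightarrow> 'a \<Rightarrow> complex"
  assumes scaleC_add_right: "a *\<^sub>C (x + y) = a *\<^sub>C x + a *\<^sub>C y"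
    and scaleC_add_left: "(a + b) *\<^sub>C x = a *\<^sub>C x + b *\<^sub>C x"
    and scaleC_scaleC: "a *\<^sub>C b *\<^sub>C x = (a * b) *\<^sub>C x"
    and scaleC_of_real: "complex_of_real r *\<^sub>C x = r *\<^sub>R x"
    and cinner_commute: "cinner x y = cnj (cinner y x)"
    and cinner_add_right: "cinner x (y + z) = cinner x y + cinner x z"
    and cinner_scaleC_right: "cinner x (a *\<^sub>C y) = a * cinner x y"
    and Re_cinner: "Re (cinner x y) = inner x y"
begin

subclass banach ..

end

instantiation complex :: complex_hilbert_space
begin

definition scaleC_complex :: "complex \<Rightarrow> complex \<Rightarrow> complex"
  where "scaleC_complex a x = a * x"

definition cinner_complex :: "complex \<Rightarrow> complex \<Rightarrow> complex"
  where "cinner_complex x y = cnj x * y"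

instance
  by standard
    (simp_all add: scaleC_complex_def cinner_complex_def algebra_simps scaleR_conv_of_real
      inner_complex_def)

end

global_interpretation complex_vector: vector_space "scaleC :: complex \<Rightarrow> 'a \<Rightarrow> 'a::complex_hilbert_space"
  defines csubspace = complex_vector.subspace
    and cspan = complex_vector.span
    and cdim = complex_vector.dim
proof
  show "1 *\<^sub>C x = x" for x :: 'a
    using scaleC_of_real[of 1 x] by simp
qed (simp_all add: scaleC_add_right scaleC_add_left scaleC_scaleC)

lemma cinner_self: "cinner x x = complex_of_real ((norm x)\<^sup>2)"
  for x :: "'a::complex_hilbert_space"
proof -
  have "Im (cinner x x) = 0"
    by (metis cinner_commute Reals_cnj_iff complex_is_Real_iff)
  then show ?thesis
    by (simp add: complex_eq_iff Re_cinner power2_norm_eq_inner)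
qed

lemma norm_scaleC: "norm (a *\<^sub>C x) = cmod a * norm x"
  for x :: "'a::complex_hilbert_space"
proof -
  have "cinner (a *\<^sub>C x) (a *\<^sub>C x) = a * cnj a * cinner x x"
    by (metis cinner_commute cinner_scaleC_right complex_cnj_mult mult.assoc)
  also have "\<dots> = complex_of_real ((cmod a * norm x)\<^sup>2)"
    by (simp add: cinner_self complex_norm_square[symmetric] power_mult_distrib
        del: of_real_power)
  finally have "(norm (a *\<^sub>C x))\<^sup>2 = (cmod a * norm x)\<^sup>2"
    by (simp only: cinner_self of_real_eq_iff)
  then show ?thesis
    by (simp add: power2_eq_iff_nonneg)
qed

lemma scaleC_scaleR: "a *\<^sub>C (r *\<^sub>R x) = r *\<^sub>R (a *\<^sub>C x)"
  for x :: "'a::complex_hilbert_space"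
  by (metis scaleC_of_real scaleC_scaleC mult.commute)

definition finite_cdim :: "'a::complex_hilbert_space set \<Rightarrow> bool"
  where "finite_cdim S \<longleftrightarrow> (\<exists>B. finite B \<and> cspan B = S)"

definition orthonormal_basis :: "'a::complex_hilbert_space set \<Rightarrow> bool"
  where "orthonormal_basis E \<longleftrightarrow>
    (\<forall>e\<in>E. \<forall>f\<in>E. cinner e f = (if e = f then 1 else 0)) \<and> closure (cspan E) = UNIV"


section \<open>Bounded operators\<close>

text \<open>
  The type \<open>'a \<Rightarrow>\<^sub>L 'a\<close> consists of the bounded real-linear maps, normed by the operator norm.
  The space of bounded operators on the Hilbert space is its closed subset \<open>bounded_operators\<close> of
  complex-linear maps. Operator-valued limits, series, derivatives and integrals are taken in
  this type and thus refer to the operator norm.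
\<close>

definition bounded_clinear :: "('a::complex_hilbert_space \<Rightarrow> 'a) \<Rightarrow> bool"
  where "bounded_clinear T \<longleftrightarrow> bounded_linear T \<and> (\<forall>a x. T (a *\<^sub>C x) = a *\<^sub>C T x)"

definition bounded_operators :: "('a::complex_hilbert_space \<Rightarrow>\<^sub>L 'a) set"
  where "bounded_operators = {T. bounded_clinear (blinfun_apply T)}"

lift_definition scaleC_blinfun ::
  "complex \<Rightarrow> ('a::complex_hilbert_space \<Rightarrow>\<^sub>L 'a) \<Rightarrow> ('a \<Rightarrow>\<^sub>L 'a)" (infixr "*\<^sub>B" 75)
  is "\<lambda>a T x. a *\<^sub>C T x"
proof -
  fix a :: complex and T :: "'a \<Rightarrow> 'a"
  assume "bounded_linear T"
  moreover have "bounded_linear ((*\<^sub>C) a :: 'a \<Rightarrow> 'a)"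
    by (rule bounded_linear_intro[where K = "cmod a"])
      (simp_all add: scaleC_add_right scaleC_scaleR norm_scaleC mult.commute)
  ultimately show "bounded_linear (\<lambda>x. a *\<^sub>C T x)"
    using bounded_linear_compose by blast
qed

definition fredholm :: "('a::complex_hilbert_space \<Rightarrow>\<^sub>L 'a) \<Rightarrow> bool"
  where "fredholm T \<longleftrightarrow> T \<in> bounded_operators \<and>
    finite_cdim {x. blinfun_apply T x = 0} \<and>
    closed (range (blinfun_apply T)) \<and>
    (\<exists>B. finite B \<and> cspan (range (blinfun_apply T) \<union> B) = UNIV)"

definition inverse_operator :: "('a::complex_hilbert_space \<Rightarrow>\<^sub>L 'a) \<Rightarrow> ('a \<Rightarrow>\<^sub>L 'a)"
  where "inverse_operator T = Blinfun (inv (blinfun_apply T))"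

text \<open>
  The trace is independent of the orthonormal basis for trace class operators, in particular for
  bounded operators of finite rank.
\<close>

definition trace_operator :: "('a::complex_hilbert_space \<Rightarrow>\<^sub>L 'a) \<Rightarrow> complex"
  where "trace_operator T =
    (\<Sum>\<^sub>\<infinity>e\<in>(SOME E. orthonormal_basis E). cinner e (blinfun_apply T e))"

text \<open>
  The derivative with respect to the complex variable: a real Frechet derivative of the form
  \<open>h \<mapsto> h D\<close> with complex \<open>h\<close>.
\<close>

definition operator_deriv ::
  "(complex \<Rightarrow> ('a::complex_hilbert_space \<Rightarrow>\<^sub>L 'a)) \<Rightarrow> complex \<Rightarrow> ('a \<Rightarrow>\<^sub>L 'a)"
  where "operator_deriv M z = (THE D. (M has_derivative (\<lambda>h. h *\<^sub>B D)) (at z))"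

text \<open>The operator-valued analogue of \<open>contour_integral\<close>, which is restricted to complex integrands.\<close>

definition operator_contour_integral ::
  "(real \<Rightarrow> complex) \<Rightarrow> (complex \<Rightarrow> ('a::complex_hilbert_space \<Rightarrow>\<^sub>L 'a)) \<Rightarrow> ('a \<Rightarrow>\<^sub>L 'a)"
  where "operator_contour_integral g F =
    integral {0..1} (\<lambda>t. vector_derivative g (at t within {0..1}) *\<^sub>B F (g t))"

definition has_operator_laurent_expansion ::
  "(complex \<Rightarrow> ('a::complex_hilbert_space \<Rightarrow>\<^sub>L 'a)) \<Rightarrow> complex \<Rightarrow> real \<Rightarrow> nat \<Rightarrow>
    (int \<Rightarrow> ('a \<Rightarrow>\<^sub>L 'a)) \<Rightarrow> bool"
  where "has_operator_laurent_expansion F z0 r N C \<longleftrightarrow>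
    (\<forall>k\<ge>- int N. C k \<in> bounded_operators) \<and>
    (\<forall>z. 0 < cmod (z - z0) \<and> cmod (z - z0) < r \<longrightarrow>
      (\<lambda>n. ((z - z0) powi (int n - int N)) *\<^sub>B C (int n - int N)) sums F z)"

text \<open>
  The index of \<open>M\<close> along the circle of radius \<open>\<epsilon>\<close> around \<open>z0\<close>. By cyclicity, interchanging the two
  factors under the integral does not change the trace.
\<close>

definition operator_index ::
  "(complex \<Rightarrow> ('a::complex_hilbert_space \<Rightarrow>\<^sub>L 'a)) \<Rightarrow> complex \<Rightarrow> real \<Rightarrow> complex"
  where "operator_index M z0 \<epsilon> = trace_operator
    ((1 / (2 * of_real pi * \<i>)) *\<^sub>B operator_contour_integral (circlepath z0 \<epsilon>)
      (\<lambda>\<zeta>. operator_deriv M \<zeta> o\<^sub>L inverse_operator (M \<zeta>)))"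


section \<open>Unbounded operators\<close>

text \<open>
  An operator is a domain together with a map, whose values outside the domain are irrelevant.
\<close>

datatype 'a operator = Operator (op_dom: "'a set") (op_app: "'a \<Rightarrow> 'a")

definition linear_operator :: "'a::complex_hilbert_space operator \<Rightarrow> bool"
  where "linear_operator A \<longleftrightarrow> csubspace (op_dom A) \<and>
    (\<forall>x\<in>op_dom A. \<forall>y\<in>op_dom A. op_app A (x + y) = op_app A x + op_app A y) \<and>
    (\<forall>a. \<forall>x\<in>op_dom A. op_app A (a *\<^sub>C x) = a *\<^sub>C op_app A x)"

definition closed_operator :: "'a::complex_hilbert_space operator \<Rightarrow> bool"
  where "closed_operator A \<longleftrightarrow> linear_operator A \<and> closed {(x, op_app A x) |x. x \<in> op_dom A}"

definition operator_plus ::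
  "'a::complex_hilbert_space operator \<Rightarrow> 'a operator \<Rightarrow> 'a operator"
  where "operator_plus A B =
    Operator (op_dom A \<inter> op_dom B) (\<lambda>x. op_app A x + op_app B x)"

definition resolvent :: "'a::complex_hilbert_space operator \<Rightarrow> complex \<Rightarrow> 'a \<Rightarrow> 'a"
  where "resolvent A z = inv_into (op_dom A) (\<lambda>x. op_app A x - z *\<^sub>C x)"

definition resolvent_set :: "'a::complex_hilbert_space operator \<Rightarrow> complex set"
  where "resolvent_set A = {z. bij_betw (\<lambda>x. op_app A x - z *\<^sub>C x) (op_dom A) UNIV \<and>
    bounded_clinear (resolvent A z)}"

definition operator_spectrum :: "'a::complex_hilbert_space operator \<Rightarrow> complex set"
  where "operator_spectrum A = - resolvent_set A"

definition eigenvalue :: "'a::complex_hilbert_space operator \<Rightarrow> complex \<Rightarrow> bool"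
  where "eigenvalue A z \<longleftrightarrow> (\<exists>x\<in>op_dom A. x \<noteq> 0 \<and> op_app A x = z *\<^sub>C x)"

text \<open>
  For an isolated point of the spectrum the Riesz projection does not depend on the choice of the
  radius.
\<close>

definition riesz_projection ::
  "'a::complex_hilbert_space operator \<Rightarrow> complex \<Rightarrow> ('a \<Rightarrow>\<^sub>L 'a)"
  where "riesz_projection A z0 =
    (let \<epsilon> = (SOME \<epsilon>. 0 < \<epsilon> \<and> cball z0 \<epsilon> \<inter> operator_spectrum A = {z0})
     in (- 1 / (2 * of_real pi * \<i>)) *\<^sub>B
          operator_contour_integral (circlepath z0 \<epsilon>) (\<lambda>\<zeta>. Blinfun (resolvent A \<zeta>)))"

definition discrete_spectrum :: "'a::complex_hilbert_space operator \<Rightarrow> complex set"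
  where "discrete_spectrum A = {z. eigenvalue A z \<and> z isolated_in operator_spectrum A \<and>
    finite_cdim (range (blinfun_apply (riesz_projection A z)))}"

definition algebraic_multiplicity :: "'a::complex_hilbert_space operator \<Rightarrow> complex \<Rightarrow> nat"
  where "algebraic_multiplicity A z = cdim (range (blinfun_apply (riesz_projection A z)))"

definition birman_schwinger ::
  "'a::complex_hilbert_space operator \<Rightarrow> 'a operator \<Rightarrow> complex \<Rightarrow> 'a \<Rightarrow> 'a"
  where "birman_schwinger H0 V z = (\<lambda>x. - op_app V (resolvent H0 z x))"

end

theory Submission
  imports Defs
begin

text \<open>
  Write \<open>R0\<close> and \<open>R\<close> for the resolvents of \<open>H0\<close> and \<open>H\<close> and \<open>M = 1 - K\<close>. The factorization
  \<open>H - z = M z (H0 - z)\<close> gives \<open>R M = R0\<close>, and since \<open>M' = (M - 1) R0\<close>, the logarithmic derivative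
  is \<open>M' M\<^sup>-\<^sup>1 = M R - R\<close>. Formally the trace is cyclic, so the residue of \<open>M R\<close> at \<open>z0\<close> has the
  same trace as that of \<open>R M = R0\<close>, which is minus the trace of the Riesz projection \<open>P0\<close> of \<open>H0\<close>,
  while the residue of \<open>R\<close> is minus the Riesz projection \<open>P\<close> of \<open>H\<close>. Hence the index is
  \<open>tr P - tr P0\<close>, and the trace of a projection of finite rank is its dimension.

  Two things remain. The first is that \<open>P\<close> has finite rank. The zeroth Laurent coefficient \<open>S\<close>
  of \<open>R0\<close> at \<open>z0\<close> satisfies \<open>S (H0 - z0) x = x - P0 x\<close> and \<open>V S = - K\<^sub>0\<close> with \<open>K\<^sub>0\<close> that
  of \<open>K\<close>. So if \<open>P0 x = 0\<close>, then \<open>(H - z0) x = (1 - K\<^sub>0) (H0 - z0) x\<close>, and as a Fredholm operator is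
  bounded below on a subspace of finite codimension, finitely many linear conditions on \<open>x\<close> force
  \<open>norm x \<le> C * norm ((H - z0) x)\<close> (\<open>bounded_below_if_fredholm\<close>). On the range of \<open>P\<close>, however,
  \<open>H - z0\<close> is quasinilpotent: its powers are the contour integrals \<open>riesz_moment\<close>, whose norms
  decay faster than any geometric sequence. If the range were infinite-dimensional, it would
  contain a nonzero vector all of whose first \<open>m\<close> iterates satisfy the linear conditions, and a
  large \<open>m\<close> gives a contradiction (\<open>finite_rank_perturbed_projection\<close>). Moreover \<open>P \<noteq> 0\<close>, since
  otherwise \<open>R\<close> would be bounded near \<open>z0\<close> and \<open>z0\<close> would not be in the spectrum; and the same decay
  shows that \<open>H - z0\<close> is not injective on the range of \<open>P\<close>, so \<open>z0\<close> is an eigenvalue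
  (\<open>eigenvalue_if_finite_rank\<close>).

  The second is the use of cyclicity, since \<open>M\<close> and \<open>R\<close> need not be of trace class. Both split
  into a term with a factor \<open>P0\<close> or \<open>P\<close> and a term that stays bounded near \<open>z0\<close>; the
  product of two bounded terms has residue zero, and in all other products the finite-rank factor
  makes the trace cyclic (\<open>operator_index_formula\<close>). The bound near \<open>z0\<close> holds because
  \<open>R - R P\<close> is a Cauchy integral over a fixed circle (\<open>resolvent_regular_part\<close>), which also yields
  \<open>P\<^sup>2 = P\<close>.
\<close>

section \<open>Inner products and orthonormal sets\<close>

lemma scaleC_one [simp]: "1 *\<^sub>C x = x"
  for x :: "'a::complex_hilbert_space"
  using scaleC_of_real[of 1 x] by simp

lemma scaleC_zero_left [simp]: "0 *\<^sub>C x = 0"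
  for x :: "'a::complex_hilbert_space"
  using scaleC_of_real[of 0 x] by simp

lemma scaleC_zero_right [simp]: "a *\<^sub>C (0::'a::complex_hilbert_space) = 0"
  by (rule complex_vector.scale_zero_right)

lemma scaleC_minus_one [simp]: "(- 1) *\<^sub>C x = - x"
  for x :: "'a::complex_hilbert_space"
  using scaleC_of_real[of "-1" x] by simp

lemmas scaleC_diff_right = complex_vector.scale_right_diff_distrib
lemmas scaleC_diff_left = complex_vector.scale_left_diff_distrib
lemmas scaleC_minus_right = complex_vector.scale_minus_right

lemma cinner_zero_right [simp]: "cinner x (0::'a::complex_hilbert_space) = 0"
  using cinner_scaleC_right[of x 0 0] by simp

lemma cinner_minus_right: "cinner x (- y) = - cinner x y"
  for x y :: "'a::complex_hilbert_space"
  using cinner_scaleC_right[of x "-1" y] by simp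

lemma cinner_diff_right: "cinner x (y - z) = cinner x y - cinner x z"
  for x y z :: "'a::complex_hilbert_space"
  using cinner_add_right[of x y "- z"] by (simp add: cinner_minus_right)

lemma cinner_sum_right: "cinner x (\<Sum>i\<in>I. f i) = (\<Sum>i\<in>I. cinner x (f i))"
  for x :: "'a::complex_hilbert_space"
  by (induction I rule: infinite_finite_induct) (simp_all add: cinner_add_right)

lemma cinner_eq_0_commute: "cinner x y = 0 \<longleftrightarrow> cinner y x = 0"
  for x y :: "'a::complex_hilbert_space"
  by (metis cinner_commute complex_cnj_zero)

lemma cinner_self_eq_0: "cinner x x = 0 \<longleftrightarrow> x = 0"
  for x :: "'a::complex_hilbert_space"
  by (simp add: cinner_self)

text \<open>A unimodular factor makes the complex inner product real, so that the Cauchy--Schwarz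
  inequality of the real inner product applies.\<close>

lemma norm_cinner_le: "cmod (cinner x y) \<le> norm x * norm y"
  for x y :: "'a::complex_hilbert_space"
proof -
  define a where "a = (if cinner x y = 0 then 1 else cnj (sgn (cinner x y)))"
  have "cmod a = 1"
    by (simp add: a_def norm_sgn)
  have "a * cinner x y = of_real (cmod (cinner x y))"
    by (simp add: a_def sgn_eq complex_norm_square[symmetric] power2_eq_square field_simps
        flip: of_real_mult)
  then have "cmod (cinner x y) = Re (cinner x (a *\<^sub>C y))"
    by (simp add: cinner_scaleC_right)
  also have "\<dots> \<le> norm x * norm (a *\<^sub>C y)"
    unfolding Re_cinner by (rule norm_cauchy_schwarz)
  finally show ?thesis
    by (simp add: norm_scaleC \<open>cmod a = 1\<close>)
qed

lemma bounded_linear_cinner_right: "bounded_linear (cinner x)"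
  for x :: "'a::complex_hilbert_space"
proof (rule bounded_linear_intro[where K = "norm x"])
  fix r and y :: 'a
  show "cinner x (r *\<^sub>R y) = r *\<^sub>R cinner x y"
    by (metis scaleC_of_real cinner_scaleC_right scaleR_conv_of_real)
  show "cmod (cinner x y) \<le> norm y * norm x"
    using norm_cinner_le[of x y] by (simp add: mult.commute)
qed (rule cinner_add_right)

lemma bounded_bilinear_scaleC:
  "bounded_bilinear (scaleC :: complex \<Rightarrow> 'a \<Rightarrow> 'a::complex_hilbert_space)"
proof
  fix a b :: complex and x y :: 'a and r :: real
  show "(r *\<^sub>R a) *\<^sub>C x = r *\<^sub>R (a *\<^sub>C x)"
    by (metis scaleC_of_real scaleC_scaleC scaleR_conv_of_real)
  show "\<exists>K. \<forall>a x. norm (a *\<^sub>C (x::'a)) \<le> norm a * norm x * K"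
    by (rule exI[of _ 1]) (simp add: norm_scaleC)
qed (simp_all add: scaleC_add_left scaleC_add_right scaleC_scaleR)

lemma eq_if_cinner_eq:
  fixes x y :: "'a::complex_hilbert_space"
  assumes "\<And>u. cinner u x = cinner u y"
  shows "x = y"
proof -
  have "cinner (x - y) (x - y) = 0"
    using assms[of "x - y"] by (simp add: cinner_diff_right)
  then show ?thesis
    by (simp add: cinner_self_eq_0)
qed

definition orthonormal :: "'a::complex_hilbert_space set \<Rightarrow> bool"
  where "orthonormal U \<longleftrightarrow> (\<forall>e\<in>U. \<forall>f\<in>U. cinner e f = (if e = f then 1 else 0))"

definition orthogonal_projection ::
    "'a::complex_hilbert_space set \<Rightarrow> 'a \<Rightarrow> 'a"
  where "orthogonal_projection U x = (\<Sum>u\<in>U. cinner u x *\<^sub>C u)"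

lemma orthonormal_subset: "orthonormal U \<Longrightarrow> U' \<subseteq> U \<Longrightarrow> orthonormal U'"
  unfolding orthonormal_def by blast

lemma cinner_orthogonal_projection:
  assumes "orthonormal U" "finite U" "u \<in> U"
  shows "cinner u (orthogonal_projection U x) = cinner u x"
proof -
  have "cinner u (orthogonal_projection U x) = (\<Sum>v\<in>U. cinner v x * cinner u v)"
    by (simp add: orthogonal_projection_def cinner_sum_right cinner_scaleC_right)
  also have "\<dots> = (\<Sum>v\<in>U. if u = v then cinner v x else 0)"
    using assms unfolding orthonormal_def by (intro sum.cong) auto
  also have "\<dots> = cinner u x"
    using assms by simp
  finally show ?thesis .
qed

lemma orthogonal_projection_in_cspan: "orthogonal_projection U x \<in> cspan U"
  unfolding orthogonal_projection_def
  by (intro complex_vector.span_sum complex_vector.span_scale complex_vector.span_base)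

lemma bounded_linear_orthogonal_projection: "bounded_linear (orthogonal_projection U)"
  unfolding orthogonal_projection_def
  by (intro bounded_linear_sum bounded_linear_cinner_right
      bounded_linear_compose[OF bounded_bilinear.bounded_linear_left[OF bounded_bilinear_scaleC]])

lemma cinner_eq_0_cspan:
  fixes x :: "'a::complex_hilbert_space"
  assumes "\<And>u. u \<in> U \<Longrightarrow> cinner x u = 0" "v \<in> cspan U"
  shows "cinner x v = 0"
  using assms(2)
proof (rule complex_vector.span_induct)
  show "complex_vector.subspace {v. cinner x v = 0}"
    by (rule complex_vector.subspaceI) (simp_all add: cinner_add_right cinner_scaleC_right)
qed (use assms in auto)

lemma cinner_residual_cspan:
  assumes "orthonormal U" "finite U" "v \<in> cspan U"
  shows "cinner (x - orthogonal_projection U x) v = 0"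
proof (rule cinner_eq_0_cspan[OF _ assms(3)])
  fix u assume "u \<in> U"
  then have "cinner u (x - orthogonal_projection U x) = 0"
    using assms by (simp add: cinner_diff_right cinner_orthogonal_projection)
  then show "cinner (x - orthogonal_projection U x) u = 0"
    by (simp add: cinner_eq_0_commute)
qed

text \<open>The residual is orthogonal to the span, so Pythagoras makes the projection the best
  approximation.\<close>

lemma norm_residual_le:
  assumes "orthonormal U" "finite U" "v \<in> cspan U"
  shows "norm (x - orthogonal_projection U x) \<le> norm (x - v)"
proof -
  let ?p = "orthogonal_projection U x"
  have "?p - v \<in> cspan U"
    by (intro complex_vector.span_diff orthogonal_projection_in_cspan assms)
  then have "inner (x - ?p) (?p - v) = 0"
    using cinner_residual_cspan[OF assms(1,2)] by (metis Re_cinner zero_complex.sel(1))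
  then have "(norm (x - v))\<^sup>2 = (norm (x - ?p))\<^sup>2 + (norm (?p - v))\<^sup>2"
    using norm_add_Pythagorean[of "x - ?p" "?p - v"] by (simp add: orthogonal_def)
  then show ?thesis
    by (metis norm_ge_zero power2_le_imp_le le_add_same_cancel1 zero_le_power2)
qed

lemma orthogonal_projection_ident:
  assumes "orthonormal U" "finite U" "x \<in> cspan U"
  shows "orthogonal_projection U x = x"
  using norm_residual_le[OF assms, of x] by simp

lemma closed_cspan_orthonormal:
  assumes "orthonormal U" "finite U"
  shows "closed (cspan U)"
proof -
  have "cspan U = {x. orthogonal_projection U x = x}"
    using orthogonal_projection_ident[OF assms] orthogonal_projection_in_cspan[of U]
    by (metis (mono_tags, lifting) Collect_cong Collect_mem_eq)
  also have "closed \<dots>"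
    by (intro closed_Collect_eq continuous_on_id
        linear_continuous_on[OF bounded_linear_orthogonal_projection])
  finally show ?thesis .
qed

lemma gram_schmidt_step:
  fixes x :: "'a::complex_hilbert_space"
  assumes "orthonormal U" "finite U"
  shows "\<exists>U'. orthonormal U' \<and> finite U' \<and> U \<subseteq> U' \<and> cspan U' = cspan (insert x U)"
proof (cases "x \<in> cspan U")
  case True
  then show ?thesis
    using assms complex_vector.span_redundant by blast
next
  case False
  define p where "p = orthogonal_projection U x"
  define y where "y = complex_of_real (inverse (norm (x - p))) *\<^sub>C (x - p)"
  have p: "p \<in> cspan U"
    by (simp add: p_def orthogonal_projection_in_cspan)
  then have "x - p \<noteq> 0"
    using False by auto
  have "norm y = 1"
    using \<open>x - p \<noteq> 0\<close> by (simp add: y_def norm_scaleC norm_inverse)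
  then have yy: "cinner y y = 1"
    by (simp add: cinner_self)
  have uy: "cinner u y = 0" if "u \<in> U" for u
    using that assms by (simp add: y_def p_def cinner_scaleC_right cinner_diff_right
        cinner_orthogonal_projection)
  then have yu: "cinner y u = 0" if "u \<in> U" for u
    using that cinner_eq_0_commute by blast
  have ortho: "orthonormal (insert y U)"
    using assms(1) yy uy yu unfolding orthonormal_def by auto
  have "y \<in> cspan (insert x U)"
    unfolding y_def using p complex_vector.span_mono[of U "insert x U"]
    by (intro complex_vector.span_scale complex_vector.span_diff)
      (auto intro: complex_vector.span_base)
  moreover have "x \<in> cspan (insert y U)"
  proof -
    have "x = complex_of_real (norm (x - p)) *\<^sub>C y + p"
      using \<open>x - p \<noteq> 0\<close> by (simp add: y_def scaleC_scaleC flip: of_real_mult of_real_inverse)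
    also have "\<dots> \<in> cspan (insert y U)"
      using p complex_vector.span_mono[of U "insert y U"]
      by (intro complex_vector.span_scale complex_vector.span_add)
        (auto intro: complex_vector.span_base)
    finally show ?thesis .
  qed
  ultimately have "cspan (insert y U) = cspan (insert x U)"
    unfolding complex_vector.span_eq by (auto intro: complex_vector.span_base)
  then show ?thesis
    using ortho assms(2) by blast
qed

lemma finite_cdim_orthonormal:
  assumes "finite_cdim S"
  obtains U where "orthonormal U" "finite U" "cspan U = S"
proof -
  from assms obtain B where B: "finite B" "cspan B = S"
    unfolding finite_cdim_def by blast
  from B(1) have "\<exists>U. orthonormal U \<and> finite U \<and> cspan U = cspan B"
  proof induction
    case empty
    show ?case
      by (rule exI[of _ "{}"]) (simp add: orthonormal_def)
  next
    case (insert b B)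
    then obtain U where U: "orthonormal U" "finite U" "cspan U = cspan B"
      by blast
    then obtain U' where "orthonormal U'" "finite U'" "cspan U' = cspan (insert b U)"
      using gram_schmidt_step by metis
    moreover have "cspan (insert b U) = cspan (insert b B)"
      using U(3) by (simp add: complex_vector.span_insert)
    ultimately show ?case
      by metis
  qed
  then show thesis
    using B(2) that by blast
qed

lemma orthonormal_independent:
  assumes "orthonormal U" "finite U"
  shows "\<not> complex_vector.dependent U"
proof
  assume "complex_vector.dependent U"
  then obtain u where u: "u \<in> U" "u \<in> cspan (U - {u})"
    unfolding complex_vector.dependent_def by blast
  have "cinner u u = 0"
    by (rule cinner_eq_0_cspan[OF _ u(2)]) (use u(1) assms(1) in \<open>auto simp: orthonormal_def\<close>)
  then show False
    using u(1) assms(1) by (simp add: orthonormal_def)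
qed

lemma cdim_cspan_orthonormal:
  assumes "orthonormal U" "finite U"
  shows "cdim (cspan U) = card U"
  using complex_vector.dim_span_eq_card_independent[OF orthonormal_independent[OF assms]] .

text \<open>Gram--Schmidt orthonormalization of a dense sequence: the finite orthonormal sets produced
  step by step increase, and the span of their union contains the sequence.\<close>

lemma ex_orthonormal_basis:
  assumes "separable_space (euclidean :: 'a::complex_hilbert_space topology)"
  shows "\<exists>E :: 'a set. orthonormal_basis E"
proof -
  obtain C :: "'a set" where C: "countable C" "closure C = UNIV"
    using assms unfolding separable_space_def by auto
  then have "C \<noteq> {}"
    by auto
  then obtain d :: "nat \<Rightarrow> 'a" where d: "range d = C"
    using C(1) uncountable_def by blast
  have "\<exists>U. \<forall>n. (orthonormal (U n) \<and> finite (U n)) \<and>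
      (U n \<subseteq> U (Suc n) \<and> d n \<in> cspan (U (Suc n)))"
  proof (rule dependent_nat_choice)
    show "\<exists>U::'a set. orthonormal U \<and> finite U"
      by (rule exI[of _ "{}"]) (simp add: orthonormal_def)
  next
    fix U :: "'a set" and n
    assume "orthonormal U \<and> finite U"
    then obtain U' where "orthonormal U'" "finite U'" "U \<subseteq> U'" "cspan U' = cspan (insert (d n) U)"
      using gram_schmidt_step by metis
    then show "\<exists>U'. (orthonormal U' \<and> finite U') \<and> (U \<subseteq> U' \<and> d n \<in> cspan U')"
      using complex_vector.span_base[of "d n" "insert (d n) U"] by auto
  qed
  then obtain U where U: "\<And>n. orthonormal (U n)" "\<And>n. U n \<subseteq> U (Suc n)"
      "\<And>n. d n \<in> cspan (U (Suc n))"
    by blast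
  have mono: "U m \<subseteq> U n" if "m \<le> n" for m n
    using lift_Suc_mono_le[of U, OF U(2) that] .
  define E where "E = (\<Union>n. U n)"
  have "cinner e f = (if e = f then 1 else 0)" if "e \<in> E" "f \<in> E" for e f
  proof -
    from that obtain m n where "e \<in> U m" "f \<in> U n"
      unfolding E_def by blast
    then have "e \<in> U (max m n)" "f \<in> U (max m n)"
      using mono by (meson max.cobounded1 max.cobounded2 subsetD)+
    then show ?thesis
      using U(1) unfolding orthonormal_def by blast
  qed
  moreover have "C \<subseteq> cspan E"
  proof
    fix x assume "x \<in> C"
    then obtain n where "x = d n"
      using d by blast
    moreover have "cspan (U (Suc n)) \<subseteq> cspan E"
      by (rule complex_vector.span_mono) (auto simp: E_def)
    ultimately show "x \<in> cspan E"
      using U(3) by blast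
  qed
  then have "closure (cspan E) = UNIV"
    using C(2) closure_mono by blast
  ultimately show ?thesis
    unfolding orthonormal_basis_def by blast
qed

text \<open>Partial sums are best approximations, so they inherit convergence from the density of the
  linear span.\<close>

lemma has_sum_orthonormal_basis:
  fixes x :: "'a::complex_hilbert_space"
  assumes "orthonormal_basis E"
  shows "((\<lambda>e. cinner e x *\<^sub>C e) has_sum x) E"
  unfolding has_sum_def tendsto_iff eventually_finite_subsets_at_top
proof (intro allI impI)
  fix \<epsilon> :: real
  assume "\<epsilon> > 0"
  have "orthonormal E" and "x \<in> closure (cspan E)"
    using assms unfolding orthonormal_basis_def orthonormal_def by auto
  then obtain v where v: "v \<in> cspan E" "dist v x < \<epsilon>"
    using \<open>\<epsilon> > 0\<close> closure_approachable by blast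
  from v(1) obtain F c where F: "finite F" "F \<subseteq> E" and "v = (\<Sum>f\<in>F. c f *\<^sub>C f)"
    unfolding complex_vector.span_explicit by blast
  then have "v \<in> cspan F"
    by (simp add: complex_vector.span_sum complex_vector.span_scale complex_vector.span_base)
  have "dist (\<Sum>e\<in>Y. cinner e x *\<^sub>C e) x < \<epsilon>" if "finite Y" "F \<subseteq> Y" "Y \<subseteq> E" for Y
  proof -
    have "v \<in> cspan Y"
      using \<open>v \<in> cspan F\<close> complex_vector.span_mono[OF that(2)] by blast
    then have "norm (x - orthogonal_projection Y x) \<le> norm (x - v)"
      using norm_residual_le orthonormal_subset[OF \<open>orthonormal E\<close>] that by blast
    then show ?thesis
      using v(2) by (simp add: orthogonal_projection_def dist_norm norm_minus_commute)
  qed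
  then show "\<exists>X. finite X \<and> X \<subseteq> E \<and> (\<forall>Y. finite Y \<and> X \<subseteq> Y \<and> Y \<subseteq> E \<longrightarrow>
      dist (\<Sum>e\<in>Y. cinner e x *\<^sub>C e) x < \<epsilon>)"
    using F by blast
qed

lemma finite_cdim_subspace:
  assumes "finite_cdim S" "csubspace S'" "S' \<subseteq> S"
  shows "finite_cdim S'"
proof -
  obtain B where B: "finite B" "cspan B = S"
    using assms(1) unfolding finite_cdim_def by blast
  obtain B' where B': "B' \<subseteq> S'" "\<not> complex_vector.dependent B'" "S' \<subseteq> cspan B'"
    using complex_vector.maximal_independent_subset by blast
  have "finite B'"
    using complex_vector.independent_span_bound[OF B(1) B'(2)] B' B(2) assms(3) by blast
  moreover have "cspan B' = S'"
    using B' assms(2) complex_vector.span_subspace by blast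
  ultimately show ?thesis
    unfolding finite_cdim_def by blast
qed

text \<open>Every linear functional cuts down the dimension by at most one.\<close>

lemma ex_common_zero:
  fixes S :: "'a::complex_hilbert_space set" and G :: "('a \<Rightarrow> complex) set"
  assumes "finite G" "csubspace S" "\<not> finite_cdim S"
    and "\<And>g x y. g \<in> G \<Longrightarrow> g (x + y) = g x + g y"
    and "\<And>g a x. g \<in> G \<Longrightarrow> g (a *\<^sub>C x) = a * g x"
  shows "\<exists>x\<in>S. x \<noteq> 0 \<and> (\<forall>g\<in>G. g x = 0)"
  using assms
proof (induction G arbitrary: S)
  case empty
  have "finite_cdim {0::'a}"
    unfolding finite_cdim_def by (rule exI[of _ "{}"]) simp
  then show ?case
    using empty complex_vector.subspace_0 by (metis empty_iff insert_subset singletonI subset_antisym subset_singletonD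
        subsetI)
next
  case (insert g G)
  have g_add: "g (x + y) = g x + g y" and g_scale: "g (a *\<^sub>C x) = a * g x" for x y a
    using insert.prems by auto
  have g_0: "g 0 = 0"
    using g_scale[of 0 0] by simp
  define S' where "S' = {x \<in> S. g x = 0}"
  have "csubspace S'"
    using insert.prems(1) g_add g_scale g_0 unfolding S'_def complex_vector.subspace_def by auto
  moreover have "\<not> finite_cdim S'"
  proof
    assume "finite_cdim S'"
    then obtain B where B: "finite B" "cspan B = S'"
      unfolding finite_cdim_def by blast
    then have "S' \<noteq> S"
      using insert.prems(2) unfolding finite_cdim_def by blast
    then obtain v where v: "v \<in> S" "g v \<noteq> 0"
      unfolding S'_def by blast
    have "S \<subseteq> cspan (insert v B)"
    proof
      fix x assume "x \<in> S"
      define c where "c = g x / g v"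
      have "x - c *\<^sub>C v \<in> S"
        using insert.prems(1) \<open>x \<in> S\<close> v(1)
        by (intro complex_vector.subspace_diff complex_vector.subspace_scale)
      moreover have "g (x - c *\<^sub>C v) = 0"
        using g_add[of "x - c *\<^sub>C v" "c *\<^sub>C v"] v(2) by (simp add: g_scale c_def)
      ultimately have "x - c *\<^sub>C v \<in> cspan B"
        using B(2) by (simp add: S'_def)
      then show "x \<in> cspan (insert v B)"
        unfolding complex_vector.span_insert by blast
    qed
    then have "cspan (insert v B) = S"
      using B(2) v(1) insert.prems(1) complex_vector.span_superset[of B]
      by (intro equalityI complex_vector.span_minimal) (auto simp: S'_def)
    then show False
      using insert.prems(2) B(1) unfolding finite_cdim_def by blast
  qed
  ultimately have "\<exists>x\<in>S'. x \<noteq> 0 \<and> (\<forall>g\<in>G. g x = 0)"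
    using insert.prems by (intro insert.IH) auto
  then show ?case
    unfolding S'_def by auto
qed

section \<open>Bounded operators\<close>

lemma bounded_operators_scaleC:
  "T \<in> bounded_operators \<Longrightarrow> blinfun_apply T (a *\<^sub>C x) = a *\<^sub>C blinfun_apply T x"
  unfolding bounded_operators_def bounded_clinear_def by blast

lemma bounded_operatorsI:
  assumes "\<And>a x. blinfun_apply T (a *\<^sub>C x) = a *\<^sub>C blinfun_apply T x"
  shows "T \<in> bounded_operators"
  using assms unfolding bounded_operators_def bounded_clinear_def
  by (simp add: blinfun.bounded_linear_right)

lemma Blinfun_bounded_clinear:
  assumes "bounded_clinear f"
  shows "blinfun_apply (Blinfun f) = f" "Blinfun f \<in> bounded_operators"
  using assms unfolding bounded_operators_def bounded_clinear_def
  by (simp_all add: bounded_linear_Blinfun_apply)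

lemma scaleC_blinfun_apply [simp]: "blinfun_apply (a *\<^sub>B T) x = a *\<^sub>C blinfun_apply T x"
  by transfer rule

lemma bounded_operators_intros [intro]:
  "id_blinfun \<in> bounded_operators"
  "0 \<in> bounded_operators"
  "S \<in> bounded_operators \<Longrightarrow> T \<in> bounded_operators \<Longrightarrow> S + T \<in> bounded_operators"
  "S \<in> bounded_operators \<Longrightarrow> T \<in> bounded_operators \<Longrightarrow> S - T \<in> bounded_operators"
  "T \<in> bounded_operators \<Longrightarrow> - T \<in> bounded_operators"
  "T \<in> bounded_operators \<Longrightarrow> a *\<^sub>B T \<in> bounded_operators"
  "S \<in> bounded_operators \<Longrightarrow> T \<in> bounded_operators \<Longrightarrow> S o\<^sub>L T \<in> bounded_operators"
  by (auto intro!: bounded_operatorsI simp: bounded_operators_scaleC scaleC_add_right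
      scaleC_diff_right scaleC_minus_right scaleC_scaleC mult.commute blinfun.bilinear_simps)

lemma csubspace_range:
  assumes "T \<in> bounded_operators"
  shows "csubspace (range (blinfun_apply T))"
proof (rule complex_vector.subspaceI)
  show "0 \<in> range (blinfun_apply T)"
    by (metis blinfun.zero_right rangeI)
  show "x + y \<in> range (blinfun_apply T)"
    if "x \<in> range (blinfun_apply T)" "y \<in> range (blinfun_apply T)" for x y
    using that by (auto simp flip: blinfun.add_right)
  show "c *\<^sub>C x \<in> range (blinfun_apply T)" if "x \<in> range (blinfun_apply T)" for c x
    using that assms by (auto simp flip: bounded_operators_scaleC)
qed

lemma norm_scaleC_blinfun_le: "norm (a *\<^sub>B T) \<le> cmod a * norm T"
proof (rule norm_blinfun_bound)
  fix x
  have "norm (a *\<^sub>C blinfun_apply T x) \<le> cmod a * (norm T * norm x)"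
    unfolding norm_scaleC by (intro mult_left_mono norm_blinfun norm_ge_zero)
  then show "norm (blinfun_apply (a *\<^sub>B T) x) \<le> cmod a * norm T * norm x"
    by (simp add: mult.assoc)
qed simp

lemma bounded_bilinear_scaleC_blinfun:
  "bounded_bilinear (scaleC_blinfun :: complex \<Rightarrow> ('a::complex_hilbert_space \<Rightarrow>\<^sub>L 'a) \<Rightarrow> _)"
proof
  fix a b :: complex and S T :: "'a \<Rightarrow>\<^sub>L 'a" and r :: real
  show "(a + b) *\<^sub>B T = a *\<^sub>B T + b *\<^sub>B T"
    by (rule blinfun_eqI) (simp add: blinfun.bilinear_simps scaleC_add_left)
  show "a *\<^sub>B (S + T) = a *\<^sub>B S + a *\<^sub>B T"
    by (rule blinfun_eqI) (simp add: blinfun.bilinear_simps scaleC_add_right)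
  show "(r *\<^sub>R a) *\<^sub>B T = r *\<^sub>R (a *\<^sub>B T)"
    by (rule blinfun_eqI) (simp add: blinfun.bilinear_simps
        bounded_bilinear.scaleR_left[OF bounded_bilinear_scaleC])
  show "a *\<^sub>B (r *\<^sub>R T) = r *\<^sub>R (a *\<^sub>B T)"
    by (rule blinfun_eqI) (simp add: blinfun.bilinear_simps scaleC_scaleR)
  show "\<exists>K. \<forall>a (T::'a \<Rightarrow>\<^sub>L 'a). norm (a *\<^sub>B T) \<le> norm a * norm T * K"
    by (rule exI[of _ 1]) (simp add: norm_scaleC_blinfun_le)
qed

interpretation scaleC_blinfun: bounded_bilinear
  "scaleC_blinfun :: complex \<Rightarrow> ('a::complex_hilbert_space \<Rightarrow>\<^sub>L 'a) \<Rightarrow> _"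
  by (rule bounded_bilinear_scaleC_blinfun)

lemma scaleC_blinfun_scaleC_blinfun: "a *\<^sub>B b *\<^sub>B T = (a * b) *\<^sub>B T"
  by (rule blinfun_eqI) (simp add: scaleC_scaleC)

lemma scaleC_blinfun_one [simp]: "1 *\<^sub>B T = T"
  by (rule blinfun_eqI) simp

lemma blinfun_compose_scaleC_left: "(a *\<^sub>B S) o\<^sub>L T = a *\<^sub>B (S o\<^sub>L T)"
  by (rule blinfun_eqI) simp

lemma blinfun_compose_scaleC_right:
  "S \<in> bounded_operators \<Longrightarrow> S o\<^sub>L (a *\<^sub>B T) = a *\<^sub>B (S o\<^sub>L T)"
  by (rule blinfun_eqI) (simp add: bounded_operators_scaleC)

lemma blinfun_eq_if_cinner_eq:
  fixes S T :: "'a::complex_hilbert_space \<Rightarrow>\<^sub>L 'a"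
  assumes "\<And>x y. cinner x (blinfun_apply S y) = cinner x (blinfun_apply T y)"
  shows "S = T"
  by (rule blinfun_eqI, rule eq_if_cinner_eq) (rule assms)

lemma bounded_linear_cinner_apply: "bounded_linear (\<lambda>T. cinner x (blinfun_apply T y))"
  by (rule bounded_linear_compose[OF bounded_linear_cinner_right blinfun.bounded_linear_left])

lemma blinfun_compose_assoc: "A o\<^sub>L (B o\<^sub>L C) = A o\<^sub>L B o\<^sub>L C"
  by (rule blinfun_eqI) simp

lemma has_sum_sum:
  fixes f :: "'i \<Rightarrow> 'b \<Rightarrow> 'c::topological_comm_monoid_add"
  assumes "\<And>i. i \<in> I \<Longrightarrow> (f i has_sum s i) A"
  shows "((\<lambda>x. \<Sum>i\<in>I. f i x) has_sum (\<Sum>i\<in>I. s i)) A"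
  using assms by (induction I rule: infinite_finite_induct) (auto intro: has_sum_add)

section \<open>Traces of finite-rank operators\<close>

text \<open>Expanding \<open>P\<close> in an orthonormal basis \<open>U\<close> of its range turns \<open>X P Y\<close> into a finite sum of
  rank-one operators, for each of which Parseval's identity evaluates the trace series. The value
  depends only on the product \<open>Y X\<close>; this is the form of cyclicity used below. It is also
  given by a bounded functional of \<open>Y X\<close>, so that it can be taken under a contour integral.\<close>

lemma has_sum_trace_sandwich:
  fixes P X Y :: "'a::complex_hilbert_space \<Rightarrow>\<^sub>L 'a"
  assumes E: "orthonormal_basis E"
    and U: "orthonormal U" "finite U" "cspan U = range (blinfun_apply P)"
    and "P \<in> bounded_operators" "X \<in> bounded_operators" "Y \<in> bounded_operators"
  shows "((\<lambda>e. cinner e (blinfun_apply (X o\<^sub>L P o\<^sub>L Y) e)) has_sum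
    (\<Sum>u\<in>U. cinner u (blinfun_apply (P o\<^sub>L Y o\<^sub>L X) u))) E"
proof -
  have P: "blinfun_apply P x = (\<Sum>u\<in>U. cinner u (blinfun_apply P x) *\<^sub>C u)" for x
    using orthogonal_projection_ident[OF U(1,2), of "blinfun_apply P x"] U(3)
    by (simp add: orthogonal_projection_def)
  have XP: "blinfun_apply X (blinfun_apply P y) =
      (\<Sum>u\<in>U. cinner u (blinfun_apply P y) *\<^sub>C blinfun_apply X u)" for y
    by (subst P) (simp add: blinfun.sum_right bounded_operators_scaleC assms)
  have "((\<lambda>e. cinner e (blinfun_apply X u) * cinner u (blinfun_apply (P o\<^sub>L Y) e)) has_sum
      cinner u (blinfun_apply (P o\<^sub>L Y) (blinfun_apply X u))) E" for u
  proof -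
    have "bounded_linear (\<lambda>x. cinner u (blinfun_apply (P o\<^sub>L Y) x))"
      by (rule bounded_linear_compose[OF bounded_linear_cinner_right blinfun.bounded_linear_right])
    from has_sum_bounded_linear[OF this has_sum_orthonormal_basis[OF E, of "blinfun_apply X u"]]
    show ?thesis
      by (simp add: bounded_operators_scaleC assms cinner_scaleC_right o_def)
  qed
  then have "((\<lambda>e. \<Sum>u\<in>U. cinner e (blinfun_apply X u) * cinner u (blinfun_apply (P o\<^sub>L Y) e))
      has_sum (\<Sum>u\<in>U. cinner u (blinfun_apply (P o\<^sub>L Y) (blinfun_apply X u)))) E"
    by (intro has_sum_sum)
  then show ?thesis
    by (simp add: XP cinner_sum_right cinner_scaleC_right mult.commute)
qed

text \<open>Both sides are the trace of \<open>X P Y = P X Y\<close>.\<close>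

lemma finite_rank_functional_commute:
  fixes P X Y :: "'a::complex_hilbert_space \<Rightarrow>\<^sub>L 'a"
  assumes E: "orthonormal_basis (E :: 'a set)"
    and U: "orthonormal U" "finite U" "cspan U = range (blinfun_apply P)"
    and "P \<in> bounded_operators" "X \<in> bounded_operators" "Y \<in> bounded_operators"
    and comm: "X o\<^sub>L P = P o\<^sub>L X"
  shows "(\<Sum>u\<in>U. cinner u (blinfun_apply (P o\<^sub>L X o\<^sub>L Y) u)) =
    (\<Sum>u\<in>U. cinner u (blinfun_apply (P o\<^sub>L Y o\<^sub>L X) u))"
proof -
  have "((\<lambda>e. cinner e (blinfun_apply (id_blinfun o\<^sub>L P o\<^sub>L (X o\<^sub>L Y)) e)) has_sum
    (\<Sum>u\<in>U. cinner u (blinfun_apply (P o\<^sub>L (X o\<^sub>L Y) o\<^sub>L id_blinfun) u))) E"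
    using assms by (intro has_sum_trace_sandwich) auto
  moreover have XPY: "((\<lambda>e. cinner e (blinfun_apply (X o\<^sub>L P o\<^sub>L Y) e)) has_sum
    (\<Sum>u\<in>U. cinner u (blinfun_apply (P o\<^sub>L Y o\<^sub>L X) u))) E"
    using assms by (intro has_sum_trace_sandwich) auto
  moreover have "id_blinfun o\<^sub>L P o\<^sub>L (X o\<^sub>L Y) = X o\<^sub>L P o\<^sub>L Y"
    unfolding comm by (rule blinfun_eqI) simp
  ultimately have "((\<lambda>e. cinner e (blinfun_apply (X o\<^sub>L P o\<^sub>L Y) e)) has_sum
    (\<Sum>u\<in>U. cinner u (blinfun_apply (P o\<^sub>L (X o\<^sub>L Y) o\<^sub>L id_blinfun) u))) E"
    by simp
  from has_sum_unique[OF this XPY] show ?thesis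
    by simp
qed

lemma has_sum_trace_projection:
  fixes P :: "'a::complex_hilbert_space \<Rightarrow>\<^sub>L 'a"
  assumes E: "orthonormal_basis E"
    and "finite_cdim (range (blinfun_apply P))"
    and "P \<in> bounded_operators"
    and "P o\<^sub>L P = P"
  shows "((\<lambda>e. cinner e (blinfun_apply P e)) has_sum
    of_nat (cdim (range (blinfun_apply P)))) E"
proof -
  obtain U where U: "orthonormal U" "finite U" "cspan U = range (blinfun_apply P)"
    using assms(2) by (rule finite_cdim_orthonormal)
  have "cinner u (blinfun_apply P u) = 1" if "u \<in> U" for u
  proof -
    have "u \<in> range (blinfun_apply P)"
      using that U(3) complex_vector.span_base by blast
    then have "blinfun_apply P u = u"
      using assms(4) by (metis (no_types, lifting) blinfun_apply_blinfun_compose imageE)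
    then show ?thesis
      using that U(1) by (simp add: orthonormal_def)
  qed
  then have "(\<Sum>u\<in>U. cinner u (blinfun_apply (P o\<^sub>L id_blinfun o\<^sub>L id_blinfun) u)) = of_nat (card U)"
    by simp
  moreover have "card U = cdim (range (blinfun_apply P))"
    using cdim_cspan_orthonormal U by metis
  ultimately show ?thesis
    using has_sum_trace_sandwich[OF E U assms(3), of id_blinfun id_blinfun]
    by (simp add: bounded_operators_intros)
qed

section \<open>Operators with closed range\<close>

text \<open>The open mapping theorem for an operator onto its closed range. By Baire's theorem the closure
  of the image of some ball has interior points in the range, whence every \<open>y\<close> in the range has an
  approximate preimage, of norm controlled by that of \<open>y\<close>, with error at most half of \<open>norm y\<close>.
  Correcting the error repeatedly gives a convergent series of corrections.\<close>

lemma closed_range_bounded_preimage: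
  fixes T :: "'a::banach \<Rightarrow>\<^sub>L 'b::banach"
  assumes "closed (range (blinfun_apply T))"
  shows "\<exists>C>0. \<forall>y\<in>range (blinfun_apply T). \<exists>x. blinfun_apply T x = y \<and> norm x \<le> C * norm y"
proof -
  define S where "S = range (blinfun_apply T)"
  have S_diff: "x - y \<in> S" and S_add: "x + y \<in> S" and S_scale: "c *\<^sub>R x \<in> S"
    if "x \<in> S" "y \<in> S" for x y c
    using that unfolding S_def
    by (auto simp flip: blinfun.diff_right blinfun.add_right blinfun.scaleR_right)
  have "0 \<in> S"
    unfolding S_def by (metis blinfun.zero_right rangeI)
  define F where "F n = closure (blinfun_apply T ` ball 0 (real n))" for n
  have F_subset: "F n \<subseteq> S" for n
    unfolding F_def S_def using assms by (intro closure_minimal) auto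
  have "(\<Union>n. F n) = S"
  proof
    show "S \<subseteq> (\<Union>n. F n)"
    proof
      fix y assume "y \<in> S"
      then obtain x where "y = blinfun_apply T x"
        unfolding S_def by blast
      moreover obtain n where "norm x < real n"
        using reals_Archimedean2 by blast
      ultimately have "y \<in> F n"
        unfolding F_def using closure_subset by fastforce
      then show "y \<in> (\<Union>n. F n)"
        by blast
    qed
  qed (use F_subset in blast)
  have "\<exists>n. top_of_set S interior_of F n \<noteq> {}"
  proof (rule ccontr)
    assume "\<not> ?thesis"
    then have empty: "top_of_set S interior_of F n = {}" for n
      by blast
    have "top_of_set S interior_of \<Union> (range F) = {}"
    proof (intro Baire_category_alt)
      have "completely_metrizable_space (top_of_set S)"
        using assms completely_metrizable_space_closedin completely_metrizable_space_euclidean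
        unfolding S_def by (metis closed_closedin)
      then show "completely_metrizable_space (top_of_set S) \<or>
          locally_compact_space (top_of_set S) \<and> regular_space (top_of_set S)" ..
      show "closedin (top_of_set S) G \<and> top_of_set S interior_of G = {}" if "G \<in> range F" for G
        using that F_subset empty by (auto intro!: closed_subset simp: F_def)
    qed simp
    then have "S = {}"
      using \<open>(\<Union>n. F n) = S\<close> by (metis interior_of_topspace topspace_euclidean_subtopology)
    then show False
      using \<open>0 \<in> S\<close> by blast
  qed
  then obtain n y0 where "y0 \<in> top_of_set S interior_of F n"
    by blast
  then obtain V where "openin (top_of_set S) V" "y0 \<in> V" "V \<subseteq> F n"
    unfolding interior_of_def by blast
  then obtain r where r: "r > 0" "ball y0 r \<inter> S \<subseteq> F n" and "y0 \<in> S"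
    by (metis (no_types, lifting) openin_contains_ball order_trans openin_subset
        subset_eq topspace_euclidean_subtopology)
  define M where "M = 4 * real n / r"
  have "M \<ge> 0"
    using r(1) by (simp add: M_def)
  have approx: "\<exists>x. norm x \<le> M * norm y \<and> norm (y - blinfun_apply T x) \<le> norm y / 2"
    if "y \<in> S" for y
  proof (cases "y = 0")
    case True
    then show ?thesis
      by (intro exI[of _ 0]) (simp add: blinfun.zero_right)
  next
    case False
    \<comment> \<open>Scale \<open>y\<close> so that \<open>y0 + c y\<close> stays in the ball around \<open>y0\<close>; the difference of near-preimages
      of \<open>y0 + c y\<close> and \<open>y0\<close> is then a near-preimage of \<open>c y\<close>.\<close>
    define c where "c = r / (2 * norm y)"
    have "c > 0"
      using False r(1) by (simp add: c_def)
    have near: "\<exists>a. norm a < real n \<and> norm (blinfun_apply T a - w) < c * norm y / 4"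
      if "w \<in> ball y0 r" "w \<in> S" for w
    proof -
      have "w \<in> closure (blinfun_apply T ` ball 0 (real n))"
        using that r(2) unfolding F_def by blast
      then obtain v where "v \<in> blinfun_apply T ` ball 0 (real n)" "dist v w < c * norm y / 4"
        unfolding closure_approachable using False \<open>c > 0\<close> by (metis divide_pos_pos mult_pos_pos
            zero_less_norm_iff zero_less_numeral)
      then show ?thesis
        by (auto simp: dist_norm)
    qed
    have "norm (c *\<^sub>R y) < r"
      using False r(1) by (simp add: c_def)
    then have "y0 + c *\<^sub>R y \<in> ball y0 r"
      by (simp add: dist_norm)
    then obtain a where a: "norm a < real n"
        "norm (blinfun_apply T a - (y0 + c *\<^sub>R y)) < c * norm y / 4"
      using near S_add[OF \<open>y0 \<in> S\<close> S_scale[OF \<open>y \<in> S\<close> \<open>y \<in> S\<close>]] by metis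
    obtain b where b: "norm b < real n" "norm (blinfun_apply T b - y0) < c * norm y / 4"
      using near[of y0] r(1) \<open>y0 \<in> S\<close> by auto
    define x where "x = inverse c *\<^sub>R (a - b)"
    have "norm (a - b) \<le> 2 * real n"
      using norm_triangle_ineq4[of a b] a(1) b(1) by linarith
    then have "norm x \<le> inverse c * (2 * real n)"
      using \<open>c > 0\<close> by (simp add: x_def)
    also have "\<dots> = M * norm y"
      using r(1) by (simp add: c_def M_def)
    finally have "norm x \<le> M * norm y" .
    moreover have "y - blinfun_apply T x = inverse c *\<^sub>R
        ((blinfun_apply T b - y0) - (blinfun_apply T a - (y0 + c *\<^sub>R y)))"
      using \<open>c > 0\<close> by (simp add: x_def blinfun.bilinear_simps algebra_simps)
    then have "norm (y - blinfun_apply T x) = inverse c *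
        norm ((blinfun_apply T b - y0) - (blinfun_apply T a - (y0 + c *\<^sub>R y)))"
      using \<open>c > 0\<close> by simp
    moreover have "\<dots> \<le> inverse c * (c * norm y / 4 + c * norm y / 4)"
      using \<open>c > 0\<close> a(2) b(2)
      by (intro mult_left_mono order_trans[OF norm_triangle_ineq4]) auto
    moreover have "\<dots> = norm y / 2"
      using \<open>c > 0\<close> by simp
    ultimately show ?thesis
      by (intro exI[of _ x]) linarith
  qed
  then obtain g where g: "\<And>y. y \<in> S \<Longrightarrow> norm (g y) \<le> M * norm y"
      "\<And>y. y \<in> S \<Longrightarrow> norm (y - blinfun_apply T (g y)) \<le> norm y / 2"
    by metis
  have "\<exists>x. blinfun_apply T x = y \<and> norm x \<le> (2 * M + 1) * norm y" if "y \<in> S" for y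
  proof -
    define w where "w k = ((\<lambda>v. v - blinfun_apply T (g v)) ^^ k) y" for k
    have w_Suc: "w (Suc k) = w k - blinfun_apply T (g (w k))" for k
      by (simp add: w_def)
    have w: "w k \<in> S \<and> norm (w k) \<le> (1/2) ^ k * norm y" for k
    proof (induction k)
      case 0
      then show ?case
        using that by (simp add: w_def)
    next
      case (Suc k)
      then have "norm (w (Suc k)) \<le> norm (w k) / 2"
        unfolding w_Suc using g(2) by blast
      moreover have "w (Suc k) \<in> S"
        unfolding w_Suc using Suc by (intro S_diff) (auto simp: S_def)
      ultimately show ?case
        using Suc by auto
    qed
    have gw: "norm (g (w k)) \<le> M * norm y * (1/2) ^ k" for k
    proof -
      have "norm (g (w k)) \<le> M * norm (w k)"
        using g(1) w by blast
      also have "\<dots> \<le> M * ((1/2) ^ k * norm y)"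
        using w \<open>M \<ge> 0\<close> by (intro mult_left_mono) auto
      finally show ?thesis
        by (simp add: mult_ac)
    qed
    have geo: "(\<lambda>k. M * norm y * (1/2) ^ k) sums (M * norm y * 2)"
      using sums_mult[OF geometric_sums[of "1/2::real"], of "M * norm y"] by simp
    have sum_g: "summable (\<lambda>k. norm (g (w k)))"
      by (rule summable_comparison_test'[OF sums_summable[OF geo]]) (use gw in auto)
    define x where "x = (\<Sum>k. g (w k))"
    have "norm x \<le> (\<Sum>k. norm (g (w k)))"
      unfolding x_def by (rule summable_norm[OF sum_g])
    also have "\<dots> \<le> M * norm y * 2"
      using suminf_le[OF gw sum_g sums_summable[OF geo]] sums_unique[OF geo] by simp
    also have "\<dots> \<le> (2 * M + 1) * norm y"
      by (simp add: algebra_simps)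
    finally have "norm x \<le> (2 * M + 1) * norm y" .
    moreover have "blinfun_apply T x = y"
    proof -
      have "(\<lambda>k. (1/2) ^ k * norm y) \<longlonglongrightarrow> 0"
        by (intro tendsto_mult_left_zero LIMSEQ_power_zero) simp
      then have "w \<longlonglongrightarrow> 0"
        by (rule Lim_null_comparison[rotated]) (use w in auto)
      then have "(\<lambda>k. w k - w (Suc k)) sums (w 0 - 0)"
        by (rule telescope_sums')
      then have "(\<lambda>k. blinfun_apply T (g (w k))) sums y"
        by (simp add: w_Suc) (simp add: w_def)
      moreover have "(\<lambda>k. blinfun_apply T (g (w k))) sums blinfun_apply T x"
        unfolding x_def
        by (intro bounded_linear.sums[OF blinfun.bounded_linear_right] summable_sums
            summable_norm_cancel[OF sum_g])
      ultimately show ?thesis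
        using sums_unique2 by blast
    qed
    ultimately show ?thesis
      by blast
  qed
  moreover have "2 * M + 1 > 0"
    using \<open>M \<ge> 0\<close> by simp
  ultimately show ?thesis
    unfolding S_def by blast
qed

lemma bounded_clinear_inv:
  fixes T :: "'a::complex_hilbert_space \<Rightarrow>\<^sub>L 'a"
  assumes "T \<in> bounded_operators" and bij: "bij (blinfun_apply T)"
  shows "bounded_clinear (inv (blinfun_apply T))"
proof -
  let ?T = "blinfun_apply T" and ?I = "inv (blinfun_apply T)"
  have inj: "inj ?T" and surj: "surj ?T"
    using bij by (auto simp: bij_def)
  have TI: "?T (?I y) = y" for y
    using surj by (rule surj_f_inv_f)
  have eqI: "?I y = x" if "?T x = y" for x y
    using that inj by (auto intro: inv_f_eq)
  obtain C where C: "C > 0" "\<forall>y\<in>range ?T. \<exists>x. ?T x = y \<and> norm x \<le> C * norm y"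
    using closed_range_bounded_preimage[of T] surj by auto
  have "bounded_linear ?I"
  proof (rule bounded_linear_intro[where K = C])
    show "norm (?I y) \<le> norm y * C" for y
    proof -
      obtain x where "?T x = y" "norm x \<le> C * norm y"
        using C(2) surj by blast
      moreover from this have "?I y = x"
        by (intro eqI)
      ultimately show ?thesis
        by (simp add: mult.commute)
    qed
  qed (auto intro!: eqI simp: blinfun.bilinear_simps TI)
  moreover have "?I (a *\<^sub>C y) = a *\<^sub>C ?I y" for a y
    by (rule eqI) (simp add: bounded_operators_scaleC assms(1) TI)
  ultimately show ?thesis
    unfolding bounded_clinear_def by blast
qed

text \<open>Solving \<open>x - T x = y\<close> for \<open>x\<close> means finding the fixed point of a contraction.\<close>

lemma bij_id_minus:
  fixes T :: "'a::complex_hilbert_space \<Rightarrow>\<^sub>L 'a"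
  assumes "norm T < 1"
  shows "bij (blinfun_apply (id_blinfun - T))"
proof -
  have "\<exists>!x. blinfun_apply (id_blinfun - T) x = y" for y
  proof -
    have "\<exists>!x. y + blinfun_apply T x = x"
    proof (rule banach_fix_type[where c = "norm T"])
      show "\<forall>x z. dist (y + blinfun_apply T x) (y + blinfun_apply T z) \<le> norm T * dist x z"
        by (metis add_diff_cancel_left blinfun.diff_right dist_norm norm_blinfun)
    qed (use assms in auto)
    moreover have "blinfun_apply (id_blinfun - T) x = y \<longleftrightarrow> y + blinfun_apply T x = x" for x
      by (auto simp: blinfun.bilinear_simps algebra_simps)
    ultimately show ?thesis
      by simp
  qed
  then show ?thesis
    by (simp add: bij_iff)
qed

text \<open>The range is closed, so \<open>T x\<close> has a preimage \<open>y\<close> with \<open>norm y \<le> C * norm (T x)\<close>. It differs from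
  \<open>x\<close> by an element of the kernel, and among such \<open>y\<close> the one orthogonal to the kernel is
  shortest.\<close>

lemma fredholm_bounded_below:
  fixes T :: "'a::complex_hilbert_space \<Rightarrow>\<^sub>L 'a"
  assumes "fredholm T"
  obtains U C where "finite U" "C > 0"
    "\<And>x. (\<And>u. u \<in> U \<Longrightarrow> cinner u x = 0) \<Longrightarrow> norm x \<le> C * norm (blinfun_apply T x)"
proof -
  have "finite_cdim {x. blinfun_apply T x = 0}" "closed (range (blinfun_apply T))"
    using assms unfolding fredholm_def by auto
  then obtain U C where U: "orthonormal U" "finite U" "cspan U = {x. blinfun_apply T x = 0}"
    and C: "C > 0" "\<forall>y\<in>range (blinfun_apply T). \<exists>x. blinfun_apply T x = y \<and> norm x \<le> C * norm y"
    using closed_range_bounded_preimage by (metis finite_cdim_orthonormal)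
  have "norm x \<le> C * norm (blinfun_apply T x)" if "\<And>u. u \<in> U \<Longrightarrow> cinner u x = 0" for x
  proof -
    obtain y where y: "blinfun_apply T y = blinfun_apply T x"
        "norm y \<le> C * norm (blinfun_apply T x)"
      using C(2) by blast
    have "x - y \<in> cspan U"
      using y(1) U(3) by (simp add: blinfun.diff_right)
    then have "norm (x - orthogonal_projection U x) \<le> norm (x - (x - y))"
      by (rule norm_residual_le[OF U(1,2)])
    moreover have "orthogonal_projection U x = 0"
      using that by (simp add: orthogonal_projection_def)
    ultimately show ?thesis
      using y(2) by simp
  qed
  then show thesis
    using that U(2) C(1) by blast
qed

section \<open>Holomorphic operator functions\<close>

text \<open>The derivative is a real Frechet derivative, as in \<open>operator_deriv\<close>; being of the form
  \<open>h \<mapsto> h D\<close> is the Cauchy--Riemann condition. Matrix elements \<open>\<langle>x, F z y\<rangle>\<close> are then ordinary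
  holomorphic functions, which is how Cauchy's theorem is brought to bear.\<close>

definition operator_holomorphic_on ::
    "(complex \<Rightarrow> ('a::complex_hilbert_space \<Rightarrow>\<^sub>L 'a)) \<Rightarrow> complex set \<Rightarrow> bool"
  where "operator_holomorphic_on F S \<longleftrightarrow>
    (\<forall>z\<in>S. F z \<in> bounded_operators \<and> (\<exists>D. (F has_derivative (\<lambda>h. h *\<^sub>B D)) (at z)))"

lemma operator_holomorphic_on_const:
  "T \<in> bounded_operators \<Longrightarrow> operator_holomorphic_on (\<lambda>_. T) S"
  unfolding operator_holomorphic_on_def
  by (auto intro!: exI[of _ 0] simp: scaleC_blinfun.zero_right)

lemma operator_holomorphic_on_add:
  assumes "operator_holomorphic_on F S" "operator_holomorphic_on G S"
  shows "operator_holomorphic_on (\<lambda>z. F z + G z) S"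
  unfolding operator_holomorphic_on_def
proof (intro ballI conjI)
  fix z assume "z \<in> S"
  with assms show "F z + G z \<in> bounded_operators"
    unfolding operator_holomorphic_on_def by auto
  obtain D D' where "(F has_derivative (\<lambda>h. h *\<^sub>B D)) (at z)" "(G has_derivative (\<lambda>h. h *\<^sub>B D')) (at z)"
    using assms \<open>z \<in> S\<close> unfolding operator_holomorphic_on_def by blast
  from has_derivative_add[OF this]
  show "\<exists>D. ((\<lambda>z. F z + G z) has_derivative (\<lambda>h. h *\<^sub>B D)) (at z)"
    by (auto simp flip: scaleC_blinfun.add_right)
qed

lemma operator_holomorphic_on_scaleC:
  assumes "operator_holomorphic_on F S" "f holomorphic_on S" "open S"
  shows "operator_holomorphic_on (\<lambda>z. f z *\<^sub>B F z) S"
  unfolding operator_holomorphic_on_def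
proof (intro ballI conjI)
  fix z assume "z \<in> S"
  with assms show "f z *\<^sub>B F z \<in> bounded_operators"
    unfolding operator_holomorphic_on_def by auto
  obtain D where D: "(F has_derivative (\<lambda>h. h *\<^sub>B D)) (at z)"
    using assms \<open>z \<in> S\<close> unfolding operator_holomorphic_on_def by blast
  have "(f has_derivative (\<lambda>h. deriv f z * h)) (at z)"
    using holomorphic_derivI[OF assms(2,3) \<open>z \<in> S\<close>] by (simp add: has_field_derivative_def)
  from scaleC_blinfun.FDERIV[OF this D]
  have "((\<lambda>z. f z *\<^sub>B F z) has_derivative (\<lambda>h. h *\<^sub>B (f z *\<^sub>B D + deriv f z *\<^sub>B F z))) (at z)"
    by (simp add: scaleC_blinfun.add_right scaleC_blinfun_scaleC_blinfun mult.commute)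
  then show "\<exists>D. ((\<lambda>z. f z *\<^sub>B F z) has_derivative (\<lambda>h. h *\<^sub>B D)) (at z)"
    by blast
qed

lemma operator_holomorphic_on_diff:
  assumes "operator_holomorphic_on F S" "operator_holomorphic_on G S"
  shows "operator_holomorphic_on (\<lambda>z. F z - G z) S"
  unfolding operator_holomorphic_on_def
proof (intro ballI conjI)
  fix z assume "z \<in> S"
  with assms show "F z - G z \<in> bounded_operators"
    unfolding operator_holomorphic_on_def by auto
  obtain D D' where "(F has_derivative (\<lambda>h. h *\<^sub>B D)) (at z)" "(G has_derivative (\<lambda>h. h *\<^sub>B D')) (at z)"
    using assms \<open>z \<in> S\<close> unfolding operator_holomorphic_on_def by blast
  from has_derivative_diff[OF this]
  show "\<exists>D. ((\<lambda>z. F z - G z) has_derivative (\<lambda>h. h *\<^sub>B D)) (at z)"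
    by (auto simp flip: scaleC_blinfun.diff_right)
qed

lemma has_derivative_blinfun_compose_scaleC:
  assumes "F z \<in> bounded_operators"
    and "(F has_derivative (\<lambda>h. h *\<^sub>B D)) (at z)" "(G has_derivative (\<lambda>h. h *\<^sub>B D')) (at z)"
  shows "((\<lambda>z. F z o\<^sub>L G z) has_derivative (\<lambda>h. h *\<^sub>B ((F z o\<^sub>L D') + (D o\<^sub>L G z)))) (at z)"
proof -
  interpret comp: bounded_bilinear blinfun_compose
    by (rule bounded_bilinear_blinfun_compose)
  from comp.FDERIV[OF assms(2,3)] show ?thesis
    by (simp add: blinfun_compose_scaleC_right[OF assms(1)] blinfun_compose_scaleC_left
        scaleC_blinfun.add_right)
qed

lemma operator_holomorphic_on_compose:
  assumes "operator_holomorphic_on F S" "operator_holomorphic_on G S"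
  shows "operator_holomorphic_on (\<lambda>z. F z o\<^sub>L G z) S"
  unfolding operator_holomorphic_on_def
proof (intro ballI conjI)
  fix z assume "z \<in> S"
  with assms have F: "F z \<in> bounded_operators" and "G z \<in> bounded_operators"
    unfolding operator_holomorphic_on_def by auto
  then show "F z o\<^sub>L G z \<in> bounded_operators"
    by auto
  obtain D D' where "(F has_derivative (\<lambda>h. h *\<^sub>B D)) (at z)" "(G has_derivative (\<lambda>h. h *\<^sub>B D')) (at z)"
    using assms \<open>z \<in> S\<close> unfolding operator_holomorphic_on_def by blast
  from has_derivative_blinfun_compose_scaleC[OF F this]
  show "\<exists>D. ((\<lambda>z. F z o\<^sub>L G z) has_derivative (\<lambda>h. h *\<^sub>B D)) (at z)"
    by blast
qed

lemmas operator_holomorphic_intros =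
  operator_holomorphic_on_const operator_holomorphic_on_add operator_holomorphic_on_diff
  operator_holomorphic_on_scaleC operator_holomorphic_on_compose

lemma operator_holomorphic_on_imp_continuous_on:
  assumes "operator_holomorphic_on F S" "S' \<subseteq> S"
  shows "continuous_on S' F"
proof (rule continuous_at_imp_continuous_on, rule ballI)
  fix z assume "z \<in> S'"
  then show "isCont F z"
    using assms unfolding operator_holomorphic_on_def by (meson has_derivative_continuous subsetD)
qed

lemma operator_holomorphic_on_cinner:
  assumes "operator_holomorphic_on F S"
  shows "(\<lambda>z. cinner x (blinfun_apply (F z) y)) holomorphic_on S"
  unfolding holomorphic_on_def
proof
  fix z assume "z \<in> S"
  then obtain D where D: "(F has_derivative (\<lambda>h. h *\<^sub>B D)) (at z)"
    using assms unfolding operator_holomorphic_on_def by blast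
  have "((\<lambda>z. cinner x (blinfun_apply (F z) y)) has_field_derivative
      cinner x (blinfun_apply D y)) (at z)"
    using bounded_linear.has_derivative[OF bounded_linear_cinner_apply D, of x y]
    by (simp add: has_field_derivative_def cinner_scaleC_right mult_commute_abs)
  then show "(\<lambda>z. cinner x (blinfun_apply (F z) y)) field_differentiable at z within S"
    using field_differentiable_at_within field_differentiable_def by blast
qed

lemma operator_deriv_eq:
  assumes "(M has_derivative (\<lambda>h. h *\<^sub>B D)) (at z)"
  shows "operator_deriv M z = D"
  unfolding operator_deriv_def
proof (rule the_equality[where P = "\<lambda>D. (M has_derivative (\<lambda>h. h *\<^sub>B D)) (at z)", OF assms])
  fix D' assume "(M has_derivative (\<lambda>h. h *\<^sub>B D')) (at z)"
  then have "(\<lambda>h. h *\<^sub>B D') = (\<lambda>h. h *\<^sub>B D)"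
    using assms has_derivative_unique by blast
  then have "1 *\<^sub>B D' = 1 *\<^sub>B D"
    by (rule fun_cong)
  then show "D' = D"
    by simp
qed

section \<open>Residues of operator functions\<close>

text \<open>For \<open>F\<close> holomorphic on a punctured disc around \<open>z0\<close> this does not depend on the radius and is the
  Laurent coefficient of \<open>(z - z0)\<^sup>-\<^sup>1\<close>.\<close>

definition circle_residue ::
    "complex \<Rightarrow> real \<Rightarrow> (complex \<Rightarrow> ('a::complex_hilbert_space \<Rightarrow>\<^sub>L 'a)) \<Rightarrow> ('a \<Rightarrow>\<^sub>L 'a)"
  where "circle_residue z0 r F =
    (1 / (2 * of_real pi * \<i>)) *\<^sub>B operator_contour_integral (circlepath z0 r) F"

lemma operator_contour_integral_circlepath:
  "operator_contour_integral (circlepath z0 r) F =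
    integral {0..1} (\<lambda>t. (2 * pi * \<i> * r * exp (2 * of_real pi * \<i> * t)) *\<^sub>B F (circlepath z0 r t))"
  unfolding operator_contour_integral_def
  by (rule integral_cong) (simp add: vector_derivative_circlepath01)

lemma circlepath_in_sphere: "r \<ge> 0 \<Longrightarrow> circlepath z0 r t \<in> sphere z0 r"
  by (simp add: circlepath dist_norm norm_mult)

lemma continuous_on_circle_integrand:
  assumes "continuous_on (sphere z0 r) F" "r \<ge> 0"
  shows "continuous_on {0..1}
    (\<lambda>t. (2 * pi * \<i> * r * exp (2 * of_real pi * \<i> * t)) *\<^sub>B F (circlepath z0 r t))"
proof -
  have "continuous_on {0..1} (\<lambda>t. F (circlepath z0 r t))"
    by (rule continuous_on_compose2[OF assms(1)])
      (use circlepath_in_sphere[OF assms(2)] path_circlepath[of z0 r] in \<open>auto simp: path_def\<close>)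
  then show ?thesis
    by (intro scaleC_blinfun.continuous_on continuous_intros)
qed

lemmas integrable_circle_integrand =
  integrable_continuous_real[OF continuous_on_circle_integrand]

lemma circle_residue_cong:
  assumes "\<And>z. z \<in> sphere z0 r \<Longrightarrow> F z = G z" "r \<ge> 0"
  shows "circle_residue z0 r F = circle_residue z0 r G"
  unfolding circle_residue_def operator_contour_integral_circlepath
  using assms circlepath_in_sphere by (metis (no_types, lifting))

lemma circle_residue_linear:
  assumes "continuous_on (sphere z0 r) F" "r \<ge> 0"
    and "bounded_linear f" "\<And>a T. f (a *\<^sub>B T) = a *\<^sub>B f T"
  shows "f (circle_residue z0 r F) = circle_residue z0 r (\<lambda>z. f (F z))"
  unfolding circle_residue_def operator_contour_integral_circlepath
  using integral_linear[OF integrable_circle_integrand[OF assms(1,2)] assms(3)]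
  by (simp add: o_def assms(4))

lemma circle_residue_compose_left:
  assumes "continuous_on (sphere z0 r) F" "r \<ge> 0" "T \<in> bounded_operators"
  shows "T o\<^sub>L circle_residue z0 r F = circle_residue z0 r (\<lambda>z. T o\<^sub>L F z)"
  using assms by (intro circle_residue_linear blinfun_compose_scaleC_right
      bounded_bilinear.bounded_linear_right[OF bounded_bilinear_blinfun_compose])

lemma circle_residue_compose_right:
  assumes "continuous_on (sphere z0 r) F" "r \<ge> 0"
  shows "circle_residue z0 r F o\<^sub>L T = circle_residue z0 r (\<lambda>z. F z o\<^sub>L T)"
  using assms by (intro circle_residue_linear[where f = "\<lambda>S. S o\<^sub>L T"] blinfun_compose_scaleC_left
      bounded_bilinear.bounded_linear_left[OF bounded_bilinear_blinfun_compose])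

lemma circle_residue_scaleC:
  assumes "continuous_on (sphere z0 r) F" "r \<ge> 0"
  shows "circle_residue z0 r (\<lambda>z. a *\<^sub>B F z) = a *\<^sub>B circle_residue z0 r F"
  using assms
  by (intro circle_residue_linear[symmetric, where f = "\<lambda>T. a *\<^sub>B T"] scaleC_blinfun.bounded_linear_right)
    (simp_all add: scaleC_blinfun_scaleC_blinfun mult.commute)

lemma circle_residue_add:
  assumes "continuous_on (sphere z0 r) F" "continuous_on (sphere z0 r) G" "r \<ge> 0"
  shows "circle_residue z0 r (\<lambda>z. F z + G z) = circle_residue z0 r F + circle_residue z0 r G"
  unfolding circle_residue_def operator_contour_integral_circlepath
  using integral_add[OF integrable_circle_integrand[OF assms(1,3)]
      integrable_circle_integrand[OF assms(2,3)]]
  by (simp add: scaleC_blinfun.add_right)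

lemma circle_residue_diff:
  assumes "continuous_on (sphere z0 r) F" "continuous_on (sphere z0 r) G" "r \<ge> 0"
  shows "circle_residue z0 r (\<lambda>z. F z - G z) = circle_residue z0 r F - circle_residue z0 r G"
  unfolding circle_residue_def operator_contour_integral_circlepath
  using integral_diff[OF integrable_circle_integrand[OF assms(1,3)]
      integrable_circle_integrand[OF assms(2,3)]]
  by (simp add: scaleC_blinfun.diff_right)

lemma norm_circle_residue_le:
  assumes "continuous_on (sphere z0 r) F" "r \<ge> 0" "\<And>z. z \<in> sphere z0 r \<Longrightarrow> norm (F z) \<le> B"
  shows "norm (circle_residue z0 r F) \<le> r * B"
proof -
  have "norm (integral {0..1}
      (\<lambda>t. (2 * pi * \<i> * r * exp (2 * of_real pi * \<i> * t)) *\<^sub>B F (circlepath z0 r t)))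
    \<le> (2 * pi * r * B) * (1 - 0)"
  proof (rule integral_bound[OF _ continuous_on_circle_integrand[OF assms(1,2)]])
    fix t :: real
    have "norm ((2 * pi * \<i> * r * exp (2 * of_real pi * \<i> * t)) *\<^sub>B F (circlepath z0 r t))
        \<le> 2 * pi * r * norm (F (circlepath z0 r t))"
      by (rule order_trans[OF norm_scaleC_blinfun_le]) (use assms(2) in \<open>simp add: norm_mult\<close>)
    also have "\<dots> \<le> 2 * pi * r * B"
      using assms circlepath_in_sphere by (intro mult_left_mono) auto
    finally show "norm ((2 * pi * \<i> * r * exp (2 * of_real pi * \<i> * t)) *\<^sub>B F (circlepath z0 r t))
        \<le> 2 * pi * r * B" .
  qed simp
  then have "cmod (1 / (2 * of_real pi * \<i>)) * norm (operator_contour_integral (circlepath z0 r) F)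
      \<le> cmod (1 / (2 * of_real pi * \<i>)) * (2 * pi * r * B)"
    unfolding operator_contour_integral_circlepath by (intro mult_left_mono) auto
  also have "\<dots> = r * B"
    by (simp add: norm_divide norm_mult)
  finally show ?thesis
    unfolding circle_residue_def using norm_scaleC_blinfun_le order_trans by blast
qed

lemma cinner_circle_residue:
  assumes "continuous_on (sphere z0 r) F" "r \<ge> 0"
  shows "cinner x (blinfun_apply (circle_residue z0 r F) y) =
    1 / (2 * of_real pi * \<i>) *
      contour_integral (circlepath z0 r) (\<lambda>z. cinner x (blinfun_apply (F z) y))"
  unfolding circle_residue_def operator_contour_integral_circlepath contour_integral_integral
    vector_derivative_circlepath
  using integral_linear[OF integrable_circle_integrand[OF assms] bounded_linear_cinner_apply, of x y]
  by (simp add: o_def cinner_scaleC_right mult.commute)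

lemma continuous_on_cinner_apply:
  "continuous_on S F \<Longrightarrow> continuous_on S (\<lambda>z. cinner x (blinfun_apply (F z) y))"
  by (rule bounded_linear.continuous_on[OF bounded_linear_cinner_apply])

lemma circle_residue_in_bounded_operators:
  assumes "continuous_on (sphere z0 r) F" "r \<ge> 0"
    and "\<And>z. z \<in> sphere z0 r \<Longrightarrow> F z \<in> bounded_operators"
  shows "circle_residue z0 r F \<in> bounded_operators"
proof (rule bounded_operatorsI, rule eq_if_cinner_eq)
  fix a x y
  have int: "(\<lambda>z. cinner x (blinfun_apply (F z) y)) contour_integrable_on circlepath z0 r"
    using assms(1,2) by (intro contour_integrable_continuous_circlepath continuous_on_cinner_apply) simp
  have "contour_integral (circlepath z0 r) (\<lambda>z. cinner x (blinfun_apply (F z) (a *\<^sub>C y))) =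
      contour_integral (circlepath z0 r) (\<lambda>z. a * cinner x (blinfun_apply (F z) y))"
    using assms(2,3) by (intro contour_integral_cong)
      (auto simp: bounded_operators_scaleC cinner_scaleC_right)
  also have "\<dots> = a * contour_integral (circlepath z0 r) (\<lambda>z. cinner x (blinfun_apply (F z) y))"
    by (rule contour_integral_lmul[OF int])
  finally show "cinner x (blinfun_apply (circle_residue z0 r F) (a *\<^sub>C y)) =
      cinner x (a *\<^sub>C blinfun_apply (circle_residue z0 r F) y)"
    by (simp add: cinner_circle_residue[OF assms(1,2)] cinner_scaleC_right)
qed

lemma circle_residue_scalar:
  assumes "continuous_on (sphere z0 r) f" "r \<ge> 0"
  shows "circle_residue z0 r (\<lambda>z. f z *\<^sub>B T) =
    (1 / (2 * of_real pi * \<i>) * contour_integral (circlepath z0 r) f) *\<^sub>B T"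
proof (rule blinfun_eq_if_cinner_eq)
  fix x y
  have "continuous_on (sphere z0 r) (\<lambda>z. f z *\<^sub>B T)"
    by (intro scaleC_blinfun.continuous_on assms continuous_intros)
  moreover have "f contour_integrable_on circlepath z0 r"
    using assms by (intro contour_integrable_continuous_circlepath) simp
  ultimately show "cinner x (blinfun_apply (circle_residue z0 r (\<lambda>z. f z *\<^sub>B T)) y) =
      cinner x (blinfun_apply ((1 / (2 * of_real pi * \<i>) *
        contour_integral (circlepath z0 r) f) *\<^sub>B T) y)"
    using assms by (simp add: cinner_circle_residue cinner_scaleC_right contour_integral_rmul)
qed

lemma circle_residue_Cauchy_kernel:
  assumes "w \<in> ball z0 r"
  shows "circle_residue z0 r (\<lambda>z. (1 / (z - w)) *\<^sub>B T) = T"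
proof -
  have "((\<lambda>u. 1 / (u - w)) has_contour_integral (2 * of_real pi * \<i> * 1)) (circlepath z0 r)"
    using assms
    by (intro Cauchy_integral_circlepath_simple) (auto simp: dist_norm norm_minus_commute)
  then have "contour_integral (circlepath z0 r) (\<lambda>z. 1 / (z - w)) = 2 * of_real pi * \<i>"
    using contour_integral_unique by auto
  moreover have "r \<ge> 0"
    using assms by (meson less_imp_le mem_ball zero_le_dist order_le_less_trans)
  moreover have "continuous_on (sphere z0 r) (\<lambda>z. 1 / (z - w))"
    using assms by (intro continuous_intros) auto
  ultimately show ?thesis
    by (simp add: circle_residue_scalar)
qed

lemma circle_residue_power:
  assumes "r > 0"
  shows "circle_residue z0 r (\<lambda>z. (z - z0) ^ m *\<^sub>B T) = 0"
proof -
  have "((\<lambda>z. (z - z0) ^ m) has_contour_integral 0) (circlepath z0 r)"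
    by (rule Cauchy_theorem_disc_simple[of _ z0 "r + 1"])
      (use assms in \<open>auto intro!: holomorphic_intros\<close>)
  then have "contour_integral (circlepath z0 r) (\<lambda>z. (z - z0) ^ m) = 0"
    by (rule contour_integral_unique)
  moreover have "continuous_on (sphere z0 r) (\<lambda>z. (z - z0) ^ m)"
    by (intro continuous_intros)
  ultimately show ?thesis
    using assms by (simp add: circle_residue_scalar scaleC_blinfun.zero_left)
qed

lemma circle_residue_radius_le:
  assumes "operator_holomorphic_on F (S - {z0})" "open S" "cball z0 s \<subseteq> S" "0 < r" "r \<le> s"
  shows "circle_residue z0 s F = circle_residue z0 r F"
proof (rule blinfun_eq_if_cinner_eq)
  fix x y
  have "sphere z0 t \<subseteq> S - {z0}" if "0 < t" "t \<le> s" for t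
    using assms(3) that by fastforce
  then have cont: "continuous_on (sphere z0 t) F" if "0 < t" "t \<le> s" for t
    using operator_holomorphic_on_imp_continuous_on[OF assms(1)] that by blast
  have "contour_integral (circlepath z0 s) (\<lambda>z. cinner x (blinfun_apply (F z) y)) =
      contour_integral (circlepath z0 r) (\<lambda>z. cinner x (blinfun_apply (F z) y))"
    by (rule contour_integral_circlepath_eq(3)[OF assms(2)
          operator_holomorphic_on_cinner[OF assms(1)] assms(4,5,3)])
  then show "cinner x (blinfun_apply (circle_residue z0 s F) y) =
      cinner x (blinfun_apply (circle_residue z0 r F) y)"
    using assms(4,5) by (simp add: cinner_circle_residue cont)
qed

lemma circle_residue_radius:
  assumes "operator_holomorphic_on F (S - {z0})" "open S"
    and "cball z0 s \<subseteq> S" "cball z0 r \<subseteq> S" "0 < r" "0 < s"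
  shows "circle_residue z0 s F = circle_residue z0 r F"
proof (cases "r \<le> s")
  case True
  then show ?thesis
    using circle_residue_radius_le assms by blast
next
  case False
  then have "s \<le> r"
    by simp
  then show ?thesis
    using circle_residue_radius_le[OF assms(1,2,4,6)] by simp
qed

text \<open>A consequence of Riemann's theorem on removable singularities, obtained directly: the residue is
  at most \<open>B\<close> times the radius of the circle, which can be shrunk.\<close>

lemma circle_residue_bounded_eq_0:
  assumes "operator_holomorphic_on F (ball z0 R - {z0})" "0 < r" "r < R"
    and "0 < \<delta>" and bound: "\<And>z. z \<noteq> z0 \<Longrightarrow> dist z0 z < \<delta> \<Longrightarrow> norm (F z) \<le> B"
  shows "circle_residue z0 r F = 0"
proof (rule ccontr)
  assume neq: "circle_residue z0 r F \<noteq> 0"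
  define n where "n = norm (circle_residue z0 r F)"
  have "n > 0"
    using neq by (simp add: n_def)
  define t where "t = min (min (r / 2) (\<delta> / 2)) (n / (2 * (\<bar>B\<bar> + 1)))"
  have "n / (2 * (\<bar>B\<bar> + 1)) > 0"
    using \<open>n > 0\<close> by simp
  then have t: "t > 0" "t < r" "t < \<delta>" "t \<le> n / (2 * (\<bar>B\<bar> + 1))"
    unfolding t_def using assms by linarith+
  have "circle_residue z0 r F = circle_residue z0 t F"
    by (rule circle_residue_radius_le[OF assms(1)]) (use t assms in auto)
  moreover have "norm (circle_residue z0 t F) \<le> t * (\<bar>B\<bar> + 1)"
  proof (rule norm_circle_residue_le)
    show "continuous_on (sphere z0 t) F"
      by (rule operator_holomorphic_on_imp_continuous_on[OF assms(1)]) (use t assms in auto)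
    fix z assume "z \<in> sphere z0 t"
    then have "norm (F z) \<le> B"
      using t by (intro bound) auto
    then show "norm (F z) \<le> \<bar>B\<bar> + 1"
      by linarith
  qed (use t in simp)
  moreover have "t * (\<bar>B\<bar> + 1) \<le> n / 2"
    using t(4) by (simp add: pos_le_divide_eq field_simps)
  ultimately have "n \<le> n / 2"
    unfolding n_def by (metis order_trans)
  then show False
    using \<open>n > 0\<close> by simp
qed

text \<open>With \<open>U\<close> an orthonormal basis of the range of \<open>P\<close> and \<open>F z = P X\<close>, the sums are traces. Equality of
  traces thus passes from the integrands to the integrals.\<close>

lemma sum_cinner_circle_residue_cong:
  assumes "finite U" "r \<ge> 0"
    and F: "continuous_on (sphere z0 r) F" and G: "continuous_on (sphere z0 r) G"
    and eq: "\<And>z. z \<in> sphere z0 r \<Longrightarrow>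
      (\<Sum>u\<in>U. cinner u (blinfun_apply (F z) u)) = (\<Sum>u\<in>U. cinner u (blinfun_apply (G z) u))"
  shows "(\<Sum>u\<in>U. cinner u (blinfun_apply (circle_residue z0 r F) u)) =
    (\<Sum>u\<in>U. cinner u (blinfun_apply (circle_residue z0 r G) u))"
proof -
  have sum: "(\<Sum>u\<in>U. cinner u (blinfun_apply (circle_residue z0 r F) u)) =
      1 / (2 * of_real pi * \<i>) *
        contour_integral (circlepath z0 r) (\<lambda>z. \<Sum>u\<in>U. cinner u (blinfun_apply (F z) u))"
    if "continuous_on (sphere z0 r) F" for F :: "complex \<Rightarrow> 'a \<Rightarrow>\<^sub>L 'a"
  proof -
    have "contour_integral (circlepath z0 r) (\<lambda>z. \<Sum>u\<in>U. cinner u (blinfun_apply (F z) u)) =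
        (\<Sum>u\<in>U. contour_integral (circlepath z0 r) (\<lambda>z. cinner u (blinfun_apply (F z) u)))"
      using assms(1,2) that
      by (intro contour_integral_sum contour_integrable_continuous_circlepath continuous_on_cinner_apply) auto
    then show ?thesis
      using that assms(2) by (simp add: cinner_circle_residue sum_distrib_left)
  qed
  have "contour_integral (circlepath z0 r) (\<lambda>z. \<Sum>u\<in>U. cinner u (blinfun_apply (F z) u)) =
      contour_integral (circlepath z0 r) (\<lambda>z. \<Sum>u\<in>U. cinner u (blinfun_apply (G z) u))"
    using eq assms(2) by (intro contour_integral_cong) auto
  then show ?thesis
    by (simp add: sum[OF F] sum[OF G])
qed

section \<open>Resolvents\<close>

definition bounded_resolvent :: "'a::complex_hilbert_space operator \<Rightarrow> complex \<Rightarrow> ('a \<Rightarrow>\<^sub>L 'a)"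
  where "bounded_resolvent A z = Blinfun (resolvent A z)"

lemma
  assumes "z \<in> resolvent_set A"
  shows bounded_resolvent_apply: "blinfun_apply (bounded_resolvent A z) = resolvent A z"
    and bounded_resolvent_in_bounded_operators: "bounded_resolvent A z \<in> bounded_operators"
  using assms Blinfun_bounded_clinear unfolding resolvent_set_def bounded_resolvent_def by auto

lemma
  assumes "z \<in> resolvent_set A"
  shows resolvent_in_dom: "blinfun_apply (bounded_resolvent A z) x \<in> op_dom A"
    and resolvent_right_inverse:
      "op_app A (blinfun_apply (bounded_resolvent A z) x) - z *\<^sub>C blinfun_apply (bounded_resolvent A z) x = x"
proof -
  have bij: "bij_betw (\<lambda>x. op_app A x - z *\<^sub>C x) (op_dom A) UNIV"
    using assms unfolding resolvent_set_def by blast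
  show "blinfun_apply (bounded_resolvent A z) x \<in> op_dom A"
    unfolding bounded_resolvent_apply[OF assms] resolvent_def
    using bij by (intro inv_into_into) (simp add: bij_betw_def)
  show "op_app A (blinfun_apply (bounded_resolvent A z) x) - z *\<^sub>C blinfun_apply (bounded_resolvent A z) x = x"
    unfolding bounded_resolvent_apply[OF assms] resolvent_def
    using bij by (intro f_inv_into_f[where f = "\<lambda>x. op_app A x - z *\<^sub>C x"]) (simp add: bij_betw_def)
qed

lemma resolvent_left_inverse:
  assumes "z \<in> resolvent_set A" "x \<in> op_dom A"
  shows "blinfun_apply (bounded_resolvent A z) (op_app A x - z *\<^sub>C x) = x"
  unfolding bounded_resolvent_apply[OF assms(1)] resolvent_def
  using assms unfolding resolvent_set_def
  by (intro inv_into_f_f[where f = "\<lambda>x. op_app A x - z *\<^sub>C x"]) (simp_all add: bij_betw_def)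

lemma resolvent_identity:
  assumes "z \<in> resolvent_set A" "w \<in> resolvent_set A"
  shows "bounded_resolvent A z - bounded_resolvent A w =
    (z - w) *\<^sub>B (bounded_resolvent A z o\<^sub>L bounded_resolvent A w)"
proof (rule blinfun_eqI)
  fix x
  define u where "u = blinfun_apply (bounded_resolvent A w) x"
  have u: "u \<in> op_dom A" "op_app A u - w *\<^sub>C u = x"
    unfolding u_def by (rule resolvent_in_dom[OF assms(2)], rule resolvent_right_inverse[OF assms(2)])
  have "op_app A u - z *\<^sub>C u = x - (z - w) *\<^sub>C u"
    unfolding u(2)[symmetric] by (simp add: scaleC_diff_left)
  then have "blinfun_apply (bounded_resolvent A z) (x - (z - w) *\<^sub>C u) = u"
    using resolvent_left_inverse[OF assms(1) u(1)] by simp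
  then show "blinfun_apply (bounded_resolvent A z - bounded_resolvent A w) x =
      blinfun_apply ((z - w) *\<^sub>B (bounded_resolvent A z o\<^sub>L bounded_resolvent A w)) x"
    by (simp add: blinfun.bilinear_simps u_def[symmetric] algebra_simps
        bounded_operators_scaleC[OF bounded_resolvent_in_bounded_operators[OF assms(1)]])
qed

text \<open>All resolvents factor through one of them. Operators that are bounded only after composition
  with a resolvent, such as \<open>V\<close>, can thus be moved past contour integrals.\<close>

lemma resolvent_shift:
  assumes "z \<in> resolvent_set A" "w \<in> resolvent_set A"
  shows "bounded_resolvent A z =
    bounded_resolvent A w o\<^sub>L (id_blinfun + (z - w) *\<^sub>B bounded_resolvent A z)"
proof (rule blinfun_eqI)
  fix x
  have "blinfun_apply (bounded_resolvent A w - bounded_resolvent A z) x =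
      (w - z) *\<^sub>C blinfun_apply (bounded_resolvent A w) (blinfun_apply (bounded_resolvent A z) x)"
    unfolding resolvent_identity[OF assms(2,1)] by simp
  then show "blinfun_apply (bounded_resolvent A z) x = blinfun_apply
      (bounded_resolvent A w o\<^sub>L (id_blinfun + (z - w) *\<^sub>B bounded_resolvent A z)) x"
    by (simp add: blinfun.bilinear_simps scaleC_diff_left algebra_simps
        bounded_operators_scaleC[OF bounded_resolvent_in_bounded_operators[OF assms(2)]])
qed

lemma resolvent_commute:
  assumes "z \<in> resolvent_set A" "w \<in> resolvent_set A"
  shows "bounded_resolvent A z o\<^sub>L bounded_resolvent A w =
    bounded_resolvent A w o\<^sub>L bounded_resolvent A z"
proof (cases "z = w")
  case False
  have "(z - w) *\<^sub>B (bounded_resolvent A z o\<^sub>L bounded_resolvent A w) =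
      - ((w - z) *\<^sub>B (bounded_resolvent A w o\<^sub>L bounded_resolvent A z))"
    unfolding resolvent_identity[OF assms, symmetric] resolvent_identity[OF assms(2,1), symmetric]
    by simp
  also have "\<dots> = (z - w) *\<^sub>B (bounded_resolvent A w o\<^sub>L bounded_resolvent A z)"
    by (simp flip: scaleC_blinfun.minus_left)
  finally have "inverse (z - w) *\<^sub>B (z - w) *\<^sub>B (bounded_resolvent A z o\<^sub>L bounded_resolvent A w) =
      inverse (z - w) *\<^sub>B (z - w) *\<^sub>B (bounded_resolvent A w o\<^sub>L bounded_resolvent A z)"
    by simp
  then show ?thesis
    using False by (simp add: scaleC_blinfun_scaleC_blinfun)
qed simp

text \<open>\<open>A - w = (1 - (w - z) (A - z)\<^sup>-\<^sup>1) (A - z)\<close>.\<close>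

lemma resolvent_set_near:
  assumes z: "z \<in> resolvent_set A" and near: "cmod (w - z) * norm (bounded_resolvent A z) < 1"
  shows "w \<in> resolvent_set A"
proof -
  let ?R = "bounded_resolvent A z"
  define T where "T = (w - z) *\<^sub>B ?R"
  have T: "T \<in> bounded_operators"
    unfolding T_def using bounded_resolvent_in_bounded_operators[OF z] by auto
  have "norm T < 1"
    unfolding T_def using near norm_scaleC_blinfun_le le_less_trans by blast
  then have bij: "bij (blinfun_apply (id_blinfun - T))"
    by (rule bij_id_minus)
  let ?I = "inv (blinfun_apply (id_blinfun - T))"
  have factor: "op_app A x - w *\<^sub>C x = blinfun_apply (id_blinfun - T) (op_app A x - z *\<^sub>C x)"
    if "x \<in> op_dom A" for x
  proof -
    have "blinfun_apply T (op_app A x - z *\<^sub>C x) = (w - z) *\<^sub>C x"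
      by (simp add: T_def resolvent_left_inverse[OF z that])
    then show ?thesis
      by (simp add: blinfun.diff_left scaleC_diff_left)
  qed
  have bij_w: "bij_betw (\<lambda>x. op_app A x - w *\<^sub>C x) (op_dom A) UNIV"
  proof -
    have "bij_betw (blinfun_apply (id_blinfun - T) \<circ> (\<lambda>x. op_app A x - z *\<^sub>C x)) (op_dom A) UNIV"
      by (rule bij_betw_trans[OF _ bij]) (use z in \<open>simp add: resolvent_set_def\<close>)
    then show ?thesis
      by (subst bij_betw_cong[where g = "blinfun_apply (id_blinfun - T) \<circ> (\<lambda>x. op_app A x - z *\<^sub>C x)"])
        (simp_all add: factor)
  qed
  have inverse: "resolvent A w = (\<lambda>y. blinfun_apply ?R (?I y))"
  proof
    fix y
    have "blinfun_apply ?R (?I y) \<in> op_dom A"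
      by (rule resolvent_in_dom[OF z])
    moreover from this have "op_app A (blinfun_apply ?R (?I y)) - w *\<^sub>C blinfun_apply ?R (?I y) = y"
      using bij by (simp add: factor resolvent_right_inverse[OF z] bij_is_surj surj_f_inv_f)
    ultimately show "resolvent A w y = blinfun_apply ?R (?I y)"
      unfolding resolvent_def using bij_w
      by (intro inv_into_f_eq) (auto simp: bij_betw_def)
  qed
  have I: "bounded_clinear ?I"
    using bij T by (intro bounded_clinear_inv) auto
  have "bounded_clinear (resolvent A w)"
    unfolding inverse bounded_clinear_def
    using I bounded_linear_compose[OF blinfun.bounded_linear_right]
      bounded_operators_scaleC[OF bounded_resolvent_in_bounded_operators[OF z]]
    by (auto simp: bounded_clinear_def)
  with bij_w show ?thesis
    unfolding resolvent_set_def by blast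
qed

lemma open_resolvent_set: "open (resolvent_set A)"
  unfolding open_dist
proof
  fix z assume z: "z \<in> resolvent_set A"
  define e where "e = 1 / (norm (bounded_resolvent A z) + 1)"
  have "norm (bounded_resolvent A z) + 1 > 0"
    by (simp add: add_nonneg_pos)
  then have "e > 0"
    by (simp add: e_def)
  moreover have "w \<in> resolvent_set A" if "dist w z < e" for w
  proof (rule resolvent_set_near[OF z])
    have "cmod (w - z) * norm (bounded_resolvent A z) \<le> cmod (w - z) * (norm (bounded_resolvent A z) + 1)"
      by (intro mult_left_mono) auto
    also have "\<dots> < 1"
      using that \<open>norm (bounded_resolvent A z) + 1 > 0\<close>
      by (simp add: e_def dist_norm pos_less_divide_eq)
    finally show "cmod (w - z) * norm (bounded_resolvent A z) < 1" .
  qed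
  ultimately show "\<exists>e>0. \<forall>w. dist w z < e \<longrightarrow> w \<in> resolvent_set A"
    by blast
qed

text \<open>The bound makes the resolvent locally bounded; by the resolvent identity it is then continuous
  and differentiable.\<close>

lemma norm_resolvent_near:
  assumes "z \<in> resolvent_set A" "w \<in> resolvent_set A"
    and "cmod (w - z) * norm (bounded_resolvent A z) \<le> 1 / 2"
  shows "norm (bounded_resolvent A w) \<le> 2 * norm (bounded_resolvent A z)"
proof -
  let ?n = "norm (bounded_resolvent A z)" and ?m = "norm (bounded_resolvent A w)"
  have "norm (bounded_resolvent A w - bounded_resolvent A z) \<le> cmod (w - z) * (?m * ?n)"
    unfolding resolvent_identity[OF assms(2,1)]
    by (rule order_trans[OF norm_scaleC_blinfun_le]) (intro mult_left_mono norm_blinfun_compose norm_ge_zero)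
  also have "\<dots> = ?m * (cmod (w - z) * ?n)"
    by simp
  also have "\<dots> \<le> ?m * (1 / 2)"
    using assms(3) by (intro mult_left_mono) auto
  finally show ?thesis
    using norm_triangle_sub[of "bounded_resolvent A w" "bounded_resolvent A z"] by linarith
qed

lemma has_derivative_resolvent:
  assumes z: "z \<in> resolvent_set A"
  shows "(bounded_resolvent A has_derivative
    (\<lambda>h. h *\<^sub>B (bounded_resolvent A z o\<^sub>L bounded_resolvent A z))) (at z)"
proof -
  let ?R = "bounded_resolvent A"
  define n where "n = norm (?R z) + 1"
  have "n > 0"
    by (simp add: n_def add_nonneg_pos)
  obtain e where e: "e > 0" "\<And>w. dist w z < e \<Longrightarrow> w \<in> resolvent_set A"
    using open_resolvent_set z unfolding open_dist by metis
  show ?thesis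
  proof (rule has_derivativeI_sandwich)
    show "min e (1 / (2 * n)) > 0"
      using e(1) \<open>n > 0\<close> by simp
    show "bounded_linear (\<lambda>h. h *\<^sub>B (?R z o\<^sub>L ?R z))"
      by (rule scaleC_blinfun.bounded_linear_left)
    show "((\<lambda>w. 2 * n ^ 3 * cmod (w - z)) \<longlongrightarrow> 0) (at z)"
      by (auto intro!: tendsto_eq_intros)
    fix w assume "w \<noteq> z" "dist w z < min e (1 / (2 * n))"
    then have w: "w \<in> resolvent_set A" and "cmod (w - z) < 1 / (2 * n)"
      using e(2) by (auto simp: dist_norm)
    then have "cmod (w - z) * n \<le> 1 / 2"
      using \<open>n > 0\<close> by (simp add: field_simps)
    moreover have "cmod (w - z) * norm (?R z) \<le> cmod (w - z) * n"
      by (intro mult_left_mono) (simp_all add: n_def)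
    ultimately have "norm (?R w) \<le> 2 * norm (?R z)"
      using norm_resolvent_near[OF z w] by linarith
    then have Rw: "norm (?R w) \<le> 2 * n"
      by (simp add: n_def)
    have "?R w - ?R z - (w - z) *\<^sub>B (?R z o\<^sub>L ?R z) = (w - z) *\<^sub>B ((?R w - ?R z) o\<^sub>L ?R z)"
      unfolding resolvent_identity[OF w z]
      by (subst resolvent_identity[OF w z, symmetric])
        (rule blinfun_eqI, simp add: blinfun.bilinear_simps scaleC_diff_right)
    then have "norm (?R w - ?R z - (w - z) *\<^sub>B (?R z o\<^sub>L ?R z)) \<le>
        cmod (w - z) * norm ((?R w - ?R z) o\<^sub>L ?R z)"
      using norm_scaleC_blinfun_le by metis
    also have "\<dots> \<le> cmod (w - z) * (norm (?R w - ?R z) * norm (?R z))"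
      by (intro mult_left_mono norm_blinfun_compose norm_ge_zero)
    also have "norm (?R w - ?R z) \<le> cmod (w - z) * (norm (?R w) * norm (?R z))"
      unfolding resolvent_identity[OF w z]
      by (rule order_trans[OF norm_scaleC_blinfun_le]) (intro mult_left_mono norm_blinfun_compose norm_ge_zero)
    also have "cmod (w - z) * (cmod (w - z) * (norm (?R w) * norm (?R z)) * norm (?R z)) \<le>
        cmod (w - z) * (cmod (w - z) * (2 * n * n) * n)"
      using Rw \<open>n > 0\<close>
      by (intro mult_left_mono mult_mono mult_nonneg_nonneg norm_ge_zero) (simp_all add: n_def)
    finally have "norm (?R w - ?R z - (w - z) *\<^sub>B (?R z o\<^sub>L ?R z)) \<le>
        cmod (w - z) * (cmod (w - z) * (2 * n * n) * n)"
      by (simp add: mult_left_mono mult_right_mono)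
    then show "norm (?R w - ?R z - (w - z) *\<^sub>B (?R z o\<^sub>L ?R z)) / norm (w - z) \<le>
        2 * n ^ 3 * cmod (w - z)"
      using \<open>w \<noteq> z\<close> by (simp add: divide_le_eq power3_eq_cube mult_ac)
  qed
qed

lemma operator_holomorphic_on_resolvent:
  "S \<subseteq> resolvent_set A \<Longrightarrow> operator_holomorphic_on (bounded_resolvent A) S"
  unfolding operator_holomorphic_on_def
  using has_derivative_resolvent bounded_resolvent_in_bounded_operators by blast

section \<open>Isolated points of the spectrum\<close>

text \<open>For \<open>m = 0\<close> this is the Riesz projection \<open>P\<close>, in general it is \<open>(A - z0)\<^sup>m P\<close>, that is, up to
  sign the coefficient of \<open>(z - z0)\<^sup>-\<^sup>m\<^sup>-\<^sup>1\<close> in the Laurent expansion of the resolvent.\<close>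

definition riesz_moment ::
    "'a::complex_hilbert_space operator \<Rightarrow> complex \<Rightarrow> real \<Rightarrow> nat \<Rightarrow> ('a \<Rightarrow>\<^sub>L 'a)"
  where "riesz_moment A z0 r m =
    - circle_residue z0 r (\<lambda>z. (z - z0) ^ m *\<^sub>B bounded_resolvent A z)"

locale punctured_resolvent =
  fixes A :: "'a::complex_hilbert_space operator" and z0 :: complex and \<rho> :: real
  assumes radius_pos: "\<rho> > 0" and punctured_disc: "ball z0 \<rho> - {z0} \<subseteq> resolvent_set A"
begin

lemma in_resolvent_set: "z \<noteq> z0 \<Longrightarrow> dist z0 z < \<rho> \<Longrightarrow> z \<in> resolvent_set A"
  using punctured_disc by auto

lemma holomorphic_resolvent: "operator_holomorphic_on (bounded_resolvent A) (ball z0 \<rho> - {z0})"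
  by (rule operator_holomorphic_on_resolvent[OF punctured_disc])

lemma sphere_subset: "0 < r \<Longrightarrow> r < \<rho> \<Longrightarrow> sphere z0 r \<subseteq> ball z0 \<rho> - {z0}"
  by auto

lemma continuous_resolvent:
  "0 < r \<Longrightarrow> r < \<rho> \<Longrightarrow> continuous_on (sphere z0 r) (bounded_resolvent A)"
  by (rule operator_holomorphic_on_imp_continuous_on[OF holomorphic_resolvent sphere_subset])

lemma holomorphic_moment_integrand:
  "operator_holomorphic_on (\<lambda>z. (z - z0) ^ m *\<^sub>B bounded_resolvent A z) (ball z0 \<rho> - {z0})"
  by (intro operator_holomorphic_on_scaleC holomorphic_resolvent holomorphic_intros) auto

lemma continuous_moment_integrand:
  "0 < r \<Longrightarrow> r < \<rho> \<Longrightarrow>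
    continuous_on (sphere z0 r) (\<lambda>z. (z - z0) ^ m *\<^sub>B bounded_resolvent A z)"
  by (rule operator_holomorphic_on_imp_continuous_on[OF holomorphic_moment_integrand sphere_subset])

lemma riesz_moment_radius:
  assumes "0 < r" "r < \<rho>" "0 < s" "s < \<rho>"
  shows "riesz_moment A z0 r m = riesz_moment A z0 s m"
  unfolding riesz_moment_def
  using circle_residue_radius[OF holomorphic_moment_integrand open_ball, of s r m]
    circle_residue_radius[OF holomorphic_moment_integrand open_ball, of r s m] assms
  by (simp add: cball_subset_ball_iff)

text \<open>The radius chosen in the definition of the Riesz projection may exceed \<open>\<rho>\<close>, so the two circles are
  compared inside the resolvent set together with \<open>z0\<close>, which is open.\<close>

lemma riesz_projection_eq_moment:
  assumes "z0 \<in> operator_spectrum A" "0 < r" "r < \<rho>"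
  shows "riesz_projection A z0 = riesz_moment A z0 r 0"
proof -
  define \<epsilon> where "\<epsilon> = (SOME \<epsilon>. 0 < \<epsilon> \<and> cball z0 \<epsilon> \<inter> operator_spectrum A = {z0})"
  have "x = z0" if "x \<in> cball z0 (\<rho> / 2)" "x \<notin> resolvent_set A" for x
    using in_resolvent_set[of x] that radius_pos by auto
  then have "0 < \<rho> / 2 \<and> cball z0 (\<rho> / 2) \<inter> operator_spectrum A = {z0}"
    using assms(1) radius_pos unfolding operator_spectrum_def by auto
  then have "0 < \<epsilon> \<and> cball z0 \<epsilon> \<inter> operator_spectrum A = {z0}"
    unfolding \<epsilon>_def by (rule someI)
  then have \<epsilon>: "0 < \<epsilon>" "cball z0 \<epsilon> \<subseteq> insert z0 (resolvent_set A)"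
    unfolding operator_spectrum_def by auto
  have "insert z0 (resolvent_set A) = ball z0 \<rho> \<union> resolvent_set A"
    using punctured_disc radius_pos by auto
  then have op: "open (insert z0 (resolvent_set A))"
    using open_resolvent_set by auto
  have "cball z0 r \<subseteq> insert z0 (resolvent_set A)"
    using punctured_disc assms(3) \<open>insert z0 (resolvent_set A) = ball z0 \<rho> \<union> resolvent_set A\<close>
    by auto
  then have "circle_residue z0 \<epsilon> (bounded_resolvent A) = circle_residue z0 r (bounded_resolvent A)"
    using \<epsilon> assms(2) by (intro circle_residue_radius[OF operator_holomorphic_on_resolvent op]) auto
  moreover have "bounded_resolvent A = (\<lambda>z. Blinfun (resolvent A z))"
    by (simp add: fun_eq_iff bounded_resolvent_def)
  ultimately show ?thesis
    unfolding riesz_projection_def riesz_moment_def Let_def \<epsilon>_def[symmetric]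
    by (simp add: circle_residue_def scaleC_blinfun.minus_left)
qed

context
  fixes r :: real
  assumes r: "0 < r" "r < \<rho>"
begin

lemma sphere_in_resolvent_set: "z \<in> sphere z0 r \<Longrightarrow> z \<in> resolvent_set A"
  using r in_resolvent_set[of z] by auto

lemma moment_in_bounded_operators: "riesz_moment A z0 r m \<in> bounded_operators"
  unfolding riesz_moment_def
  using r sphere_in_resolvent_set bounded_resolvent_in_bounded_operators
  by (intro bounded_operators_intros(5) circle_residue_in_bounded_operators
      continuous_moment_integrand) auto

lemma moment_commute_resolvent:
  assumes "w \<in> resolvent_set A"
  shows "riesz_moment A z0 r m o\<^sub>L bounded_resolvent A w =
    bounded_resolvent A w o\<^sub>L riesz_moment A z0 r m"
proof -
  let ?R = "bounded_resolvent A"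
  have "circle_residue z0 r (\<lambda>z. (z - z0) ^ m *\<^sub>B ?R z) o\<^sub>L ?R w =
      circle_residue z0 r (\<lambda>z. ((z - z0) ^ m *\<^sub>B ?R z) o\<^sub>L ?R w)"
    using r by (intro circle_residue_compose_right continuous_moment_integrand) auto
  also have "\<dots> = circle_residue z0 r (\<lambda>z. ?R w o\<^sub>L ((z - z0) ^ m *\<^sub>B ?R z))"
    using r sphere_in_resolvent_set assms
    by (intro circle_residue_cong) (simp_all add: blinfun_compose_scaleC_left
        blinfun_compose_scaleC_right bounded_resolvent_in_bounded_operators resolvent_commute)
  also have "\<dots> = ?R w o\<^sub>L circle_residue z0 r (\<lambda>z. (z - z0) ^ m *\<^sub>B ?R z)"
    using r assms by (intro circle_residue_compose_left[symmetric] continuous_moment_integrand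
        bounded_resolvent_in_bounded_operators) auto
  finally show ?thesis
    unfolding riesz_moment_def
    by (metis (no_types, lifting) bounded_bilinear.minus_left bounded_bilinear.minus_right
        bounded_bilinear_blinfun_compose)
qed

text \<open>Integrate the resolvent identity in the form
  \<open>R w R z = (R z - R w) / (z - w)\<close> over the circle around \<open>w\<close>. The right-hand side is the
  holomorphic part of the resolvent, given by values on a fixed circle, hence bounded near \<open>z0\<close>.\<close>

lemma resolvent_regular_part:
  assumes "w \<noteq> z0" "dist z0 w < r"
  shows "bounded_resolvent A w - (bounded_resolvent A w o\<^sub>L riesz_moment A z0 r 0) =
    circle_residue z0 r (\<lambda>z. (1 / (z - w)) *\<^sub>B bounded_resolvent A z)"
proof -
  let ?R = "bounded_resolvent A"
  have w: "w \<in> resolvent_set A"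
    using assms r by (intro in_resolvent_set) auto
  have kernel: "continuous_on (sphere z0 r) (\<lambda>z. 1 / (z - w))"
    using assms by (intro continuous_intros) auto
  have "?R w o\<^sub>L circle_residue z0 r ?R = circle_residue z0 r (\<lambda>z. ?R w o\<^sub>L ?R z)"
    using r w by (intro circle_residue_compose_left continuous_resolvent
        bounded_resolvent_in_bounded_operators) auto
  also have "\<dots> = circle_residue z0 r (\<lambda>z. (1 / (z - w)) *\<^sub>B ?R z - (1 / (z - w)) *\<^sub>B ?R w)"
  proof (rule circle_residue_cong)
    fix z assume z: "z \<in> sphere z0 r"
    then have "z - w \<noteq> 0"
      using assms by auto
    have "(1 / (z - w)) *\<^sub>B ?R z - (1 / (z - w)) *\<^sub>B ?R w = (1 / (z - w)) *\<^sub>B (?R z - ?R w)"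
      by (simp add: scaleC_blinfun.diff_right)
    also have "\<dots> = ?R z o\<^sub>L ?R w"
      unfolding resolvent_identity[OF sphere_in_resolvent_set[OF z] w]
      using \<open>z - w \<noteq> 0\<close> by (simp add: scaleC_blinfun_scaleC_blinfun)
    finally show "?R w o\<^sub>L ?R z = (1 / (z - w)) *\<^sub>B ?R z - (1 / (z - w)) *\<^sub>B ?R w"
      using resolvent_commute[OF sphere_in_resolvent_set[OF z] w] by simp
  qed (use r in simp)
  also have "\<dots> = circle_residue z0 r (\<lambda>z. (1 / (z - w)) *\<^sub>B ?R z) -
      circle_residue z0 r (\<lambda>z. (1 / (z - w)) *\<^sub>B ?R w)"
    using r by (intro circle_residue_diff scaleC_blinfun.continuous_on kernel continuous_resolvent
        continuous_intros) auto
  also have "circle_residue z0 r (\<lambda>z. (1 / (z - w)) *\<^sub>B ?R w) = ?R w"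
    using assms by (intro circle_residue_Cauchy_kernel) auto
  finally show ?thesis
    by (simp add: riesz_moment_def bounded_bilinear.minus_right[OF bounded_bilinear_blinfun_compose])
qed

lemma resolvent_bounded_on_sphere:
  obtains B where "B > 0" "\<And>z. z \<in> sphere z0 r \<Longrightarrow> norm (bounded_resolvent A z) \<le> B"
proof -
  have "compact (bounded_resolvent A ` sphere z0 r)"
    using r by (intro compact_continuous_image continuous_resolvent compact_sphere) auto
  then obtain B where "B > 0" "\<forall>T\<in>bounded_resolvent A ` sphere z0 r. norm T \<le> B"
    using compact_imp_bounded bounded_pos by blast
  then show thesis
    using that by blast
qed

lemma resolvent_regular_part_bounded:
  obtains B where "\<And>w. w \<noteq> z0 \<Longrightarrow> dist z0 w < r / 2 \<Longrightarrow>
    norm (bounded_resolvent A w - (bounded_resolvent A w o\<^sub>L riesz_moment A z0 r 0)) \<le> B"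
proof -
  obtain B where B: "B > 0" "\<And>z. z \<in> sphere z0 r \<Longrightarrow> norm (bounded_resolvent A z) \<le> B"
    using resolvent_bounded_on_sphere by blast
  have "norm (bounded_resolvent A w - (bounded_resolvent A w o\<^sub>L riesz_moment A z0 r 0))
      \<le> r * (2 / r * B)" if w: "w \<noteq> z0" "dist z0 w < r / 2" for w
  proof -
    have "dist z0 w < r"
      using w r by linarith
    show ?thesis
      unfolding resolvent_regular_part[OF w(1) \<open>dist z0 w < r\<close>]
    proof (rule norm_circle_residue_le)
      show "continuous_on (sphere z0 r) (\<lambda>z. (1 / (z - w)) *\<^sub>B bounded_resolvent A z)"
        using r \<open>dist z0 w < r\<close>
        by (intro scaleC_blinfun.continuous_on continuous_resolvent continuous_intros) auto
      fix z assume z: "z \<in> sphere z0 r"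
      have "cmod (z - w) \<ge> r / 2"
        using z w(2) dist_triangle[of z0 z w] by (simp add: dist_norm norm_minus_commute)
      then have "cmod (1 / (z - w)) \<le> 2 / r"
        using frac_le[of 1 1 "r / 2" "cmod (z - w)"] r by (simp add: norm_divide)
      then show "norm ((1 / (z - w)) *\<^sub>B bounded_resolvent A z) \<le> 2 / r * B"
        using B z r by (intro order_trans[OF norm_scaleC_blinfun_le] mult_mono) auto
    qed (use r in simp)
  qed
  then show thesis
    by (rule that)
qed

text \<open>Up to sign, the difference of the two sides is the residue of \<open>(z - z0)\<^sup>m (R z - R z P)\<close>, which is bounded near \<open>z0\<close>. The case
  \<open>m = 0\<close> says that \<open>P\<close> is a projection.\<close>

lemma moment_projection: "riesz_moment A z0 r m o\<^sub>L riesz_moment A z0 r 0 = riesz_moment A z0 r m"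
proof -
  let ?R = "bounded_resolvent A" and ?P = "riesz_moment A z0 r 0"
  let ?F = "\<lambda>z. (z - z0) ^ m *\<^sub>B (?R z - (?R z o\<^sub>L ?P))"
  obtain B where B: "\<And>w. w \<noteq> z0 \<Longrightarrow> dist z0 w < r / 2 \<Longrightarrow> norm (?R w - (?R w o\<^sub>L ?P)) \<le> B"
    using resolvent_regular_part_bounded by blast
  have "circle_residue z0 r ?F = 0"
  proof (rule circle_residue_bounded_eq_0[OF _ r])
    show "operator_holomorphic_on ?F (ball z0 \<rho> - {z0})"
      by (intro operator_holomorphic_intros holomorphic_resolvent holomorphic_intros
          moment_in_bounded_operators) auto
    show "0 < r / 2"
      using r by simp
    fix z assume z: "z \<noteq> z0" "dist z0 z < r / 2"
    have "cmod (z - z0) ^ m \<le> \<rho> ^ m"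
      using z r by (intro power_mono) (auto simp: dist_norm norm_minus_commute)
    then have "cmod ((z - z0) ^ m) \<le> \<rho> ^ m"
      by (simp add: norm_power)
    then show "norm (?F z) \<le> \<rho> ^ m * B"
      using B[OF z] radius_pos by (intro order_trans[OF norm_scaleC_blinfun_le] mult_mono) auto
  qed
  moreover have "circle_residue z0 r ?F =
      circle_residue z0 r (\<lambda>z. (z - z0) ^ m *\<^sub>B ?R z) -
      circle_residue z0 r (\<lambda>z. ((z - z0) ^ m *\<^sub>B ?R z) o\<^sub>L ?P)"
    using r by (subst circle_residue_diff[symmetric])
      (auto simp: scaleC_blinfun.diff_right blinfun_compose_scaleC_left
        intro!: continuous_moment_integrand continuous_intros continuous_resolvent
          scaleC_blinfun.continuous_on
          bounded_bilinear.continuous_on[OF bounded_bilinear_blinfun_compose])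
  moreover have "circle_residue z0 r (\<lambda>z. ((z - z0) ^ m *\<^sub>B ?R z) o\<^sub>L ?P) =
      circle_residue z0 r (\<lambda>z. (z - z0) ^ m *\<^sub>B ?R z) o\<^sub>L ?P"
    using r by (intro circle_residue_compose_right[symmetric] continuous_moment_integrand) auto
  moreover have "riesz_moment A z0 r m o\<^sub>L ?P =
      - (circle_residue z0 r (\<lambda>z. (z - z0) ^ m *\<^sub>B ?R z) o\<^sub>L ?P)"
    by (subst riesz_moment_def)
      (rule bounded_bilinear.minus_left[OF bounded_bilinear_blinfun_compose])
  ultimately show ?thesis
    by (simp add: riesz_moment_def[of _ _ _ m])
qed

lemma projection_moment: "riesz_moment A z0 r 0 o\<^sub>L riesz_moment A z0 r m = riesz_moment A z0 r m"
proof -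
  let ?P = "riesz_moment A z0 r 0" and ?F = "\<lambda>z. (z - z0) ^ m *\<^sub>B bounded_resolvent A z"
  have "?P o\<^sub>L circle_residue z0 r ?F = circle_residue z0 r (\<lambda>z. ?P o\<^sub>L ?F z)"
    using r by (intro circle_residue_compose_left continuous_moment_integrand
        moment_in_bounded_operators) auto
  also have "\<dots> = circle_residue z0 r (\<lambda>z. ?F z o\<^sub>L ?P)"
    using r sphere_in_resolvent_set
    by (intro circle_residue_cong) (simp_all add: blinfun_compose_scaleC_left
        blinfun_compose_scaleC_right moment_in_bounded_operators moment_commute_resolvent)
  also have "\<dots> = circle_residue z0 r ?F o\<^sub>L ?P"
    using r by (intro circle_residue_compose_right[symmetric] continuous_moment_integrand) auto
  finally have "?P o\<^sub>L riesz_moment A z0 r m = riesz_moment A z0 r m o\<^sub>L ?P"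
    by (subst (2 3) riesz_moment_def)
      (simp add: bounded_bilinear.minus_left[OF bounded_bilinear_blinfun_compose]
        bounded_bilinear.minus_right[OF bounded_bilinear_blinfun_compose])
  then show ?thesis
    by (simp add: moment_projection)
qed

text \<open>Integrate \<open>R z = R w (1 + (z - w) R z)\<close> against \<open>(z - z0)\<^sup>m\<close> and expand
  \<open>z - w = (z - z0) + (z0 - w)\<close>. Since \<open>R w\<close> maps into the domain, the moments do so too, and
  \<open>A - z0\<close> raises the exponent.\<close>

lemma moment_shift:
  assumes w: "w \<in> resolvent_set A"
  shows "riesz_moment A z0 r m = bounded_resolvent A w o\<^sub>L
    (riesz_moment A z0 r (Suc m) + (z0 - w) *\<^sub>B riesz_moment A z0 r m)"
proof -
  let ?R = "bounded_resolvent A"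
  let ?F = "\<lambda>m z. (z - z0) ^ m *\<^sub>B ?R z"
  have cont: "continuous_on (sphere z0 r) (?F m)" for m
    using r by (intro continuous_moment_integrand) auto
  have cont': "continuous_on (sphere z0 r) (\<lambda>z. ?F (Suc m) z + (z0 - w) *\<^sub>B ?F m z)"
    by (intro continuous_intros cont scaleC_blinfun.continuous_on)
  have cont_id: "continuous_on (sphere z0 r) (\<lambda>z. (z - z0) ^ m *\<^sub>B (id_blinfun :: 'a \<Rightarrow>\<^sub>L 'a))"
    by (intro continuous_intros scaleC_blinfun.continuous_on)
  have "circle_residue z0 r (?F m) = circle_residue z0 r
      (\<lambda>z. ?R w o\<^sub>L ((z - z0) ^ m *\<^sub>B id_blinfun + (?F (Suc m) z + (z0 - w) *\<^sub>B ?F m z)))"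
  proof (rule circle_residue_cong)
    fix z assume "z \<in> sphere z0 r"
    then have z: "z \<in> resolvent_set A"
      by (rule sphere_in_resolvent_set)
    have "(z - z0) ^ m * (z - w) = (z - z0) ^ Suc m + (z0 - w) * (z - z0) ^ m"
      by (simp add: algebra_simps)
    then have "(z - z0) ^ m *\<^sub>B id_blinfun + (?F (Suc m) z + (z0 - w) *\<^sub>B ?F m z) =
        (z - z0) ^ m *\<^sub>B (id_blinfun + (z - w) *\<^sub>B ?R z)"
      by (simp add: scaleC_blinfun.add_right scaleC_blinfun_scaleC_blinfun
          flip: scaleC_blinfun.add_left)
    then have "?R w o\<^sub>L ((z - z0) ^ m *\<^sub>B id_blinfun + (?F (Suc m) z + (z0 - w) *\<^sub>B ?F m z)) =
        (z - z0) ^ m *\<^sub>B (?R w o\<^sub>L (id_blinfun + (z - w) *\<^sub>B ?R z))"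
      by (simp add: blinfun_compose_scaleC_right bounded_resolvent_in_bounded_operators w)
    then show "?F m z =
        ?R w o\<^sub>L ((z - z0) ^ m *\<^sub>B id_blinfun + (?F (Suc m) z + (z0 - w) *\<^sub>B ?F m z))"
      using resolvent_shift[OF z w] by simp
  qed (use r in simp)
  also have "\<dots> = ?R w o\<^sub>L circle_residue z0 r
      (\<lambda>z. (z - z0) ^ m *\<^sub>B id_blinfun + (?F (Suc m) z + (z0 - w) *\<^sub>B ?F m z))"
    using r w by (intro circle_residue_compose_left[symmetric] continuous_on_add cont_id cont'
        bounded_resolvent_in_bounded_operators) auto
  also have "circle_residue z0 r
      (\<lambda>z. (z - z0) ^ m *\<^sub>B id_blinfun + (?F (Suc m) z + (z0 - w) *\<^sub>B ?F m z)) =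
      circle_residue z0 r (\<lambda>z. (z - z0) ^ m *\<^sub>B id_blinfun) +
      circle_residue z0 r (\<lambda>z. ?F (Suc m) z + (z0 - w) *\<^sub>B ?F m z)"
    using r by (intro circle_residue_add cont_id cont') auto
  also have "circle_residue z0 r (\<lambda>z. (z - z0) ^ m *\<^sub>B (id_blinfun :: 'a \<Rightarrow>\<^sub>L 'a)) = 0"
    using r by (intro circle_residue_power) auto
  also have "circle_residue z0 r (\<lambda>z. ?F (Suc m) z + (z0 - w) *\<^sub>B ?F m z) =
      circle_residue z0 r (?F (Suc m)) + circle_residue z0 r (\<lambda>z. (z0 - w) *\<^sub>B ?F m z)"
    using r by (intro circle_residue_add cont scaleC_blinfun.continuous_on continuous_intros) auto
  also have "circle_residue z0 r (\<lambda>z. (z0 - w) *\<^sub>B ?F m z) = (z0 - w) *\<^sub>B circle_residue z0 r (?F m)"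
    using r by (intro circle_residue_scaleC cont) auto
  finally have shift: "circle_residue z0 r (?F m) = ?R w o\<^sub>L
      (0 + (circle_residue z0 r (?F (Suc m)) + (z0 - w) *\<^sub>B circle_residue z0 r (?F m)))" .
  have neg: "- S + a *\<^sub>B (- T) = - (S + a *\<^sub>B T)" for a and S T :: "'a \<Rightarrow>\<^sub>L 'a"
    by (simp add: scaleC_blinfun.minus_right)
  show ?thesis
    unfolding riesz_moment_def neg bounded_bilinear.minus_right[OF bounded_bilinear_blinfun_compose]
    using arg_cong[OF shift, of uminus] unfolding add_0 .
qed

lemma
  shows moment_in_dom: "blinfun_apply (riesz_moment A z0 r m) x \<in> op_dom A"
    and operator_moment: "op_app A (blinfun_apply (riesz_moment A z0 r m) x) -
      z0 *\<^sub>C blinfun_apply (riesz_moment A z0 r m) x = blinfun_apply (riesz_moment A z0 r (Suc m)) x"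
proof -
  let ?D = "riesz_moment A z0 r"
  obtain w where w: "w \<in> resolvent_set A"
    using sphere_in_resolvent_set[of "z0 + r"] r by (auto simp: dist_norm)
  define v where "v = blinfun_apply (?D (Suc m)) x + (z0 - w) *\<^sub>C blinfun_apply (?D m) x"
  have D: "blinfun_apply (?D m) x = blinfun_apply (bounded_resolvent A w) v"
    by (subst moment_shift[OF w]) (simp add: v_def blinfun.add_left)
  then show "blinfun_apply (?D m) x \<in> op_dom A"
    using resolvent_in_dom[OF w] by simp
  have "op_app A (blinfun_apply (?D m) x) - w *\<^sub>C blinfun_apply (?D m) x = v"
    unfolding D by (rule resolvent_right_inverse[OF w])
  then show "op_app A (blinfun_apply (?D m) x) - z0 *\<^sub>C blinfun_apply (?D m) x =
      blinfun_apply (?D (Suc m)) x"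
    unfolding v_def by (simp add: scaleC_diff_left algebra_simps)
qed

lemma norm_moment_le:
  obtains B where "B > 0" "\<And>m. norm (riesz_moment A z0 r m) \<le> B * r ^ m"
proof -
  obtain B where B: "B > 0" "\<And>z. z \<in> sphere z0 r \<Longrightarrow> norm (bounded_resolvent A z) \<le> B"
    using resolvent_bounded_on_sphere by blast
  have "norm (riesz_moment A z0 r m) \<le> r * (r ^ m * B)" for m
    unfolding riesz_moment_def norm_minus_cancel
  proof (rule norm_circle_residue_le)
    show "continuous_on (sphere z0 r) (\<lambda>z. (z - z0) ^ m *\<^sub>B bounded_resolvent A z)"
      using r by (intro continuous_moment_integrand) auto
    fix z assume z: "z \<in> sphere z0 r"
    then have "cmod ((z - z0) ^ m) = r ^ m"
      by (simp add: norm_power dist_norm norm_minus_commute)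
    then show "norm ((z - z0) ^ m *\<^sub>B bounded_resolvent A z) \<le> r ^ m * B"
      using B z r by (intro order_trans[OF norm_scaleC_blinfun_le] mult_mono) auto
  qed (use r in simp)
  then have "norm (riesz_moment A z0 r m) \<le> (r * B) * r ^ m" for m
    by (simp add: mult_ac)
  moreover have "r * B > 0"
    using r B by simp
  ultimately show thesis
    using that by blast
qed

text \<open>If \<open>P = 0\<close>, the resolvent is bounded near \<open>z0\<close>, and then \<open>resolvent_set_near\<close>, applied at a point
  close to \<open>z0\<close>, puts \<open>z0\<close> into the resolvent set.\<close>

lemma projection_nonzero:
  assumes "z0 \<in> operator_spectrum A"
  shows "riesz_moment A z0 r 0 \<noteq> 0"
proof
  assume P: "riesz_moment A z0 r 0 = 0"
  obtain B where B: "\<And>w. w \<noteq> z0 \<Longrightarrow> dist z0 w < r / 2 \<Longrightarrow>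
      norm (bounded_resolvent A w - (bounded_resolvent A w o\<^sub>L riesz_moment A z0 r 0)) \<le> B"
    using resolvent_regular_part_bounded by blast
  define t where "t = min (r / 4) (1 / (2 * (\<bar>B\<bar> + 1)))"
  have t: "0 < t" "t < r / 2" "t * (\<bar>B\<bar> + 1) < 1"
    using r by (auto simp: t_def min_def field_simps) 
  define w where "w = z0 + of_real t"
  have w: "w \<noteq> z0" "dist z0 w = t"
    using t by (auto simp: w_def dist_norm)
  have "norm (bounded_resolvent A w) \<le> \<bar>B\<bar> + 1"
    using B[of w] w t by (simp add: P bounded_bilinear.zero_right[OF bounded_bilinear_blinfun_compose])
  then have "t * norm (bounded_resolvent A w) \<le> t * (\<bar>B\<bar> + 1)"
    using t(1) by (intro mult_left_mono) auto
  then have "cmod (z0 - w) * norm (bounded_resolvent A w) < 1"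
    using t(3) w(2) by (simp add: dist_norm)
  then have "z0 \<in> resolvent_set A"
    using w t r by (intro resolvent_set_near[OF in_resolvent_set]) auto
  then show False
    using assms unfolding operator_spectrum_def by blast
qed

end

lemma resolvent_regular_part_bounded_left:
  assumes r: "0 < r" "r < \<rho>"
  obtains B where "B \<ge> 0" "\<And>w. w \<noteq> z0 \<Longrightarrow> dist z0 w < r / 2 \<Longrightarrow>
    norm (bounded_resolvent A w - (riesz_moment A z0 r 0 o\<^sub>L bounded_resolvent A w)) \<le> B"
proof -
  obtain B where B: "\<And>w. w \<noteq> z0 \<Longrightarrow> dist z0 w < r / 2 \<Longrightarrow>
      norm (bounded_resolvent A w - (bounded_resolvent A w o\<^sub>L riesz_moment A z0 r 0)) \<le> B"
    using resolvent_regular_part_bounded[OF r] by blast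
  have "norm (bounded_resolvent A w - (riesz_moment A z0 r 0 o\<^sub>L bounded_resolvent A w)) \<le> \<bar>B\<bar>"
    if w: "w \<noteq> z0" "dist z0 w < r / 2" for w
  proof -
    have "w \<in> resolvent_set A"
      using w r by (intro in_resolvent_set) auto
    then show ?thesis
      using B[OF w] by (simp add: moment_commute_resolvent[OF r])
  qed
  then show thesis
    using that[of "\<bar>B\<bar>"] by simp
qed

text \<open>On the range of the Riesz projection \<open>A - z0\<close> is quasinilpotent: as the radius of the circle is at
  our disposal, \<open>(A - z0)\<^sup>m P\<close> is smaller than \<open>C\<^sup>-\<^sup>m\<close> for large \<open>m\<close>. So the first \<open>m\<close> steps
  of the orbit of a nonzero vector under \<open>A - z0\<close> cannot all shrink its norm by at most the factor
  \<open>1 / C\<close>, with \<open>m\<close> independent of the vector.\<close>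

lemma no_lower_bound_along_moments:
  assumes "C > 0" "0 < r" "r < \<rho>"
  obtains m where "\<And>x. blinfun_apply (riesz_moment A z0 r 0) x = x \<Longrightarrow>
    (\<And>k. k < m \<Longrightarrow> norm (blinfun_apply (riesz_moment A z0 r k) x) \<le>
      C * norm (blinfun_apply (riesz_moment A z0 r (Suc k)) x)) \<Longrightarrow> x = 0"
proof -
  \<comment> \<open>A circle so small that \<open>C\<close> times its radius is at most \<open>1 / 2\<close>.\<close>
  define s where "s = min (\<rho> / 2) (1 / (2 * C))"
  have s: "0 < s" "s < \<rho>" "C * s \<le> 1 / 2"
    using assms(1) radius_pos by (auto simp: s_def min_def field_simps)
  obtain B where B: "B > 0" "\<And>m. norm (riesz_moment A z0 s m) \<le> B * s ^ m"
    using norm_moment_le[OF s(1,2)] by blast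
  obtain m where m: "(1 / 2) ^ m < 1 / B"
    using real_arch_pow_inv[of "1 / B" "1 / 2"] B(1) by auto
  have "x = 0" if x: "blinfun_apply (riesz_moment A z0 r 0) x = x"
    and step: "\<And>k. k < m \<Longrightarrow> norm (blinfun_apply (riesz_moment A z0 r k) x) \<le>
      C * norm (blinfun_apply (riesz_moment A z0 r (Suc k)) x)" for x
  proof (rule ccontr)
    assume "x \<noteq> 0"
    have "norm x \<le> C ^ k * norm (blinfun_apply (riesz_moment A z0 r k) x)" if "k \<le> m" for k
      using that
    proof (induction k)
      case (Suc k)
      then have "norm x \<le> C ^ k * norm (blinfun_apply (riesz_moment A z0 r k) x)"
        by simp
      also have "\<dots> \<le> C ^ k * (C * norm (blinfun_apply (riesz_moment A z0 r (Suc k)) x))"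
        using Suc.prems step assms(1) by (intro mult_left_mono) auto
      finally show ?case
        by (simp add: mult_ac)
    qed (simp add: x)
    then have "norm x \<le> C ^ m * norm (blinfun_apply (riesz_moment A z0 s m) x)"
      using riesz_moment_radius[OF assms(2,3) s(1,2)] by fastforce
    also have "\<dots> \<le> C ^ m * (B * s ^ m * norm x)"
      using assms(1) B(2)
      by (intro mult_left_mono order_trans[OF norm_blinfun] mult_right_mono) auto
    also have "\<dots> = (C * s) ^ m * B * norm x"
      by (simp add: power_mult_distrib mult_ac)
    also have "\<dots> \<le> (1 / 2) ^ m * B * norm x"
      using s assms(1) B(1) by (intro mult_right_mono power_mono) auto
    also have "\<dots> < 1 * norm x"
      using m B(1) \<open>x \<noteq> 0\<close> by (intro mult_strict_right_mono) (simp_all add: field_simps)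
    finally show False
      by simp
  qed
  then show thesis
    using that by blast
qed

text \<open>Otherwise \<open>A - z0\<close> would be injective on the finite-dimensional range of \<open>P\<close>, hence bounded below
  there, contradicting quasinilpotency. The lower bound is read off from \<open>(A - z0) P\<close>, which as an
  operator of finite rank has closed range.\<close>

lemma eigenvalue_if_finite_rank:
  assumes "z0 \<in> operator_spectrum A" and r: "0 < r" "r < \<rho>"
    and fin: "finite_cdim (range (blinfun_apply (riesz_moment A z0 r 0)))"
  shows "eigenvalue A z0"
proof (rule ccontr)
  assume not_ev: "\<not> eigenvalue A z0"
  let ?D = "riesz_moment A z0 r"
  have PD: "blinfun_apply (?D 0) (blinfun_apply (?D k) x) = blinfun_apply (?D k) x" for k x
    using projection_moment[OF r, of k] by (metis blinfun_apply_blinfun_compose)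
  have DP: "blinfun_apply (?D k) (blinfun_apply (?D 0) x) = blinfun_apply (?D k) x" for k x
    using moment_projection[OF r, of k] by (metis blinfun_apply_blinfun_compose)
  have ker: "blinfun_apply (?D 0) x = 0" if "blinfun_apply (?D 1) x = 0" for x
    using that operator_moment[OF r, of 0 x] moment_in_dom[OF r, of 0 x] not_ev
    unfolding eigenvalue_def by auto
  have "finite_cdim (range (blinfun_apply (?D 1)))"
    by (rule finite_cdim_subspace[OF fin csubspace_range[OF moment_in_bounded_operators[OF r]]])
      (metis PD image_subsetI rangeI)
  then have "closed (range (blinfun_apply (?D 1)))"
    using closed_cspan_orthonormal by (metis finite_cdim_orthonormal)
  then obtain C where C: "C > 0" "\<forall>y\<in>range (blinfun_apply (?D 1)).
      \<exists>x. blinfun_apply (?D 1) x = y \<and> norm x \<le> C * norm y"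
    using closed_range_bounded_preimage by blast
  define C' where "C' = (norm (?D 0) + 1) * C"
  have "C' > 0"
    unfolding C'_def using C(1) by (intro mult_pos_pos add_nonneg_pos) auto
  have D1: "blinfun_apply (?D 1) (blinfun_apply (?D k) x) = blinfun_apply (?D (Suc k)) x" for k x
    using operator_moment[OF r, of k x] operator_moment[OF r, of 0 "blinfun_apply (?D k) x"]
    by (simp add: PD)
  have below: "norm (blinfun_apply (?D k) x) \<le> C' * norm (blinfun_apply (?D (Suc k)) x)" for k x
  proof -
    obtain x' where x': "blinfun_apply (?D 1) x' = blinfun_apply (?D 1) (blinfun_apply (?D k) x)"
        "norm x' \<le> C * norm (blinfun_apply (?D 1) (blinfun_apply (?D k) x))"
      using C(2) by blast
    have "blinfun_apply (?D 0) (x' - blinfun_apply (?D k) x) = 0"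
      by (rule ker) (simp del: One_nat_def add: blinfun.diff_right x'(1))
    then have "blinfun_apply (?D k) x = blinfun_apply (?D 0) x'"
      by (simp add: blinfun.diff_right PD)
    then have "norm (blinfun_apply (?D k) x) \<le> norm (?D 0) * norm x'"
      by (simp add: norm_blinfun)
    also have "\<dots> \<le> (norm (?D 0) + 1) * (C * norm (blinfun_apply (?D (Suc k)) x))"
      using x'(2) unfolding D1 by (intro mult_mono) auto
    finally show ?thesis
      by (simp add: C'_def mult_ac)
  qed
  obtain m where "\<And>x. blinfun_apply (?D 0) x = x \<Longrightarrow>
      (\<And>k. k < m \<Longrightarrow> norm (blinfun_apply (?D k) x) \<le> C' * norm (blinfun_apply (?D (Suc k)) x)) \<Longrightarrow> x = 0"
    using no_lower_bound_along_moments[OF \<open>C' > 0\<close> r] by blast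
  then have "blinfun_apply (?D 0) x = 0" for x
    using PD[of 0 x] below by blast
  then have "?D 0 = 0"
    by (intro blinfun_eqI) simp
  then show False
    using projection_nonzero[OF r assms(1)] by blast
qed

end

section \<open>Laurent coefficients\<close>

lemma contour_integral_circlepath_shift:
  "contour_integral (circlepath z0 r) f = contour_integral (circlepath 0 r) (\<lambda>w. f (z0 + w))"
  unfolding contour_integral_integral vector_derivative_circlepath by (simp add: circlepath)

text \<open>After multiplication by \<open>(z - z0)\<^sup>N\<close>, matrix elements are power series, to which Cauchy's formula
  for the \<open>N\<close>-th derivative applies.\<close>

lemma laurent_coefficient_0_eq_residue:
  fixes F :: "complex \<Rightarrow> ('a::complex_hilbert_space \<Rightarrow>\<^sub>L 'a)"
  assumes expansion: "has_operator_laurent_expansion F z0 \<rho> N C"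
    and cont: "continuous_on (sphere z0 r) F" and r: "0 < r" "r < \<rho>"
  shows "C 0 = circle_residue z0 r (\<lambda>z. (1 / (z - z0)) *\<^sub>B F z)"
proof (rule blinfun_eq_if_cinner_eq)
  fix x y
  define a where "a n = cinner x (blinfun_apply (C (int n - int N)) y)" for n
  define A where "A = Abs_fps a"
  let ?f = "\<lambda>z. cinner x (blinfun_apply (F z) y)"
  have sums: "(\<lambda>n. a n * w ^ n) sums (w ^ N * ?f (z0 + w))" if "w \<noteq> 0" "cmod w < \<rho>" for w
  proof -
    have "(\<lambda>n. (w powi (int n - int N)) *\<^sub>B C (int n - int N)) sums F (z0 + w)"
      using expansion[unfolded has_operator_laurent_expansion_def, THEN conjunct2, rule_format,
          of "z0 + w"] that by simp
    then have "(\<lambda>n. cinner x (blinfun_apply ((w powi (int n - int N)) *\<^sub>B C (int n - int N)) y))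
        sums ?f (z0 + w)"
      by (rule bounded_linear.sums[OF bounded_linear_cinner_apply])
    from sums_mult[OF this, of "w ^ N"] show ?thesis
      using that by (simp add: a_def cinner_scaleC_right power_int_diff mult.commute)
  qed
  have radius: "fps_conv_radius A \<ge> ereal \<rho>"
    unfolding A_def fps_conv_radius_def
  proof (rule conv_radius_geI_ex')
    fix t :: real assume "0 < t" "ereal t < ereal \<rho>"
    then show "summable (\<lambda>n. fps_nth (Abs_fps a) n * of_real t ^ n)"
      using sums_summable[OF sums[of "of_real t"]] by simp
  qed
  moreover have "ereal 0 < ereal \<rho>"
    using r by simp
  ultimately have "fps_conv_radius A > 0"
    using order.strict_trans2 by (metis zero_ereal_def)
  have hol: "eval_fps A holomorphic_on ball 0 \<rho>"
  proof (rule holomorphic_on_eval_fps)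
    show "ball (0::complex) \<rho> \<subseteq> eball 0 (fps_conv_radius A)"
    proof
      fix w :: complex assume "w \<in> ball 0 \<rho>"
      then have "ereal (cmod w) < ereal \<rho>"
        by simp
      then have "ereal (cmod w) < fps_conv_radius A"
        using radius by (rule less_le_trans)
      then show "w \<in> eball 0 (fps_conv_radius A)"
        by simp
    qed
  qed
  have eval: "eval_fps A w = w ^ N * ?f (z0 + w)" if "w \<noteq> 0" "cmod w < \<rho>" for w
    using sums_unique[OF sums[OF that]] by (simp add: eval_fps_def A_def)
  have "contour_integral (circlepath 0 r) (\<lambda>u. eval_fps A u / (u - 0) ^ Suc N) =
      2 * pi * \<i> * (deriv ^^ N) (eval_fps A) 0 / fact N"
  proof (rule Cauchy_contour_integral_circlepath)
    show "continuous_on (cball 0 r) (eval_fps A)"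
      using holomorphic_on_imp_continuous_on[OF hol] r by (auto elim: continuous_on_subset)
    show "eval_fps A holomorphic_on ball 0 r"
      using hol r by (auto elim: holomorphic_on_subset)
  qed (use r in simp)
  also have "\<dots> = 2 * of_real pi * \<i> * a N"
    using fps_nth_fps_expansion[OF eval_fps_has_fps_expansion[OF \<open>fps_conv_radius A > 0\<close>], of N]
    by (simp add: A_def)
  finally have "2 * of_real pi * \<i> * a N =
      contour_integral (circlepath 0 r) (\<lambda>u. eval_fps A u / (u - 0) ^ Suc N)" ..
  also have "\<dots> = contour_integral (circlepath 0 r) (\<lambda>u. 1 / u * ?f (z0 + u))"
  proof (rule contour_integral_cong)
    fix u assume "u \<in> path_image (circlepath 0 r)"
    then have "u \<noteq> 0" "cmod u < \<rho>"
      using r by auto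
    then show "eval_fps A u / (u - 0) ^ Suc N = 1 / u * ?f (z0 + u)"
      by (simp add: eval)
  qed simp
  also have "\<dots> = contour_integral (circlepath z0 r) (\<lambda>z. cinner x (blinfun_apply ((1 / (z - z0)) *\<^sub>B F z) y))"
    by (subst (2) contour_integral_circlepath_shift) (simp add: cinner_scaleC_right)
  finally have "a N = 1 / (2 * of_real pi * \<i>) *
      contour_integral (circlepath z0 r) (\<lambda>z. cinner x (blinfun_apply ((1 / (z - z0)) *\<^sub>B F z) y))"
    by (simp add: field_simps)
  also have "\<dots> = cinner x (blinfun_apply (circle_residue z0 r (\<lambda>z. (1 / (z - z0)) *\<^sub>B F z)) y)"
    using r by (intro cinner_circle_residue[symmetric] scaleC_blinfun.continuous_on cont
        continuous_intros) auto
  finally show "cinner x (blinfun_apply (C 0) y) =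
      cinner x (blinfun_apply (circle_residue z0 r (\<lambda>z. (1 / (z - z0)) *\<^sub>B F z)) y)"
    by (simp add: a_def)
qed

section \<open>Perturbation of an isolated eigenvalue\<close>

locale birman_schwinger_pair =
  fixes H0 V :: "'a::complex_hilbert_space operator" and z0 :: complex and \<rho> :: real
  assumes linear_H0: "linear_operator H0"
    and dom_subset: "op_dom H0 \<subseteq> op_dom V"
    and pos: "\<rho> > 0"
    and disc: "ball z0 \<rho> - {z0} \<subseteq> resolvent_set H0 \<inter> resolvent_set (operator_plus H0 V)"
    and bounded_K: "\<exists>z\<in>resolvent_set H0. bounded_clinear (birman_schwinger H0 V z)"
begin

abbreviation "H \<equiv> operator_plus H0 V"
abbreviation "R0 \<equiv> bounded_resolvent H0"
abbreviation "R \<equiv> bounded_resolvent H"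

sublocale free: punctured_resolvent H0 z0 \<rho>
  using pos disc by unfold_locales auto

sublocale perturbed: punctured_resolvent "operator_plus H0 V" z0 \<rho>
  using pos disc by unfold_locales auto

definition "K z = Blinfun (birman_schwinger H0 V z)"

definition "M z = id_blinfun - K z"

lemma dom_H [simp]: "op_dom H = op_dom H0"
  using dom_subset by (auto simp: operator_plus_def)

lemma app_H [simp]: "op_app H x = op_app H0 x + op_app V x"
  by (simp add: operator_plus_def)

text \<open>Boundedness spreads from one point to the whole resolvent set by \<open>resolvent_shift\<close>.\<close>

lemma bounded_birman_schwinger:
  assumes z: "z \<in> resolvent_set H0"
  shows "bounded_clinear (birman_schwinger H0 V z)"
proof -
  obtain w where w: "w \<in> resolvent_set H0" "bounded_clinear (birman_schwinger H0 V w)"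
    using bounded_K by blast
  define T where "T = K w o\<^sub>L (id_blinfun + (z - w) *\<^sub>B R0 z)"
  have "birman_schwinger H0 V z x = blinfun_apply T x" for x
  proof -
    have "birman_schwinger H0 V z x = - op_app V (blinfun_apply (R0 z) x)"
      by (simp add: birman_schwinger_def bounded_resolvent_apply[OF z])
    also have "\<dots> = - op_app V (blinfun_apply (R0 w)
        (blinfun_apply (id_blinfun + (z - w) *\<^sub>B R0 z) x))"
      by (subst resolvent_shift[OF z w(1)]) simp
    also have "\<dots> = birman_schwinger H0 V w (blinfun_apply (id_blinfun + (z - w) *\<^sub>B R0 z) x)"
      by (simp add: birman_schwinger_def bounded_resolvent_apply[OF w(1)])
    finally show ?thesis
      by (simp add: T_def K_def Blinfun_bounded_clinear[OF w(2)])
  qed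
  then have "birman_schwinger H0 V z = blinfun_apply T"
    by (rule ext)
  moreover have "T \<in> bounded_operators"
    unfolding T_def K_def using Blinfun_bounded_clinear[OF w(2)]
      bounded_resolvent_in_bounded_operators[OF z] by auto
  ultimately show ?thesis
    unfolding bounded_operators_def by simp
qed

lemma
  assumes z: "z \<in> resolvent_set H0"
  shows K_apply: "blinfun_apply (K z) x = - op_app V (blinfun_apply (R0 z) x)"
    and K_in_bounded_operators: "K z \<in> bounded_operators"
  unfolding K_def using Blinfun_bounded_clinear[OF bounded_birman_schwinger[OF z]]
  by (simp_all add: birman_schwinger_def bounded_resolvent_apply[OF z])

lemma M_in_bounded_operators: "z \<in> resolvent_set H0 \<Longrightarrow> M z \<in> bounded_operators"
  unfolding M_def using K_in_bounded_operators by auto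

lemma K_shift:
  assumes "z \<in> resolvent_set H0" "w \<in> resolvent_set H0"
  shows "K z = K w o\<^sub>L (id_blinfun + (z - w) *\<^sub>B R0 z)"
proof (rule blinfun_eqI)
  fix x
  show "blinfun_apply (K z) x = blinfun_apply (K w o\<^sub>L (id_blinfun + (z - w) *\<^sub>B R0 z)) x"
    unfolding blinfun_apply_blinfun_compose K_apply[OF assms(1)] K_apply[OF assms(2)]
    by (subst resolvent_shift[OF assms]) simp
qed

lemma H_factorization:
  assumes z: "z \<in> resolvent_set H0" and "x \<in> op_dom H0"
  shows "op_app H x - z *\<^sub>C x = blinfun_apply (M z) (op_app H0 x - z *\<^sub>C x)"
  using assms by (simp add: M_def blinfun.diff_left K_apply resolvent_left_inverse)

lemma resolvent_M:
  assumes z: "z \<in> resolvent_set H0" "z \<in> resolvent_set H"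
  shows "R z o\<^sub>L M z = R0 z"
proof (rule blinfun_eqI)
  fix x
  have "blinfun_apply (M z) x = blinfun_apply (M z)
      (op_app H0 (blinfun_apply (R0 z) x) - z *\<^sub>C blinfun_apply (R0 z) x)"
    by (simp add: resolvent_right_inverse[OF z(1)])
  also have "\<dots> = op_app H (blinfun_apply (R0 z) x) - z *\<^sub>C blinfun_apply (R0 z) x"
    by (rule H_factorization[OF z(1) resolvent_in_dom[OF z(1)], symmetric])
  finally have "blinfun_apply (R z) (blinfun_apply (M z) x) =
      blinfun_apply (R z) (op_app H (blinfun_apply (R0 z) x) - z *\<^sub>C blinfun_apply (R0 z) x)"
    by simp
  also have "\<dots> = blinfun_apply (R0 z) x"
    using resolvent_in_dom[OF z(1)] by (intro resolvent_left_inverse[OF z(2)]) simp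
  finally show "blinfun_apply (R z o\<^sub>L M z) x = blinfun_apply (R0 z) x"
    by simp
qed

lemma bij_M:
  assumes z: "z \<in> resolvent_set H0" "z \<in> resolvent_set H"
  shows "bij (blinfun_apply (M z))"
proof (rule bijI)
  show "inj (blinfun_apply (M z))"
  proof (rule injI)
    fix x y assume "blinfun_apply (M z) x = blinfun_apply (M z) y"
    then have "blinfun_apply (R0 z) x = blinfun_apply (R0 z) y"
      unfolding resolvent_M[OF z, symmetric] by simp
    then show "x = y"
      by (metis resolvent_right_inverse[OF z(1)])
  qed
  show "surj (blinfun_apply (M z))"
  proof (rule surjI)
    fix y
    let ?u = "blinfun_apply (R z) y"
    have "?u \<in> op_dom H0"
      using resolvent_in_dom[OF z(2)] by simp
    then show "blinfun_apply (M z) (op_app H0 ?u - z *\<^sub>C ?u) = y"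
      using H_factorization[OF z(1)] resolvent_right_inverse[OF z(2), of y] by metis
  qed
qed

lemma resolvent_inverse_M:
  assumes z: "z \<in> resolvent_set H0" "z \<in> resolvent_set H"
  shows "R0 z o\<^sub>L inverse_operator (M z) = R z"
proof (rule blinfun_eqI)
  fix x
  have "blinfun_apply (inverse_operator (M z)) = inv (blinfun_apply (M z))"
    unfolding inverse_operator_def
    by (rule Blinfun_bounded_clinear(1)[OF bounded_clinear_inv[OF M_in_bounded_operators[OF z(1)] bij_M[OF z]]])
  then have "blinfun_apply (M z) (blinfun_apply (inverse_operator (M z)) x) = x"
    using bij_M[OF z] by (simp add: bij_is_surj surj_f_inv_f)
  then show "blinfun_apply (R0 z o\<^sub>L inverse_operator (M z)) x = blinfun_apply (R z) x"
    unfolding resolvent_M[OF z, symmetric] by simp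
qed

lemma has_derivative_K:
  assumes z: "z \<in> resolvent_set H0"
  shows "(K has_derivative (\<lambda>h. h *\<^sub>B (K z o\<^sub>L R0 z))) (at z)"
proof (rule has_derivative_transform_within_open[OF _ open_resolvent_set z])
  have "((\<lambda>w. (w - z) *\<^sub>B R0 w) has_derivative
      (\<lambda>h. (z - z) *\<^sub>B (h *\<^sub>B (R0 z o\<^sub>L R0 z)) + h *\<^sub>B R0 z)) (at z)"
    by (rule scaleC_blinfun.FDERIV[OF _ has_derivative_resolvent[OF z]])
      (auto intro!: derivative_eq_intros)
  then have outer: "((\<lambda>w. id_blinfun + (w - z) *\<^sub>B R0 w) has_derivative (\<lambda>h. h *\<^sub>B R0 z)) (at z)"
    by (auto intro!: derivative_eq_intros simp: scaleC_blinfun.zero_left)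
  have inner: "((\<lambda>_. K z) has_derivative (\<lambda>h. h *\<^sub>B 0)) (at z)"
    by (simp add: scaleC_blinfun.zero_right)
  have "((\<lambda>w. K z o\<^sub>L (id_blinfun + (w - z) *\<^sub>B R0 w)) has_derivative
      (\<lambda>h. h *\<^sub>B ((K z o\<^sub>L R0 z) + (0 o\<^sub>L (id_blinfun + (z - z) *\<^sub>B R0 z))))) (at z)"
    by (rule has_derivative_blinfun_compose_scaleC[OF _ inner outer])
      (rule K_in_bounded_operators[OF z])
  then show "((\<lambda>w. K z o\<^sub>L (id_blinfun + (w - z) *\<^sub>B R0 w)) has_derivative
      (\<lambda>h. h *\<^sub>B (K z o\<^sub>L R0 z))) (at z)"
    by (simp add: bounded_bilinear.zero_left[OF bounded_bilinear_blinfun_compose])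
  fix w assume "w \<in> resolvent_set H0"
  then show "K z o\<^sub>L (id_blinfun + (w - z) *\<^sub>B R0 w) = K w"
    by (rule K_shift[OF _ z, symmetric])
qed

lemma operator_holomorphic_on_K: "S \<subseteq> resolvent_set H0 \<Longrightarrow> operator_holomorphic_on K S"
  unfolding operator_holomorphic_on_def using has_derivative_K K_in_bounded_operators by blast

text \<open>\<open>M' M\<^sup>-\<^sup>1 = - K R0 M\<^sup>-\<^sup>1 = - K R = (M - 1) R\<close>.\<close>

lemma logarithmic_derivative:
  assumes z: "z \<in> resolvent_set H0" "z \<in> resolvent_set H"
  shows "operator_deriv M z o\<^sub>L inverse_operator (M z) = (M z o\<^sub>L R z) - R z"
proof -
  have "(M has_derivative (\<lambda>h. 0 - h *\<^sub>B (K z o\<^sub>L R0 z))) (at z)"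
    unfolding M_def[abs_def] by (intro has_derivative_diff has_derivative_const has_derivative_K z)
  then have "(M has_derivative (\<lambda>h. h *\<^sub>B (- (K z o\<^sub>L R0 z)))) (at z)"
    by (simp add: scaleC_blinfun.minus_right)
  then have "operator_deriv M z = - (K z o\<^sub>L R0 z)"
    by (rule operator_deriv_eq)
  then have "operator_deriv M z o\<^sub>L inverse_operator (M z) = - (K z o\<^sub>L (R0 z o\<^sub>L inverse_operator (M z)))"
    by (simp add: blinfun_compose_assoc bounded_bilinear.minus_left[OF bounded_bilinear_blinfun_compose])
  also have "\<dots> = - (K z o\<^sub>L R z)"
    unfolding resolvent_inverse_M[OF z] ..
  also have "\<dots> = (M z o\<^sub>L R z) - R z"
    unfolding M_def by (rule blinfun_eqI) (simp add: blinfun.bilinear_simps)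
  finally show ?thesis .
qed

context
  fixes r :: real
  assumes r: "0 < r" "r < \<rho>"
begin

abbreviation "P0 \<equiv> riesz_moment H0 z0 r 0"
abbreviation "P \<equiv> riesz_moment H z0 r 0"

lemma continuous_inverse: "continuous_on (sphere z0 r) (\<lambda>z. 1 / (z - z0))"
  using r by (intro continuous_intros) auto

definition "reduced_resolvent = circle_residue z0 r (\<lambda>z. (1 / (z - z0)) *\<^sub>B R0 z)"

text \<open>The resolvent identity turns \<open>R0 z (1 + (w - z0) R0 w)\<close> into \<open>R0 w + (z - z0) R0 z R0 w\<close>. Divided by
  \<open>z - z0\<close>, the first term has residue \<open>R0 w\<close> and the second \<open>- P0 R0 w\<close>.\<close>

lemma reduced_resolvent_inverse:
  assumes x: "x \<in> op_dom H0"
  shows "blinfun_apply reduced_resolvent (op_app H0 x - z0 *\<^sub>C x) = x - blinfun_apply P0 x"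
proof -
  obtain w where w: "w \<in> resolvent_set H0"
    using free.sphere_in_resolvent_set[OF r, of "z0 + r"] r by (auto simp: dist_norm)
  have cont: "continuous_on (sphere z0 r) (\<lambda>z. (1 / (z - z0)) *\<^sub>B R0 z)"
    by (intro scaleC_blinfun.continuous_on continuous_inverse free.continuous_resolvent r)
  define v where "v = op_app H0 x - w *\<^sub>C x"
  have x_eq: "blinfun_apply (R0 w) v = x"
    unfolding v_def by (rule resolvent_left_inverse[OF w x])
  have v: "op_app H0 x - z0 *\<^sub>C x = blinfun_apply (id_blinfun + (w - z0) *\<^sub>B R0 w) v"
    by (simp add: blinfun.add_left x_eq) (simp add: v_def scaleC_diff_left)
  have "reduced_resolvent o\<^sub>L (id_blinfun + (w - z0) *\<^sub>B R0 w) =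
      circle_residue z0 r (\<lambda>z. ((1 / (z - z0)) *\<^sub>B R0 z) o\<^sub>L (id_blinfun + (w - z0) *\<^sub>B R0 w))"
    unfolding reduced_resolvent_def using r cont by (intro circle_residue_compose_right) auto
  also have "\<dots> = circle_residue z0 r (\<lambda>z. (1 / (z - z0)) *\<^sub>B R0 w + (R0 z o\<^sub>L R0 w))"
  proof (rule circle_residue_cong)
    fix z assume zs: "z \<in> sphere z0 r"
    then have z: "z \<in> resolvent_set H0"
      by (rule free.sphere_in_resolvent_set[OF r])
    have "z - z0 \<noteq> 0"
      using zs r by auto
    have "R0 z o\<^sub>L (id_blinfun + (w - z0) *\<^sub>B R0 w) = R0 z + (w - z0) *\<^sub>B (R0 z o\<^sub>L R0 w)"
      by (rule blinfun_eqI) (simp add: blinfun.bilinear_simps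
          bounded_operators_scaleC[OF bounded_resolvent_in_bounded_operators[OF z]])
    also have "\<dots> = R0 w + ((z - w) *\<^sub>B (R0 z o\<^sub>L R0 w) + (w - z0) *\<^sub>B (R0 z o\<^sub>L R0 w))"
      unfolding resolvent_identity[OF z w, symmetric] by simp
    also have "\<dots> = R0 w + (z - z0) *\<^sub>B (R0 z o\<^sub>L R0 w)"
      by (simp flip: scaleC_blinfun.add_left)
    finally have "R0 z o\<^sub>L (id_blinfun + (w - z0) *\<^sub>B R0 w) = R0 w + (z - z0) *\<^sub>B (R0 z o\<^sub>L R0 w)" .
    then show "((1 / (z - z0)) *\<^sub>B R0 z) o\<^sub>L (id_blinfun + (w - z0) *\<^sub>B R0 w) =
        (1 / (z - z0)) *\<^sub>B R0 w + (R0 z o\<^sub>L R0 w)"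
      using \<open>z - z0 \<noteq> 0\<close>
      by (simp add: blinfun_compose_scaleC_left scaleC_blinfun.add_right scaleC_blinfun_scaleC_blinfun)
  qed (use r in simp)
  also have "\<dots> = circle_residue z0 r (\<lambda>z. (1 / (z - z0)) *\<^sub>B R0 w) +
      circle_residue z0 r (\<lambda>z. R0 z o\<^sub>L R0 w)"
    using r by (intro circle_residue_add scaleC_blinfun.continuous_on continuous_inverse
        continuous_on_const free.continuous_resolvent
        bounded_bilinear.continuous_on[OF bounded_bilinear_blinfun_compose]) auto
  also have "circle_residue z0 r (\<lambda>z. (1 / (z - z0)) *\<^sub>B R0 w) = R0 w"
    using r by (intro circle_residue_Cauchy_kernel) auto
  also have "circle_residue z0 r (\<lambda>z. R0 z o\<^sub>L R0 w) = - (P0 o\<^sub>L R0 w)"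
    using r circle_residue_compose_right[OF free.continuous_resolvent[OF r], of "R0 w"]
    by (simp add: riesz_moment_def bounded_bilinear.minus_left[OF bounded_bilinear_blinfun_compose])
  finally have "blinfun_apply (reduced_resolvent o\<^sub>L (id_blinfun + (w - z0) *\<^sub>B R0 w)) v =
      blinfun_apply (R0 w + - (P0 o\<^sub>L R0 w)) v"
    by simp
  then show ?thesis
    unfolding v by (simp add: blinfun.bilinear_simps x_eq)
qed

text \<open>\<open>R0 z\<close> and \<open>K z\<close> are \<open>R0 w\<close> and \<open>K w\<close> times the same operator function, so the claim
  reduces to \<open>V R0 w = - K w\<close>, and the unbounded \<open>V\<close> need not be moved under an integral.\<close>

lemma V_reduced_resolvent:
  "op_app V (blinfun_apply reduced_resolvent x) =
    - blinfun_apply (circle_residue z0 r (\<lambda>z. (1 / (z - z0)) *\<^sub>B K z)) x"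
proof -
  obtain w where w: "w \<in> resolvent_set H0"
    using free.sphere_in_resolvent_set[OF r, of "z0 + r"] r by (auto simp: dist_norm)
  define E where "E = circle_residue z0 r (\<lambda>z. (1 / (z - z0)) *\<^sub>B (id_blinfun + (z - w) *\<^sub>B R0 z))"
  have cont: "continuous_on (sphere z0 r) (\<lambda>z. (1 / (z - z0)) *\<^sub>B (id_blinfun + (z - w) *\<^sub>B R0 z))"
    by (intro scaleC_blinfun.continuous_on continuous_inverse free.continuous_resolvent r
        continuous_intros)
  have *: "circle_residue z0 r (\<lambda>z. (1 / (z - z0)) *\<^sub>B F z) = F w o\<^sub>L E"
    if "F w \<in> bounded_operators"
      "\<And>z. z \<in> resolvent_set H0 \<Longrightarrow> F z = F w o\<^sub>L (id_blinfun + (z - w) *\<^sub>B R0 z)" for F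
  proof -
    have "circle_residue z0 r (\<lambda>z. (1 / (z - z0)) *\<^sub>B F z) = circle_residue z0 r
        (\<lambda>z. F w o\<^sub>L ((1 / (z - z0)) *\<^sub>B (id_blinfun + (z - w) *\<^sub>B R0 z)))"
    proof (rule circle_residue_cong)
      fix z assume "z \<in> sphere z0 r"
      then have "F z = F w o\<^sub>L (id_blinfun + (z - w) *\<^sub>B R0 z)"
        using that(2) free.sphere_in_resolvent_set[OF r] by blast
      then show "(1 / (z - z0)) *\<^sub>B F z =
          F w o\<^sub>L ((1 / (z - z0)) *\<^sub>B (id_blinfun + (z - w) *\<^sub>B R0 z))"
        by (simp add: blinfun_compose_scaleC_right that(1))
    qed (use r in simp)
    also have "\<dots> = F w o\<^sub>L E"
      unfolding E_def using r cont that(1) by (intro circle_residue_compose_left[symmetric]) auto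
    finally show ?thesis .
  qed
  have "reduced_resolvent = R0 w o\<^sub>L E"
    unfolding reduced_resolvent_def
    by (rule *[where F = R0, OF bounded_resolvent_in_bounded_operators[OF w]])
      (rule resolvent_shift[OF _ w])
  moreover have "circle_residue z0 r (\<lambda>z. (1 / (z - z0)) *\<^sub>B K z) = K w o\<^sub>L E"
    by (rule *[where F = K, OF K_in_bounded_operators[OF w]]) (rule K_shift[OF _ w])
  ultimately show ?thesis
    by (simp add: K_apply[OF w])
qed

text \<open>For \<open>P0 x = 0\<close> and \<open>y = (H0 - z0) x\<close> the reduced resolvent \<open>S\<close> gives \<open>x = S y\<close> and
  \<open>(H - z0) x = y + V S y = (1 - K\<^sub>0) y\<close>. The Fredholm operator \<open>1 - K\<^sub>0\<close> is bounded below on the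
  orthogonal complement of its kernel.\<close>

lemma bounded_below_if_fredholm:
  assumes "fredholm (id_blinfun - circle_residue z0 r (\<lambda>z. (1 / (z - z0)) *\<^sub>B K z))"
  obtains U C where "finite U" "C > 0"
    "\<And>x. x \<in> op_dom H0 \<Longrightarrow> blinfun_apply P0 x = 0 \<Longrightarrow>
      (\<And>u. u \<in> U \<Longrightarrow> cinner u (op_app H0 x - z0 *\<^sub>C x) = 0) \<Longrightarrow>
      norm x \<le> C * norm (op_app H x - z0 *\<^sub>C x)"
proof -
  let ?K0 = "circle_residue z0 r (\<lambda>z. (1 / (z - z0)) *\<^sub>B K z)"
  obtain U C where U: "finite U" "C > 0"
    "\<And>x. (\<And>u. u \<in> U \<Longrightarrow> cinner u x = 0) \<Longrightarrow> norm x \<le> C * norm (blinfun_apply (id_blinfun - ?K0) x)"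
    using fredholm_bounded_below[OF assms] by blast
  have "norm x \<le> ((norm reduced_resolvent + 1) * C) * norm (op_app H x - z0 *\<^sub>C x)"
    if x: "x \<in> op_dom H0" "blinfun_apply P0 x = 0"
      "\<And>u. u \<in> U \<Longrightarrow> cinner u (op_app H0 x - z0 *\<^sub>C x) = 0" for x
  proof -
    define y where "y = op_app H0 x - z0 *\<^sub>C x"
    have Sy: "blinfun_apply reduced_resolvent y = x"
      using reduced_resolvent_inverse[OF x(1)] x(2) by (simp add: y_def)
    have "op_app H x - z0 *\<^sub>C x = y + op_app V (blinfun_apply reduced_resolvent y)"
      unfolding Sy by (simp add: y_def)
    also have "\<dots> = blinfun_apply (id_blinfun - ?K0) y"
      unfolding V_reduced_resolvent by (simp add: blinfun.diff_left)
    finally have "norm y \<le> C * norm (op_app H x - z0 *\<^sub>C x)"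
      using U(3)[of y] x(3) by (simp add: y_def)
    have "norm x \<le> norm reduced_resolvent * norm y"
      using norm_blinfun[of reduced_resolvent y] by (simp add: Sy)
    also have "\<dots> \<le> (norm reduced_resolvent + 1) * (C * norm (op_app H x - z0 *\<^sub>C x))"
      using \<open>norm y \<le> _\<close> by (intro mult_mono) auto
    finally show ?thesis
      by (simp add: mult.assoc)
  qed
  moreover have "(norm reduced_resolvent + 1) * C > 0"
    using U(2) by (intro mult_pos_pos add_nonneg_pos) auto
  ultimately show thesis
    using that U(1) by blast
qed

text \<open>The lower bound of \<open>bounded_below_if_fredholm\<close> is available for the first \<open>m\<close> iterates of \<open>x\<close>
  under \<open>H - z0\<close> once finitely many linear functionals vanish at \<open>x\<close>. An infinite-dimensional range
  of \<open>P\<close> contains such an \<open>x \<noteq> 0\<close>, against quasinilpotency.\<close>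

lemma finite_rank_perturbed_projection:
  assumes fin0: "finite_cdim (range (blinfun_apply P0))"
    and "fredholm (id_blinfun - circle_residue z0 r (\<lambda>z. (1 / (z - z0)) *\<^sub>B K z))"
  shows "finite_cdim (range (blinfun_apply P))"
proof (rule ccontr)
  assume infinite: "\<not> finite_cdim (range (blinfun_apply P))"
  let ?D = "riesz_moment H z0 r"
  obtain U C where U: "finite U" "C > 0"
    "\<And>x. x \<in> op_dom H0 \<Longrightarrow> blinfun_apply P0 x = 0 \<Longrightarrow>
      (\<And>u. u \<in> U \<Longrightarrow> cinner u (op_app H0 x - z0 *\<^sub>C x) = 0) \<Longrightarrow>
      norm x \<le> C * norm (op_app H x - z0 *\<^sub>C x)"
    using bounded_below_if_fredholm[OF assms(2)] by blast
  obtain U0 where U0: "orthonormal U0" "finite U0" "cspan U0 = range (blinfun_apply P0)"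
    using fin0 by (rule finite_cdim_orthonormal)
  obtain m where m: "\<And>x. blinfun_apply P x = x \<Longrightarrow>
    (\<And>k. k < m \<Longrightarrow> norm (blinfun_apply (?D k) x) \<le> C * norm (blinfun_apply (?D (Suc k)) x)) \<Longrightarrow> x = 0"
    using perturbed.no_lower_bound_along_moments[OF U(2) r] by blast
  define g where "g u k x = cinner u (blinfun_apply P0 (blinfun_apply (?D k) x))" for u k x
  define h where "h u k x = cinner u (op_app H0 (blinfun_apply (?D k) x) - z0 *\<^sub>C blinfun_apply (?D k) x)" for u k x
  define G where "G = (\<lambda>(u, k). g u k) ` (U0 \<times> {..<m}) \<union> (\<lambda>(u, k). h u k) ` (U \<times> {..<m})"
  have dom: "blinfun_apply (?D k) x \<in> op_dom H0" for k x
    using perturbed.moment_in_dom[OF r, of k x] by simp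
  have D_scaleC: "blinfun_apply (?D k) (a *\<^sub>C x) = a *\<^sub>C blinfun_apply (?D k) x" for k a x
    by (rule bounded_operators_scaleC[OF perturbed.moment_in_bounded_operators[OF r]])
  have P0_scaleC: "blinfun_apply P0 (a *\<^sub>C x) = a *\<^sub>C blinfun_apply P0 x" for a x
    by (rule bounded_operators_scaleC[OF free.moment_in_bounded_operators[OF r]])
  have H0_add: "op_app H0 (x + y) = op_app H0 x + op_app H0 y"
    if "x \<in> op_dom H0" "y \<in> op_dom H0" for x y
    using linear_H0 that unfolding linear_operator_def by auto
  have H0_scaleC: "op_app H0 (a *\<^sub>C x) = a *\<^sub>C op_app H0 x" if "x \<in> op_dom H0" for x a
    using linear_H0 that unfolding linear_operator_def by auto
  have "\<exists>x\<in>range (blinfun_apply P). x \<noteq> 0 \<and> (\<forall>f\<in>G. f x = 0)"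
  proof (rule ex_common_zero)
    show "finite G"
      unfolding G_def using U(1) U0(2) by auto
    show "csubspace (range (blinfun_apply P))"
      by (rule csubspace_range[OF perturbed.moment_in_bounded_operators[OF r]])
    show "f (x + y) = f x + f y" if "f \<in> G" for f x y
      using that dom unfolding G_def
      by (auto simp: g_def h_def blinfun.add_right cinner_add_right H0_add scaleC_add_right
          cinner_diff_right)
    show "f (a *\<^sub>C x) = a * f x" if "f \<in> G" for f a x
      using that dom unfolding G_def
      by (auto simp: g_def h_def D_scaleC P0_scaleC H0_scaleC cinner_scaleC_right
          cinner_diff_right algebra_simps)
  qed (rule infinite)
  then obtain x where x: "x \<in> range (blinfun_apply P)" "x \<noteq> 0" "\<And>f. f \<in> G \<Longrightarrow> f x = 0"
    by blast
  have "blinfun_apply P x = x"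
    using x(1) perturbed.projection_moment[OF r, of 0] by (metis (no_types, lifting) blinfun_apply_blinfun_compose imageE)
  moreover have "norm (blinfun_apply (?D k) x) \<le> C * norm (blinfun_apply (?D (Suc k)) x)" if "k < m" for k
  proof -
    let ?y = "blinfun_apply (?D k) x"
    have "cinner u (blinfun_apply P0 ?y) = 0" if "u \<in> U0" for u
    proof -
      have "g u k \<in> G"
        unfolding G_def using that \<open>k < m\<close> by (intro UnI1 image_eqI[of _ _ "(u, k)"]) auto
      then show ?thesis
        using x(3) unfolding g_def by blast
    qed
    then have "orthogonal_projection U0 (blinfun_apply P0 ?y) = 0"
      by (simp add: orthogonal_projection_def)
    then have "blinfun_apply P0 ?y = 0"
      using orthogonal_projection_ident[OF U0(1,2)] U0(3) by (metis rangeI)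
    moreover have "cinner u (op_app H0 ?y - z0 *\<^sub>C ?y) = 0" if "u \<in> U" for u
    proof -
      have "h u k \<in> G"
        unfolding G_def using that \<open>k < m\<close> by (intro UnI2 image_eqI[of _ _ "(u, k)"]) auto
      then show ?thesis
        using x(3) unfolding h_def by blast
    qed
    ultimately have "norm ?y \<le> C * norm (op_app H ?y - z0 *\<^sub>C ?y)"
      by (intro U(3) dom)
    then show ?thesis
      unfolding perturbed.operator_moment[OF r] .
  qed
  ultimately show False
    using m x(2) by blast
qed

end

section \<open>Index and multiplicities\<close>

text \<open>Split \<open>M = Ap - K w P0 C0\<close> and \<open>R = P R + (R - P R)\<close>, where \<open>Ap\<close> and \<open>R - P R\<close> are bounded near \<open>z0\<close>.
  The residues of \<open>M R\<close> and of \<open>R M = R0\<close> become sums of corresponding terms, and each term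
  carries \<open>P\<close> or \<open>P0\<close> as a left, middle or right factor outside the integral, so
  the traces of corresponding terms agree. The operators \<open>P0\<close> and \<open>P\<close> commute with \<open>C0\<close> and \<open>R\<close>,
  which allows them to be pulled out on the side needed.\<close>

lemma operator_index_formula:
  assumes r: "0 < r" "r < \<rho>"
    and basis: "\<exists>E :: 'a set. orthonormal_basis E"
    and fin0: "finite_cdim (range (blinfun_apply (riesz_moment H0 z0 r 0)))"
    and fin: "finite_cdim (range (blinfun_apply (riesz_moment H z0 r 0)))"
  shows "operator_index M z0 r = of_nat (cdim (range (blinfun_apply (riesz_moment H z0 r 0)))) -
    of_nat (cdim (range (blinfun_apply (riesz_moment H0 z0 r 0))))"
proof -
  define P where "P = riesz_moment H z0 r 0"
  define P0 where "P0 = riesz_moment H0 z0 r 0"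
  let ?D = "ball z0 \<rho> - {z0}"
  let ?res = "circle_residue z0 r"
  obtain w where w: "w \<in> resolvent_set H0" and w_ball: "w \<in> ball z0 \<rho>"
    using free.sphere_in_resolvent_set[OF r, of "z0 + r"] r by (auto simp: dist_norm)
  have in_sets: "z \<in> resolvent_set H0" "z \<in> resolvent_set H" if "z \<in> ?D" for z
    using disc that by auto
  \<comment> \<open>\<open>K z = K w C0 z\<close> by \<open>K_shift\<close>.\<close>
  define C0 where "C0 z = id_blinfun + (z - w) *\<^sub>B R0 z" for z
  \<comment> \<open>The part of \<open>M\<close> that stays bounded near \<open>z0\<close>.\<close>
  define Ap where "Ap z = id_blinfun - (K w o\<^sub>L (C0 z - (P0 o\<^sub>L C0 z)))" for z

  have P_op: "P \<in> bounded_operators" and P0_op: "P0 \<in> bounded_operators"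
    unfolding P_def P0_def
    by (rule perturbed.moment_in_bounded_operators[OF r], rule free.moment_in_bounded_operators[OF r])
  have Kw: "K w \<in> bounded_operators"
    by (rule K_in_bounded_operators[OF w])
  have hol_R: "operator_holomorphic_on R ?D" and hol_R0: "operator_holomorphic_on R0 ?D"
    by (rule perturbed.holomorphic_resolvent, rule free.holomorphic_resolvent)
  have hol_C0: "operator_holomorphic_on C0 ?D"
    unfolding C0_def by (intro operator_holomorphic_intros hol_R0 holomorphic_intros) auto
  have hol_Ap: "operator_holomorphic_on Ap ?D"
    unfolding Ap_def by (intro operator_holomorphic_intros hol_C0 Kw P0_op) auto
  have cont: "continuous_on (sphere z0 r) F" if "operator_holomorphic_on F ?D"
    for F :: "complex \<Rightarrow> 'a \<Rightarrow>\<^sub>L 'a"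
    using that r by (intro operator_holomorphic_on_imp_continuous_on[OF that]) auto
  have res_op: "?res F \<in> bounded_operators" if "operator_holomorphic_on F ?D"
    for F :: "complex \<Rightarrow> 'a \<Rightarrow>\<^sub>L 'a"
    using r by (intro circle_residue_in_bounded_operators cont that)
      (use that r in \<open>auto simp: operator_holomorphic_on_def\<close>)
  have C0_P0: "C0 z o\<^sub>L P0 = P0 o\<^sub>L C0 z" if "z \<in> ?D" for z
  proof (rule blinfun_eqI)
    fix x
    have "blinfun_apply (R0 z o\<^sub>L P0) x = blinfun_apply (P0 o\<^sub>L R0 z) x"
      unfolding P0_def using free.moment_commute_resolvent[OF r in_sets(1)[OF that]] by simp
    then show "blinfun_apply (C0 z o\<^sub>L P0) x = blinfun_apply (P0 o\<^sub>L C0 z) x"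
      by (simp add: C0_def blinfun.bilinear_simps bounded_operators_scaleC[OF P0_op])
  qed
  have R_P: "R z o\<^sub>L P = P o\<^sub>L R z" if "z \<in> ?D" for z
    unfolding P_def using perturbed.moment_commute_resolvent[OF r in_sets(2)[OF that]] by simp
  have M_split: "M z = Ap z - (K w o\<^sub>L P0 o\<^sub>L C0 z)" if "z \<in> ?D" for z
    unfolding M_def Ap_def K_shift[OF in_sets(1)[OF that] w] C0_def[symmetric]
    by (rule blinfun_eqI) (simp add: blinfun.bilinear_simps)

  obtain B where B: "B \<ge> 0" "\<And>z. z \<noteq> z0 \<Longrightarrow> dist z0 z < r / 2 \<Longrightarrow>
      norm (R z - (P o\<^sub>L R z)) \<le> B"
    using perturbed.resolvent_regular_part_bounded_left[OF r] unfolding P_def by blast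
  obtain B0 where B0: "B0 \<ge> 0" "\<And>z. z \<noteq> z0 \<Longrightarrow> dist z0 z < r / 2 \<Longrightarrow>
      norm (R0 z - (P0 o\<^sub>L R0 z)) \<le> B0"
    using free.resolvent_regular_part_bounded_left[OF r] unfolding P0_def by blast
  define BA where "BA = norm (id_blinfun :: 'a \<Rightarrow>\<^sub>L 'a) +
    norm (K w) * (norm (id_blinfun - P0) + 2 * \<rho> * B0)"
  have near: "z \<in> ?D" if "z \<noteq> z0" "dist z0 z < r / 2" for z
    using that r by auto
  have Ap_bound: "norm (Ap z) \<le> BA" if z: "z \<noteq> z0" "dist z0 z < r / 2" for z
  proof -
    have "C0 z - (P0 o\<^sub>L C0 z) = (id_blinfun - P0) + (z - w) *\<^sub>B (R0 z - (P0 o\<^sub>L R0 z))"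
      by (rule blinfun_eqI) (simp add: C0_def blinfun.bilinear_simps scaleC_diff_right
          bounded_operators_scaleC[OF P0_op])
    moreover have "cmod (z - w) \<le> 2 * \<rho>"
      using dist_triangle[of z w z0] z w_ball r by (simp add: dist_norm norm_minus_commute)
    then have "norm ((z - w) *\<^sub>B (R0 z - (P0 o\<^sub>L R0 z))) \<le> 2 * \<rho> * B0"
      using B0(2)[OF z] pos by (intro order_trans[OF norm_scaleC_blinfun_le] mult_mono) auto
    ultimately have "norm (C0 z - (P0 o\<^sub>L C0 z)) \<le> norm (id_blinfun - P0) + 2 * \<rho> * B0"
      by (metis (no_types, lifting) add_left_mono norm_triangle_ineq order_trans)
    then have "norm (K w o\<^sub>L (C0 z - (P0 o\<^sub>L C0 z))) \<le> norm (K w) * (norm (id_blinfun - P0) + 2 * \<rho> * B0)"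
      by (intro order_trans[OF norm_blinfun_compose] mult_left_mono) auto
    then show ?thesis
      unfolding Ap_def BA_def by (intro order_trans[OF norm_triangle_ineq4] add_left_mono)
  qed
  have "BA \<ge> 0"
    unfolding BA_def using B0(1) pos by (intro add_nonneg_nonneg mult_nonneg_nonneg) auto

  have zero_right: "?res (\<lambda>z. Ap z o\<^sub>L (R z - (P o\<^sub>L R z))) = 0"
  proof (rule circle_residue_bounded_eq_0[OF _ r])
    show "operator_holomorphic_on (\<lambda>z. Ap z o\<^sub>L (R z - (P o\<^sub>L R z))) ?D"
      by (intro operator_holomorphic_intros hol_Ap hol_R P_op)
    show "norm (Ap z o\<^sub>L (R z - (P o\<^sub>L R z))) \<le> BA * B" if "z \<noteq> z0" "dist z0 z < r / 2" for z
      using Ap_bound[OF that] B(2)[OF that] \<open>BA \<ge> 0\<close>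
      by (intro order_trans[OF norm_blinfun_compose] mult_mono) auto
  qed (use r in simp)
  have zero_left: "?res (\<lambda>z. (R z - (P o\<^sub>L R z)) o\<^sub>L Ap z) = 0"
  proof (rule circle_residue_bounded_eq_0[OF _ r])
    show "operator_holomorphic_on (\<lambda>z. (R z - (P o\<^sub>L R z)) o\<^sub>L Ap z) ?D"
      by (intro operator_holomorphic_intros hol_Ap hol_R P_op)
    show "norm ((R z - (P o\<^sub>L R z)) o\<^sub>L Ap z) \<le> B * BA" if "z \<noteq> z0" "dist z0 z < r / 2" for z
      using Ap_bound[OF that] B(2)[OF that] B(1)
      by (intro order_trans[OF norm_blinfun_compose] mult_mono) auto
  qed (use r in simp)

  define Z1 where "Z1 = ?res (\<lambda>z. C0 z o\<^sub>L R z)"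
  define Z2 where "Z2 = ?res (\<lambda>z. Ap z o\<^sub>L R z)"
  define Z3 where "Z3 = ?res (\<lambda>z. (R z o\<^sub>L K w) o\<^sub>L C0 z)"
  define Z4 where "Z4 = ?res (\<lambda>z. R z o\<^sub>L Ap z)"
  have hol1: "operator_holomorphic_on (\<lambda>z. C0 z o\<^sub>L R z) ?D"
    and hol2: "operator_holomorphic_on (\<lambda>z. Ap z o\<^sub>L R z) ?D"
    and hol3: "operator_holomorphic_on (\<lambda>z. (R z o\<^sub>L K w) o\<^sub>L C0 z) ?D"
    and hol4: "operator_holomorphic_on (\<lambda>z. R z o\<^sub>L Ap z) ?D"
    by (intro operator_holomorphic_intros hol_C0 hol_Ap hol_R Kw)+
  have Z_op: "Z1 \<in> bounded_operators" "Z2 \<in> bounded_operators" "Z3 \<in> bounded_operators"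
      "Z4 \<in> bounded_operators"
    unfolding Z1_def Z2_def Z3_def Z4_def by (intro res_op hol1 hol2 hol3 hol4)+
  have res_R: "?res R = - P" and res_R0: "?res R0 = - P0"
    unfolding P_def P0_def riesz_moment_def by simp_all
  have KP0_op: "K w o\<^sub>L P0 \<in> bounded_operators"
    using Kw P0_op by auto

  \<comment> \<open>The two products, without the terms that have residue zero.\<close>
  have MR: "?res (\<lambda>z. (M z o\<^sub>L R z) - R z) = (Z2 o\<^sub>L P) - (K w o\<^sub>L P0 o\<^sub>L Z1) + P"
  proof -
    have "?res (\<lambda>z. (M z o\<^sub>L R z) - R z) = ?res (\<lambda>z. (((Ap z o\<^sub>L R z) o\<^sub>L P) +
        (Ap z o\<^sub>L (R z - (P o\<^sub>L R z)))) - ((K w o\<^sub>L P0) o\<^sub>L (C0 z o\<^sub>L R z)) - R z)"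
    proof (rule circle_residue_cong)
      fix z assume "z \<in> sphere z0 r"
      then have z: "z \<in> ?D"
        using r by auto
      show "(M z o\<^sub>L R z) - R z = (((Ap z o\<^sub>L R z) o\<^sub>L P) +
          (Ap z o\<^sub>L (R z - (P o\<^sub>L R z)))) - ((K w o\<^sub>L P0) o\<^sub>L (C0 z o\<^sub>L R z)) - R z"
        unfolding M_split[OF z] R_P[OF z, symmetric]
        by (rule blinfun_eqI) (simp add: blinfun.bilinear_simps)
    qed (use r in simp)
    also have "\<dots> = ?res (\<lambda>z. (Ap z o\<^sub>L R z) o\<^sub>L P) + ?res (\<lambda>z. Ap z o\<^sub>L (R z - (P o\<^sub>L R z)))
        - ?res (\<lambda>z. (K w o\<^sub>L P0) o\<^sub>L (C0 z o\<^sub>L R z)) - ?res R"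
      using r by (simp add: circle_residue_add circle_residue_diff cont operator_holomorphic_intros
          hol1 hol2 hol_Ap hol_R P_op KP0_op)
    also have "?res (\<lambda>z. (Ap z o\<^sub>L R z) o\<^sub>L P) = Z2 o\<^sub>L P"
      unfolding Z2_def using r by (intro circle_residue_compose_right[symmetric] cont hol2) auto
    also have "?res (\<lambda>z. (K w o\<^sub>L P0) o\<^sub>L (C0 z o\<^sub>L R z)) = (K w o\<^sub>L P0) o\<^sub>L Z1"
      unfolding Z1_def using r by (intro circle_residue_compose_left[symmetric] cont hol1 KP0_op) auto
    finally show ?thesis
      by (simp add: zero_right res_R)
  qed

  have RM: "- P0 = (P o\<^sub>L Z4) - (Z3 o\<^sub>L P0)"
  proof -
    have "?res R0 = ?res (\<lambda>z. ((P o\<^sub>L (R z o\<^sub>L Ap z)) + ((R z - (P o\<^sub>L R z)) o\<^sub>L Ap z)) -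
        (((R z o\<^sub>L K w) o\<^sub>L C0 z) o\<^sub>L P0))"
    proof (rule circle_residue_cong)
      fix z assume "z \<in> sphere z0 r"
      then have z: "z \<in> ?D"
        using r by auto
      have "R0 z = R z o\<^sub>L (Ap z - (K w o\<^sub>L P0 o\<^sub>L C0 z))"
        unfolding M_split[OF z, symmetric] by (rule resolvent_M[OF in_sets[OF z], symmetric])
      also have "K w o\<^sub>L P0 o\<^sub>L C0 z = K w o\<^sub>L (C0 z o\<^sub>L P0)"
        unfolding C0_P0[OF z] by (simp add: blinfun_compose_assoc)
      finally show "R0 z = ((P o\<^sub>L (R z o\<^sub>L Ap z)) + ((R z - (P o\<^sub>L R z)) o\<^sub>L Ap z)) -
          (((R z o\<^sub>L K w) o\<^sub>L C0 z) o\<^sub>L P0)"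
        by (simp only:) (rule blinfun_eqI, simp add: blinfun.bilinear_simps)
    qed (use r in simp)
    also have "\<dots> = ?res (\<lambda>z. P o\<^sub>L (R z o\<^sub>L Ap z)) + ?res (\<lambda>z. (R z - (P o\<^sub>L R z)) o\<^sub>L Ap z)
        - ?res (\<lambda>z. ((R z o\<^sub>L K w) o\<^sub>L C0 z) o\<^sub>L P0)"
      using r by (simp add: circle_residue_add circle_residue_diff cont operator_holomorphic_intros
          hol3 hol4 hol_Ap hol_R P_op P0_op)
    also have "?res (\<lambda>z. P o\<^sub>L (R z o\<^sub>L Ap z)) = P o\<^sub>L Z4"
      unfolding Z4_def using r by (intro circle_residue_compose_left[symmetric] cont hol4 P_op) auto
    also have "?res (\<lambda>z. ((R z o\<^sub>L K w) o\<^sub>L C0 z) o\<^sub>L P0) = Z3 o\<^sub>L P0"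
      unfolding Z3_def using r by (intro circle_residue_compose_right[symmetric] cont hol3) auto
    finally show ?thesis
      by (simp add: zero_left res_R0)
  qed

  define E where "E = (SOME E :: 'a set. orthonormal_basis E)"
  have E: "orthonormal_basis E"
    unfolding E_def using basis by (rule someI_ex)
  define has_trace where "has_trace T t \<longleftrightarrow> ((\<lambda>e. cinner e (blinfun_apply T e)) has_sum t) E" for T t
  have trace_add: "has_trace (S + T) (s + t)" if "has_trace S s" "has_trace T t" for S T s t
    using has_sum_add[OF that[unfolded has_trace_def]] unfolding has_trace_def
    by (simp add: blinfun.add_left cinner_add_right)
  have trace_minus: "has_trace (- T) (- t)" if "has_trace T t" for T t
    using has_sum_uminusI[OF that[unfolded has_trace_def]] unfolding has_trace_def
    by (simp add: blinfun.minus_left cinner_minus_right)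
  have trace_diff: "has_trace (S - T) (s - t)" if "has_trace S s" "has_trace T t" for S T s t
    using trace_add[OF that(1) trace_minus[OF that(2)]] by simp
  have trace_unique: "s = t" if "has_trace T s" "has_trace T t" for T s t
    using that has_sum_unique unfolding has_trace_def by blast

  obtain U where U: "orthonormal U" "finite U" "cspan U = range (blinfun_apply P)"
    using fin unfolding P_def by (rule finite_cdim_orthonormal)
  obtain U0 where U0: "orthonormal U0" "finite U0" "cspan U0 = range (blinfun_apply P0)"
    using fin0 unfolding P0_def by (rule finite_cdim_orthonormal)
  have trace_P: "has_trace P (of_nat (cdim (range (blinfun_apply P))))"
    unfolding has_trace_def using fin P_op perturbed.projection_moment[OF r, of 0]
    by (intro has_sum_trace_projection E) (simp_all add: P_def)
  have trace_P0: "has_trace P0 (of_nat (cdim (range (blinfun_apply P0))))"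
    unfolding has_trace_def using fin0 P0_op free.projection_moment[OF r, of 0]
    by (intro has_sum_trace_projection E) (simp_all add: P0_def)

  have trace1: "has_trace (K w o\<^sub>L P0 o\<^sub>L Z1) (\<Sum>u\<in>U0. cinner u (blinfun_apply (P0 o\<^sub>L Z1 o\<^sub>L K w) u))"
    unfolding has_trace_def by (rule has_sum_trace_sandwich[OF E U0 P0_op Kw Z_op(1)])
  have trace3: "has_trace (Z3 o\<^sub>L P0) (\<Sum>u\<in>U0. cinner u (blinfun_apply (P0 o\<^sub>L Z3) u))"
    using has_sum_trace_sandwich[OF E U0 P0_op Z_op(3), of id_blinfun]
    by (simp add: has_trace_def bounded_operators_intros)
  have trace2: "has_trace (Z2 o\<^sub>L P) (\<Sum>u\<in>U. cinner u (blinfun_apply (P o\<^sub>L Z2) u))"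
    using has_sum_trace_sandwich[OF E U P_op Z_op(2), of id_blinfun]
    by (simp add: has_trace_def bounded_operators_intros)
  have trace4: "has_trace (P o\<^sub>L Z4) (\<Sum>u\<in>U. cinner u (blinfun_apply (P o\<^sub>L Z4) u))"
    using has_sum_trace_sandwich[OF E U P_op, of id_blinfun Z4] Z_op(4)
    by (simp add: has_trace_def bounded_operators_intros)

  have "P0 o\<^sub>L Z1 o\<^sub>L K w = ?res (\<lambda>z. P0 o\<^sub>L (C0 z o\<^sub>L R z) o\<^sub>L K w)"
    unfolding Z1_def using r
    by (simp add: circle_residue_compose_left circle_residue_compose_right cont hol1 P0_op
        operator_holomorphic_intros)
  moreover have "P0 o\<^sub>L Z3 = ?res (\<lambda>z. P0 o\<^sub>L ((R z o\<^sub>L K w) o\<^sub>L C0 z))"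
    unfolding Z3_def using r by (intro circle_residue_compose_left cont hol3 P0_op) auto
  moreover have "(\<Sum>u\<in>U0. cinner u (blinfun_apply (?res (\<lambda>z. P0 o\<^sub>L (C0 z o\<^sub>L R z) o\<^sub>L K w)) u)) =
      (\<Sum>u\<in>U0. cinner u (blinfun_apply (?res (\<lambda>z. P0 o\<^sub>L ((R z o\<^sub>L K w) o\<^sub>L C0 z))) u))"
  proof (rule sum_cinner_circle_residue_cong[OF U0(2)])
    show "continuous_on (sphere z0 r) (\<lambda>z. P0 o\<^sub>L (C0 z o\<^sub>L R z) o\<^sub>L K w)"
      "continuous_on (sphere z0 r) (\<lambda>z. P0 o\<^sub>L ((R z o\<^sub>L K w) o\<^sub>L C0 z))"
      by (intro cont operator_holomorphic_intros hol_C0 hol_R Kw P0_op)+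
    fix z assume "z \<in> sphere z0 r"
    then have z: "z \<in> ?D"
      using r by auto
    have ops: "C0 z \<in> bounded_operators" "R z o\<^sub>L K w \<in> bounded_operators"
      using hol_C0 hol_R Kw z unfolding operator_holomorphic_on_def by auto
    show "(\<Sum>u\<in>U0. cinner u (blinfun_apply (P0 o\<^sub>L (C0 z o\<^sub>L R z) o\<^sub>L K w) u)) =
        (\<Sum>u\<in>U0. cinner u (blinfun_apply (P0 o\<^sub>L ((R z o\<^sub>L K w) o\<^sub>L C0 z)) u))"
      using finite_rank_functional_commute[OF E U0 P0_op ops C0_P0[OF z]] by simp
  qed (use r in simp)
  ultimately have eq13: "(\<Sum>u\<in>U0. cinner u (blinfun_apply (P0 o\<^sub>L Z1 o\<^sub>L K w) u)) =
      (\<Sum>u\<in>U0. cinner u (blinfun_apply (P0 o\<^sub>L Z3) u))"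
    by simp

  have "P o\<^sub>L Z2 = ?res (\<lambda>z. P o\<^sub>L (Ap z o\<^sub>L R z))" "P o\<^sub>L Z4 = ?res (\<lambda>z. P o\<^sub>L (R z o\<^sub>L Ap z))"
    unfolding Z2_def Z4_def using r
    by (intro circle_residue_compose_left cont hol2 hol4 P_op; simp)+
  moreover have "(\<Sum>u\<in>U. cinner u (blinfun_apply (?res (\<lambda>z. P o\<^sub>L (Ap z o\<^sub>L R z))) u)) =
      (\<Sum>u\<in>U. cinner u (blinfun_apply (?res (\<lambda>z. P o\<^sub>L (R z o\<^sub>L Ap z))) u))"
  proof (rule sum_cinner_circle_residue_cong[OF U(2)])
    show "continuous_on (sphere z0 r) (\<lambda>z. P o\<^sub>L (Ap z o\<^sub>L R z))"
      "continuous_on (sphere z0 r) (\<lambda>z. P o\<^sub>L (R z o\<^sub>L Ap z))"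
      by (intro cont operator_holomorphic_intros hol_Ap hol_R P_op)+
    fix z assume "z \<in> sphere z0 r"
    then have z: "z \<in> ?D"
      using r by auto
    have ops: "R z \<in> bounded_operators" "Ap z \<in> bounded_operators"
      using hol_Ap hol_R z unfolding operator_holomorphic_on_def by auto
    show "(\<Sum>u\<in>U. cinner u (blinfun_apply (P o\<^sub>L (Ap z o\<^sub>L R z)) u)) =
        (\<Sum>u\<in>U. cinner u (blinfun_apply (P o\<^sub>L (R z o\<^sub>L Ap z)) u))"
      using finite_rank_functional_commute[OF E U P_op ops R_P[OF z]] by simp
  qed (use r in simp)
  ultimately have eq24: "(\<Sum>u\<in>U. cinner u (blinfun_apply (P o\<^sub>L Z2) u)) =
      (\<Sum>u\<in>U. cinner u (blinfun_apply (P o\<^sub>L Z4) u))"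
    by simp

  \<comment> \<open>\<open>RM\<close> determines the difference of the traces that the two products share.\<close>
  define t2 where "t2 = (\<Sum>u\<in>U. cinner u (blinfun_apply (P o\<^sub>L Z4) u))"
  define t3 where "t3 = (\<Sum>u\<in>U0. cinner u (blinfun_apply (P0 o\<^sub>L Z3) u))"
  have "has_trace (- P0) (t2 - t3)"
    using trace_diff[OF trace4 trace3] unfolding RM[symmetric] t2_def t3_def .
  then have "t2 - t3 = - of_nat (cdim (range (blinfun_apply P0)))"
    by (rule trace_unique[OF _ trace_minus[OF trace_P0]])
  moreover have "has_trace (?res (\<lambda>z. (M z o\<^sub>L R z) - R z))
      (t2 - t3 + of_nat (cdim (range (blinfun_apply P))))"
    unfolding MR t2_def t3_def eq13[symmetric] eq24[symmetric]
    by (intro trace_add trace_diff trace1 trace2 trace_P)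
  ultimately have "trace_operator (?res (\<lambda>z. (M z o\<^sub>L R z) - R z)) =
      of_nat (cdim (range (blinfun_apply P))) - of_nat (cdim (range (blinfun_apply P0)))"
    unfolding has_trace_def trace_operator_def E_def by (simp add: infsumI)
  moreover have "operator_index M z0 r = trace_operator (?res (\<lambda>z. (M z o\<^sub>L R z) - R z))"
  proof -
    have "operator_index M z0 r =
        trace_operator (?res (\<lambda>z. operator_deriv M z o\<^sub>L inverse_operator (M z)))"
      unfolding operator_index_def circle_residue_def ..
    also have "?res (\<lambda>z. operator_deriv M z o\<^sub>L inverse_operator (M z)) = ?res (\<lambda>z. (M z o\<^sub>L R z) - R z)"
    proof (rule circle_residue_cong)
      fix z assume "z \<in> sphere z0 r"
      then have "z \<in> ?D"
        using r by auto
      then show "operator_deriv M z o\<^sub>L inverse_operator (M z) = (M z o\<^sub>L R z) - R z"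
        by (intro logarithmic_derivative in_sets)
    qed (use r in simp)
    finally show ?thesis .
  qed
  ultimately show ?thesis
    by (simp add: P_def P0_def)
qed

end

theorem theorem5p9:
  fixes H0 V H :: "'a::complex_hilbert_space operator"
    and z0 :: complex
    and \<epsilon>0 :: real
    and N0 :: nat
    and K :: "complex \<Rightarrow> ('a \<Rightarrow>\<^sub>L 'a)"
    and Kcoeff :: "int \<Rightarrow> ('a \<Rightarrow>\<^sub>L 'a)"
  assumes "separable_space (euclidean :: 'a topology)"
    and "closed_operator H0"
    and "resolvent_set H0 \<noteq> {}"
    and "linear_operator V"
    and "op_dom H0 \<subseteq> op_dom V"
    and "H = operator_plus H0 V"
    and "resolvent_set H \<noteq> {}"
    and "\<exists>z\<in>resolvent_set H0. bounded_clinear (birman_schwinger H0 V z)"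
    and "K = (\<lambda>z. Blinfun (birman_schwinger H0 V z))"
    and "z0 \<in> discrete_spectrum H0 \<inter> operator_spectrum H"
    and "\<epsilon>0 > 0"
    and "ball z0 \<epsilon>0 - {z0} \<subseteq> resolvent_set H0 \<inter> resolvent_set H"
    and "has_operator_laurent_expansion K z0 \<epsilon>0 N0 Kcoeff"
    and "fredholm (id_blinfun - Kcoeff 0)"
  shows "z0 \<in> discrete_spectrum H \<and>
    (\<forall>\<epsilon>. 0 < \<epsilon> \<and> \<epsilon> < \<epsilon>0 \<longrightarrow>
      of_nat (algebraic_multiplicity H z0) =
        of_nat (algebraic_multiplicity H0 z0) + operator_index (\<lambda>z. id_blinfun - K z) z0 \<epsilon>)"
proof -
  interpret pair: birman_schwinger_pair H0 V z0 \<epsilon>0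
    using assms unfolding closed_operator_def by unfold_locales auto
  have K: "K = pair.K"
    using assms(9) by (simp add: fun_eq_iff pair.K_def)
  have z0_H0: "z0 \<in> operator_spectrum H0"
    and fin_riesz: "finite_cdim (range (blinfun_apply (riesz_projection H0 z0)))"
    using assms(10) unfolding discrete_spectrum_def isolated_in_def by auto
  have z0_H: "z0 \<in> operator_spectrum (operator_plus H0 V)"
    using assms(6,10) by blast
  have fin0: "finite_cdim (range (blinfun_apply (riesz_moment H0 z0 r 0)))"
    if "0 < r" "r < \<epsilon>0" for r
    using fin_riesz pair.free.riesz_projection_eq_moment[OF z0_H0 that] by simp
  have fin: "finite_cdim (range (blinfun_apply (riesz_moment (operator_plus H0 V) z0 r 0)))"
    if r: "0 < r" "r < \<epsilon>0" for r
  proof (rule pair.finite_rank_perturbed_projection[OF r fin0[OF r]])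
    have "continuous_on (sphere z0 r) K"
      unfolding K using pair.free.sphere_in_resolvent_set[OF r]
      by (intro operator_holomorphic_on_imp_continuous_on[OF pair.operator_holomorphic_on_K[OF subset_refl]])
        auto
    then have "Kcoeff 0 = circle_residue z0 r (\<lambda>z. (1 / (z - z0)) *\<^sub>B K z)"
      by (rule laurent_coefficient_0_eq_residue[OF assms(13) _ r])
    then show "fredholm (id_blinfun - circle_residue z0 r (\<lambda>z. (1 / (z - z0)) *\<^sub>B pair.K z))"
      using assms(14) by (simp add: K)
  qed
  have half: "0 < \<epsilon>0 / 2" "\<epsilon>0 / 2 < \<epsilon>0"
    using assms(11) by auto
  have "z0 \<in> discrete_spectrum H"
    unfolding discrete_spectrum_def assms(6)
  proof (intro CollectI conjI)
    show "eigenvalue (operator_plus H0 V) z0"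
      by (rule pair.perturbed.eigenvalue_if_finite_rank[OF z0_H half fin[OF half]])
    have "ball z0 \<epsilon>0 \<inter> operator_spectrum (operator_plus H0 V) = {z0}"
      using assms(6,11,12) z0_H unfolding operator_spectrum_def by auto
    then show "z0 isolated_in operator_spectrum (operator_plus H0 V)"
      unfolding isolated_in_def using z0_H open_ball by blast
    show "finite_cdim (range (blinfun_apply (riesz_projection (operator_plus H0 V) z0)))"
      using fin[OF half] pair.perturbed.riesz_projection_eq_moment[OF z0_H half] by simp
  qed
  moreover have "of_nat (algebraic_multiplicity H z0) =
      of_nat (algebraic_multiplicity H0 z0) + operator_index (\<lambda>z. id_blinfun - K z) z0 \<epsilon>"
    if r: "0 < \<epsilon>" "\<epsilon> < \<epsilon>0" for \<epsilon>
  proof -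
    have "(\<lambda>z. id_blinfun - K z) = pair.M"
      by (simp add: fun_eq_iff K pair.M_def)
    then show ?thesis
      using pair.operator_index_formula[OF r ex_orthonormal_basis[OF assms(1)] fin0[OF r] fin[OF r]]
        pair.perturbed.riesz_projection_eq_moment[OF z0_H r]
        pair.free.riesz_projection_eq_moment[OF z0_H0 r]
      by (simp add: algebraic_multiplicity_def assms(6))
  qed
  ultimately show ?thesis
    by blast
qed

end
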